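(* Let $\mathcal{X}:|\mathcal{X}|\to\mathbf{Set}$ be a posetal pre-stack, and consider the conditions (R1), (R2) given in the context. 1. $\mathcal{X}$ is equivalent to a realizability hyperdoctrine if and only if it satisfies (R1) and (R2), and $\gamma\cong\pi:\mathcal{X}\to\mathrm{sub}(\mathbf{Set})$. 2. $\mathcal{X}$ is equivalent to a realizability tripos, if (it satisfies (R1), (R2) and $\gamma\cong\pi$, and) the family of predicates $(\pi_i)_{i\in I}$ in (R2) can moreover be chosen to comprise a single predicate.
   Context: **Posetal fibrations.** A posetal fibration $\mathcal{X}:|\mathcal{X}|\to\mathbf{Set}$ is a fibration that is faithful as a functor; fibers $\mathcal{X}_M$ are preorders (of predicates on $M$); $u^*$ is reindexing. It is a pre-stack if $e^*\varphi\le e^*\psi$ implies $\varphi\le\psi$ for every surjection $e$. Equivalence means fibered equivalence over $\mathbf{Set}$. **(R1)** $\mathcal{X}$ models $\top,\wedge,\Rightarrow,\exists,\forall$: fibers have finite meets and Heyting implication preserved by reindexing, and all $u^*$ have left adjoints $\exists_u$ and right adjoints $\forall_u$ satisfying Beck–Chevalley. **(R2)** There exist a family $(A_i)_{i\in I}$ of sets and $\exists$-prime predicates $(\pi_i\in\mathcal{X}_{A_i})_{i\in I}$ such that the full subfibration $\mathcal{A}\subseteq\mathcal{X}$ on predicates isomorphic to some $f^*\pi_i$ is closed under finite meets, all $\pi_i$ are modest in $\mathcal{A}$, and every $\varphi\in\mathcal{X}_M$ is isomorphic to $\exists_u\psi$ for some $u:N\to M$, $\psi\in\mathcal{A}_N$.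 $\pi\in\mathcal{X}_I$ is $\exists$-prime if whenever $I\xleftarrow{u}J\xleftarrow{v}K$, $\theta\in\mathcal{X}_K$ satisfy $u^*\pi\le\exists_v\theta$, there are a surjection $e:L\to J$ and $w:L\to K$ with $vw=e$ and $(ue)^*\pi\le w^*\theta$. $\mu\in\mathcal{A}_I$ is modest in $\mathcal{A}$ if for any span $J\xleftarrow{e}K\xrightarrow{f}I$ with $e$ surjective and $\varphi\in\mathcal{A}_J$ with $e^*\varphi\le f^*\mu$ there is $h:J\to I$ with $he=f$ and $\varphi\le h^*\mu$. **$\delta,\pi,\gamma$.** $\mathrm{sub}(\mathbf{Set})$ is the subset (subobject) fibration. $\delta:\mathrm{sub}(\mathbf{Set})\to\mathcal{X}$ sends $m:U\hookrightarrow M$ to $\exists_m\top$. For $\mathcal{X}$ satisfying (R1) and (R2), $\delta$ has a finite meet preserving fibered left adjoint, denoted $\pi:\mathcal{X}\to\mathrm{sub}(\mathbf{Set})$. $\gamma:\mathcal{X}\to\mathrm{sub}(\mathbf{Set})$ is defined by $\gamma(\varphi)=\{m\in M\mid\top\le m^*\varphi\}$ for $\varphi\in\mathcal{X}_M$ (elements regarded as maps $1\to M$). **Realizability hyperdoctrines and triposes.** Application is partial, associates to the left, written by juxtaposition; $t\!\downarrow$ means $t$ is defined; asserted equations or memberships imply definedness; $t\succeq s$ means that if $s$ is defined then so is $t$ and $s=t$. A typed pca $(I,(\mathcal{B}_i)_{i\in I})$ is a set $I$ with binary operations $*,\Rightarrow$ ($\Rightarrow$ associating to the right), sets $\mathcal{B}_i$,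 partial application maps $\mathcal{B}_{i\Rightarrow j}\times\mathcal{B}_i\rightharpoonup\mathcal{B}_j$, such that for all $i,j,k$ there exist $\mathsf{k}\in\mathcal{B}_{i\Rightarrow j\Rightarrow i}$, $\mathsf{s}\in\mathcal{B}_{(i\Rightarrow j\Rightarrow k)\Rightarrow(i\Rightarrow j)\Rightarrow i\Rightarrow k}$, $\mathsf{pair}\in\mathcal{B}_{i\Rightarrow j\Rightarrow(i*j)}$, $\mathsf{fst}\in\mathcal{B}_{(i*j)\Rightarrow i}$, $\mathsf{snd}\in\mathcal{B}_{(i*j)\Rightarrow j}$ with $\mathsf{k}xy=x$, $\mathsf{s}xy\!\downarrow$, $\mathsf{s}xyz\succeq xz(yz)$, $\mathsf{fst}(\mathsf{pair}\,x\,y)=x$, $\mathsf{snd}(\mathsf{pair}\,x\,y)=y$. Its realizability hyperdoctrine has as predicates on $M$ the pairs $(i,\varphi:M\to P\mathcal{B}_i)$, with $(i,\varphi)\le(j,\psi)$ iff $\exists e\in\mathcal{B}_{i\Rightarrow j}\,\forall m\,\forall a\in\varphi(m):ea\in\psi(m)$, reindexing by precomposition. A pca is a set $\mathcal{B}$ with a partial binary application such that there are $\mathsf{k},\mathsf{s}\in\mathcal{B}$ with $\mathsf{k}xy=x$, $\mathsf{s}xy\!\downarrow$, $\mathsf{s}xyz\succeq xz(yz)$. Its realizability tripos has as predicates on $M$ the functions $\varphi:M\to P\mathcal{B}$, with $\varphi\le\psi$ iff $\exists e\in\mathcal{B}\,\forall m\,\forall a\in\varphi(m):ea\in\psi(m)$,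 reindexing by precomposition.
   Formalization: A typed pca is required to have a non-empty set I of types (for I empty the hyperdoctrine has no ⊤, so (R1) fails) and kx must be defined for every x in B_i even when B_j is empty (otherwise the order of the hyperdoctrine need not be transitive). *)

theory Defs
  imports "HOL-Library.FuncSet"
begin

section \<open>Categories and functors\<close>

record ('o, 'a) cat =
  Obj :: "'o set"
  Arr :: "'a set"
  Dom :: "'a \<Rightarrow> 'o"
  Cod :: "'a \<Rightarrow> 'o"
  Ident :: "'o \<Rightarrow> 'a"
  Comp :: "'a \<Rightarrow> 'a \<Rightarrow> 'a"

text \<open>\<open>Comp C g f\<close> is ``g after f''.\<close>

definition hom :: "('o, 'a) cat \<Rightarrow> 'o \<Rightarrow> 'o \<Rightarrow> 'a set" where
  "hom C x y = {f \<in> Arr C. Dom C f = x \<and> Cod C f = y}"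

definition category :: "('o, 'a) cat \<Rightarrow> bool" where
  "category C \<longleftrightarrow>
     (\<forall>f\<in>Arr C. Dom C f \<in> Obj C \<and> Cod C f \<in> Obj C) \<and>
     (\<forall>x\<in>Obj C. Ident C x \<in> hom C x x) \<and>
     (\<forall>x y z. \<forall>f\<in>hom C x y. \<forall>g\<in>hom C y z. Comp C g f \<in> hom C x z) \<and>
     (\<forall>x y. \<forall>f\<in>hom C x y. Comp C f (Ident C x) = f \<and> Comp C (Ident C y) f = f) \<and>
     (\<forall>w x y z. \<forall>f\<in>hom C w x. \<forall>g\<in>hom C x y. \<forall>h\<in>hom C y z.
        Comp C h (Comp C g f) = Comp C (Comp C h g) f)"

definition iso_arr :: "('o, 'a) cat \<Rightarrow> 'a \<Rightarrow> bool" where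
  "iso_arr C f \<longleftrightarrow> f \<in> Arr C \<and>
     (\<exists>g\<in>hom C (Cod C f) (Dom C f).
        Comp C g f = Ident C (Dom C f) \<and> Comp C f g = Ident C (Cod C f))"

definition is_pullback :: "('o, 'a) cat \<Rightarrow> 'a \<Rightarrow> 'a \<Rightarrow> 'a \<Rightarrow> 'a \<Rightarrow> bool" where
  "is_pullback C p q u v \<longleftrightarrow>
     p \<in> Arr C \<and> q \<in> Arr C \<and> u \<in> Arr C \<and> v \<in> Arr C \<and>
     Dom C p = Dom C q \<and> Cod C p = Dom C u \<and> Cod C q = Dom C v \<and> Cod C u = Cod C v \<and>
     Comp C u p = Comp C v q \<and>
     (\<forall>Z. \<forall>a\<in>hom C Z (Dom C u). \<forall>b\<in>hom C Z (Dom C v). Comp C u a = Comp C v b \<longrightarrow>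
        (\<exists>!h. h \<in> hom C Z (Dom C p) \<and> Comp C p h = a \<and> Comp C q h = b))"

record ('o, 'a, 'p, 'b) ftor =
  on_obj :: "'o \<Rightarrow> 'p"
  on_arr :: "'a \<Rightarrow> 'b"

definition is_ftor :: "('o, 'a) cat \<Rightarrow> ('p, 'b) cat \<Rightarrow> ('o, 'a, 'p, 'b) ftor \<Rightarrow> bool" where
  "is_ftor C D F \<longleftrightarrow>
     (\<forall>x\<in>Obj C. on_obj F x \<in> Obj D) \<and>
     (\<forall>x y. \<forall>f\<in>hom C x y. on_arr F f \<in> hom D (on_obj F x) (on_obj F y)) \<and>
     (\<forall>x\<in>Obj C. on_arr F (Ident C x) = Ident D (on_obj F x)) \<and>
     (\<forall>x y z. \<forall>f\<in>hom C x y. \<forall>g\<in>hom C y z.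
        on_arr F (Comp C g f) = Comp D (on_arr F g) (on_arr F f))"

definition faithful :: "('o, 'a) cat \<Rightarrow> ('o, 'a, 'p, 'b) ftor \<Rightarrow> bool" where
  "faithful C F \<longleftrightarrow>
     (\<forall>x y. \<forall>f\<in>hom C x y. \<forall>g\<in>hom C x y. on_arr F f = on_arr F g \<longrightarrow> f = g)"

definition id_ftor :: "('o, 'a, 'o, 'a) ftor" where
  "id_ftor = \<lparr>on_obj = (\<lambda>x. x), on_arr = (\<lambda>f. f)\<rparr>"

definition comp_ftor :: "('p, 'b, 'q, 'c) ftor \<Rightarrow> ('o, 'a, 'p, 'b) ftor \<Rightarrow> ('o, 'a, 'q, 'c) ftor" where
  "comp_ftor G F = \<lparr>on_obj = on_obj G \<circ> on_obj F, on_arr = on_arr G \<circ> on_arr F\<rparr>"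


section \<open>The category of sets\<close>

text \<open>
  The category of sets is that of an arbitrary universe of sets: a type \<open>'v\<close> with
  \<open>elts x\<close> the extension of \<open>x\<close>, satisfying (second-order) ZF; choice is inherited from HOL.
  Families, functions and subsets are genuine HOL ones, so that separation and replacement
  range over all HOL predicates and functions.
\<close>

definition set_universe :: "('v \<Rightarrow> 'v set) \<Rightarrow> bool" where
  "set_universe elts \<longleftrightarrow>
     (\<forall>x y. elts x = elts y \<longrightarrow> x = y) \<and>
     wf {(x, y). x \<in> elts y} \<and>
     (\<forall>x y. \<exists>z. elts z = {x, y}) \<and>
     (\<forall>x. \<exists>z. elts z = \<Union> (elts ` elts x)) \<and>
     (\<forall>x. \<exists>z. elts z = {y. elts y \<subseteq> elts x}) \<and>
     (\<forall>x P. \<exists>z. elts z = {y \<in> elts x. P y}) \<and>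
     (\<forall>x f. \<exists>z. elts z = f ` elts x) \<and>
     (\<exists>x. infinite (elts x))"

text \<open>
  A set is represented by its extension, a subset of \<open>'v\<close> in the range of \<open>elts\<close>;
  a function is a triple of domain, extensional map, codomain.
\<close>

type_synonym 'v setfun = "'v set \<times> ('v \<Rightarrow> 'v) \<times> 'v set"
type_synonym 'v setcat = "('v set, 'v setfun) cat"

definition fn :: "'v setfun \<Rightarrow> 'v \<Rightarrow> 'v" where
  "fn u = fst (snd u)"

definition set_cat :: "('v \<Rightarrow> 'v set) \<Rightarrow> 'v setcat" where
  "set_cat elts = \<lparr>
     Obj = range elts,
     Arr = {(M, f, N) | M f N. M \<in> range elts \<and> N \<in> range elts \<and> f \<in> M \<rightarrow>\<^sub>E N},
     Dom = fst,
     Cod = snd \<circ> snd,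
     Ident = (\<lambda>M. (M, restrict id M, M)),
     Comp = (\<lambda>v u. (fst u, restrict (fn v \<circ> fn u) (fst u), snd (snd v)))\<rparr>"

definition surjection :: "'v setfun \<Rightarrow> bool" where
  "surjection u \<longleftrightarrow> fn u ` fst u = snd (snd u)"

definition inclusion :: "'v set \<Rightarrow> 'v set \<Rightarrow> 'v setfun" where
  "inclusion U M = (U, restrict id U, M)"

text \<open>The terminal object; any one-element set would do.\<close>

definition one_set :: "'v set" where
  "one_set = {undefined}"

definition point :: "'v set \<Rightarrow> 'v \<Rightarrow> 'v setfun" where
  "point M m = (one_set, restrict (\<lambda>_. m) one_set, M)"


section \<open>Fibrations\<close>

record ('o, 'a, 'p, 'b) fib =
  Base :: "('p, 'b) cat"
  Total :: "('o, 'a) cat"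
  Proj :: "('o, 'a, 'p, 'b) ftor"

definition cartesian :: "('o, 'a, 'p, 'b) fib \<Rightarrow> 'a \<Rightarrow> bool" where
  "cartesian X f \<longleftrightarrow> f \<in> Arr (Total X) \<and>
     (\<forall>z\<in>Obj (Total X). \<forall>g\<in>hom (Total X) z (Cod (Total X) f).
      \<forall>w\<in>hom (Base X) (on_obj (Proj X) z) (on_obj (Proj X) (Dom (Total X) f)).
        Comp (Base X) (on_arr (Proj X) f) w = on_arr (Proj X) g \<longrightarrow>
        (\<exists>!h. h \<in> hom (Total X) z (Dom (Total X) f) \<and>
              on_arr (Proj X) h = w \<and> Comp (Total X) f h = g))"

definition fibration :: "('o, 'a, 'p, 'b) fib \<Rightarrow> bool" where
  "fibration X \<longleftrightarrow>
     category (Base X) \<and> category (Total X) \<and> is_ftor (Total X) (Base X) (Proj X) \<and>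
     (\<forall>y\<in>Obj (Total X). \<forall>u\<in>Arr (Base X). Cod (Base X) u = on_obj (Proj X) y \<longrightarrow>
        (\<exists>f. cartesian X f \<and> Cod (Total X) f = y \<and> on_arr (Proj X) f = u))"

definition posetal_fibration :: "('o, 'a, 'p, 'b) fib \<Rightarrow> bool" where
  "posetal_fibration X \<longleftrightarrow> fibration X \<and> faithful (Total X) (Proj X)"

definition fibered_ftor ::
  "('o, 'a, 'p, 'b) fib \<Rightarrow> ('q, 'c, 'p, 'b) fib \<Rightarrow> ('o, 'a, 'q, 'c) ftor \<Rightarrow> bool" where
  "fibered_ftor X Y F \<longleftrightarrow>
     Base X = Base Y \<and> is_ftor (Total X) (Total Y) F \<and>
     (\<forall>x\<in>Obj (Total X). on_obj (Proj Y) (on_obj F x) = on_obj (Proj X) x) \<and>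
     (\<forall>f\<in>Arr (Total X). on_arr (Proj Y) (on_arr F f) = on_arr (Proj X) f) \<and>
     (\<forall>f. cartesian X f \<longrightarrow> cartesian Y (on_arr F f))"

definition vertical_iso ::
  "('o, 'a, 'p, 'b) fib \<Rightarrow> ('q, 'c, 'p, 'b) fib \<Rightarrow>
   ('o, 'a, 'q, 'c) ftor \<Rightarrow> ('o, 'a, 'q, 'c) ftor \<Rightarrow> bool" where
  "vertical_iso X Y F G \<longleftrightarrow> (\<exists>\<eta>.
     (\<forall>x\<in>Obj (Total X).
        \<eta> x \<in> hom (Total Y) (on_obj F x) (on_obj G x) \<and> iso_arr (Total Y) (\<eta> x) \<and>
        on_arr (Proj Y) (\<eta> x) = Ident (Base X) (on_obj (Proj X) x)) \<and>
     (\<forall>x y. \<forall>f\<in>hom (Total X) x y.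
        Comp (Total Y) (on_arr G f) (\<eta> x) = Comp (Total Y) (\<eta> y) (on_arr F f)))"

definition fibered_equivalent ::
  "('o, 'a, 'p, 'b) fib \<Rightarrow> ('q, 'c, 'p, 'b) fib \<Rightarrow> bool" where
  "fibered_equivalent X Y \<longleftrightarrow> (\<exists>F G.
     fibered_ftor X Y F \<and> fibered_ftor Y X G \<and>
     vertical_iso X X (comp_ftor G F) id_ftor \<and> vertical_iso Y Y (comp_ftor F G) id_ftor)"


section \<open>Fibers and first-order structure\<close>

definition fiber :: "('o, 'a, 'p, 'b) fib \<Rightarrow> 'p \<Rightarrow> 'o set" where
  "fiber X M = {\<phi> \<in> Obj (Total X). on_obj (Proj X) \<phi> = M}"

definition fle :: "('o, 'a, 'p, 'b) fib \<Rightarrow> 'o \<Rightarrow> 'o \<Rightarrow> bool" where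
  "fle X \<phi> \<psi> \<longleftrightarrow>
     (\<exists>f\<in>hom (Total X) \<phi> \<psi>. on_arr (Proj X) f = Ident (Base X) (on_obj (Proj X) \<phi>))"

definition fiso :: "('o, 'a, 'p, 'b) fib \<Rightarrow> 'o \<Rightarrow> 'o \<Rightarrow> bool" where
  "fiso X \<phi> \<psi> \<longleftrightarrow> fle X \<phi> \<psi> \<and> fle X \<psi> \<phi>"

text \<open>
  \<open>reindex X u \<phi>\<close> is \<open>u\<^sup>*\<phi>\<close> for a chosen cartesian lift. The logical operations are likewise
  relations, with a chosen representative where a term is needed; in a posetal fibration all
  choices are isomorphic.
\<close>

definition reindex :: "('o, 'a, 'p, 'b) fib \<Rightarrow> 'b \<Rightarrow> 'o \<Rightarrow> 'o" where
  "reindex X u \<phi> = (SOME \<psi>. \<exists>f. cartesian X f \<and> Dom (Total X) f = \<psi> \<and>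
     Cod (Total X) f = \<phi> \<and> on_arr (Proj X) f = u)"

definition is_truth :: "('o, 'a, 'p, 'b) fib \<Rightarrow> 'p \<Rightarrow> 'o \<Rightarrow> bool" where
  "is_truth X M \<tau> \<longleftrightarrow> \<tau> \<in> fiber X M \<and> (\<forall>\<phi>\<in>fiber X M. fle X \<phi> \<tau>)"

definition is_meet :: "('o, 'a, 'p, 'b) fib \<Rightarrow> 'p \<Rightarrow> 'o \<Rightarrow> 'o \<Rightarrow> 'o \<Rightarrow> bool" where
  "is_meet X M \<phi> \<psi> \<mu> \<longleftrightarrow> \<mu> \<in> fiber X M \<and>
     (\<forall>\<theta>\<in>fiber X M. fle X \<theta> \<mu> \<longleftrightarrow> fle X \<theta> \<phi> \<and> fle X \<theta> \<psi>)"

definition is_imp :: "('o, 'a, 'p, 'b) fib \<Rightarrow> 'p \<Rightarrow> 'o \<Rightarrow> 'o \<Rightarrow> 'o \<Rightarrow> bool" where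
  "is_imp X M \<phi> \<psi> \<iota> \<longleftrightarrow> \<iota> \<in> fiber X M \<and>
     (\<forall>\<theta>\<in>fiber X M. \<forall>\<mu>. is_meet X M \<theta> \<phi> \<mu> \<longrightarrow> (fle X \<theta> \<iota> \<longleftrightarrow> fle X \<mu> \<psi>))"

definition is_ex :: "('o, 'a, 'p, 'b) fib \<Rightarrow> 'b \<Rightarrow> 'o \<Rightarrow> 'o \<Rightarrow> bool" where
  "is_ex X u \<phi> \<epsilon> \<longleftrightarrow> \<epsilon> \<in> fiber X (Cod (Base X) u) \<and>
     (\<forall>\<psi>\<in>fiber X (Cod (Base X) u). fle X \<epsilon> \<psi> \<longleftrightarrow> fle X \<phi> (reindex X u \<psi>))"

definition is_all :: "('o, 'a, 'p, 'b) fib \<Rightarrow> 'b \<Rightarrow> 'o \<Rightarrow> 'o \<Rightarrow> bool" where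
  "is_all X u \<phi> \<alpha> \<longleftrightarrow> \<alpha> \<in> fiber X (Cod (Base X) u) \<and>
     (\<forall>\<psi>\<in>fiber X (Cod (Base X) u). fle X \<psi> \<alpha> \<longleftrightarrow> fle X (reindex X u \<psi>) \<phi>)"

definition truth :: "('o, 'a, 'p, 'b) fib \<Rightarrow> 'p \<Rightarrow> 'o" where
  "truth X M = (SOME \<tau>. is_truth X M \<tau>)"

definition ex :: "('o, 'a, 'p, 'b) fib \<Rightarrow> 'b \<Rightarrow> 'o \<Rightarrow> 'o" where
  "ex X u \<phi> = (SOME \<epsilon>. is_ex X u \<phi> \<epsilon>)"

definition univ :: "('o, 'a, 'p, 'b) fib \<Rightarrow> 'b \<Rightarrow> 'o \<Rightarrow> 'o" where
  "univ X u \<phi> = (SOME \<alpha>. is_all X u \<phi> \<alpha>)"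

definition R1 :: "('o, 'a, 'p, 'b) fib \<Rightarrow> bool" where
  "R1 X \<longleftrightarrow>
     (\<forall>M\<in>Obj (Base X).
        (\<exists>\<tau>. is_truth X M \<tau>) \<and>
        (\<forall>\<phi>\<in>fiber X M. \<forall>\<psi>\<in>fiber X M. (\<exists>\<mu>. is_meet X M \<phi> \<psi> \<mu>) \<and> (\<exists>\<iota>. is_imp X M \<phi> \<psi> \<iota>))) \<and>
     (\<forall>N M. \<forall>u\<in>hom (Base X) N M.
        (\<forall>\<tau>. is_truth X M \<tau> \<longrightarrow> is_truth X N (reindex X u \<tau>)) \<and>
        (\<forall>\<phi>\<in>fiber X M. \<forall>\<psi>\<in>fiber X M.
           (\<forall>\<mu>. is_meet X M \<phi> \<psi> \<mu> \<longrightarrow>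
              is_meet X N (reindex X u \<phi>) (reindex X u \<psi>) (reindex X u \<mu>)) \<and>
           (\<forall>\<iota>. is_imp X M \<phi> \<psi> \<iota> \<longrightarrow>
              is_imp X N (reindex X u \<phi>) (reindex X u \<psi>) (reindex X u \<iota>)))) \<and>
     (\<forall>N M. \<forall>u\<in>hom (Base X) N M. \<forall>\<phi>\<in>fiber X N.
        (\<exists>\<epsilon>. is_ex X u \<phi> \<epsilon>) \<and> (\<exists>\<alpha>. is_all X u \<phi> \<alpha>)) \<and>
     (\<forall>p q u v. is_pullback (Base X) p q u v \<longrightarrow>
        (\<forall>\<phi>\<in>fiber X (Dom (Base X) u).
           fiso X (reindex X v (ex X u \<phi>)) (ex X q (reindex X p \<phi>)) \<and>
           fiso X (reindex X v (univ X u \<phi>)) (univ X q (reindex X p \<phi>))))"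


section \<open>Fibrations over the category of sets\<close>

type_synonym ('o, 'a, 'v) setfib = "('o, 'a, 'v set, 'v setfun) fib"

definition pre_stack :: "('o, 'a, 'v) setfib \<Rightarrow> bool" where
  "pre_stack X \<longleftrightarrow>
     (\<forall>N M. \<forall>e\<in>hom (Base X) N M. surjection e \<longrightarrow>
        (\<forall>\<phi>\<in>fiber X M. \<forall>\<psi>\<in>fiber X M.
           fle X (reindex X e \<phi>) (reindex X e \<psi>) \<longrightarrow> fle X \<phi> \<psi>))"

definition ex_prime :: "('o, 'a, 'v) setfib \<Rightarrow> 'v set \<Rightarrow> 'o \<Rightarrow> bool" where
  "ex_prime X I \<pi> \<longleftrightarrow> \<pi> \<in> fiber X I \<and>
     (\<forall>J K. \<forall>u\<in>hom (Base X) J I. \<forall>v\<in>hom (Base X) K J. \<forall>\<theta>\<in>fiber X K.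
        fle X (reindex X u \<pi>) (ex X v \<theta>) \<longrightarrow>
        (\<exists>L. \<exists>e\<in>hom (Base X) L J. \<exists>w\<in>hom (Base X) L K.
           surjection e \<and> Comp (Base X) v w = e \<and>
           fle X (reindex X (Comp (Base X) u e) \<pi>) (reindex X w \<theta>)))"

text \<open>
  A full subfibration is given by its set \<open>S\<close> of predicates; being full, it has the order of \<open>X\<close>.
\<close>

definition modest_in :: "('o, 'a, 'v) setfib \<Rightarrow> 'o set \<Rightarrow> 'v set \<Rightarrow> 'o \<Rightarrow> bool" where
  "modest_in X S I \<mu> \<longleftrightarrow> \<mu> \<in> S \<inter> fiber X I \<and>
     (\<forall>J K. \<forall>e\<in>hom (Base X) K J. \<forall>f\<in>hom (Base X) K I. \<forall>\<phi>\<in>S \<inter> fiber X J.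
        surjection e \<and> fle X (reindex X e \<phi>) (reindex X f \<mu>) \<longrightarrow>
        (\<exists>h\<in>hom (Base X) J I. Comp (Base X) h e = f \<and> fle X \<phi> (reindex X h \<mu>)))"

definition generated ::
  "('o, 'a, 'v) setfib \<Rightarrow> 'v set \<Rightarrow> ('v \<Rightarrow> 'v set) \<Rightarrow> ('v \<Rightarrow> 'o) \<Rightarrow> 'o set" where
  "generated X I A \<pi> = {\<phi> \<in> Obj (Total X).
     \<exists>i\<in>I. \<exists>f\<in>hom (Base X) (on_obj (Proj X) \<phi>) (A i). fiso X \<phi> (reindex X f (\<pi> i))}"

definition closed_under_finite_meets :: "('o, 'a, 'v) setfib \<Rightarrow> 'o set \<Rightarrow> bool" where
  "closed_under_finite_meets X S \<longleftrightarrow>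
     (\<forall>M\<in>Obj (Base X).
        (\<forall>\<tau>. is_truth X M \<tau> \<longrightarrow> \<tau> \<in> S) \<and>
        (\<forall>\<phi>\<in>S \<inter> fiber X M. \<forall>\<psi>\<in>S \<inter> fiber X M. \<forall>\<mu>. is_meet X M \<phi> \<psi> \<mu> \<longrightarrow> \<mu> \<in> S))"

definition R2_family ::
  "('o, 'a, 'v) setfib \<Rightarrow> 'v set \<Rightarrow> ('v \<Rightarrow> 'v set) \<Rightarrow> ('v \<Rightarrow> 'o) \<Rightarrow> bool" where
  "R2_family X I A \<pi> \<longleftrightarrow>
     I \<in> Obj (Base X) \<and>
     (\<forall>i\<in>I. A i \<in> Obj (Base X) \<and> ex_prime X (A i) (\<pi> i)) \<and>
     closed_under_finite_meets X (generated X I A \<pi>) \<and>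
     (\<forall>i\<in>I. modest_in X (generated X I A \<pi>) (A i) (\<pi> i)) \<and>
     (\<forall>M\<in>Obj (Base X). \<forall>\<phi>\<in>fiber X M.
        \<exists>N. \<exists>u\<in>hom (Base X) N M. \<exists>\<psi>\<in>generated X I A \<pi> \<inter> fiber X N. fiso X \<phi> (ex X u \<psi>))"

definition R2 :: "('o, 'a, 'v) setfib \<Rightarrow> bool" where
  "R2 X \<longleftrightarrow> (\<exists>I A \<pi>. R2_family X I A \<pi>)"


section \<open>Indexed preorders\<close>

text \<open>
  The posetal fibration of a strictly indexed preorder: predicates \<open>Pr M\<close> on \<open>M\<close>, ordered by
  \<open>Le M\<close>, reindexed by \<open>Re u\<close>. An arrow over \<open>u\<close> from \<open>\<phi>\<close> to \<open>\<psi>\<close> witnesses \<open>\<phi> \<le> u\<^sup>*\<psi>\<close>.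
\<close>

definition grothendieck ::
  "('p, 'b) cat \<Rightarrow> ('p \<Rightarrow> 'r set) \<Rightarrow> ('p \<Rightarrow> 'r \<Rightarrow> 'r \<Rightarrow> bool) \<Rightarrow> ('b \<Rightarrow> 'r \<Rightarrow> 'r) \<Rightarrow>
   ('p \<times> 'r, ('p \<times> 'r) \<times> 'b \<times> ('p \<times> 'r), 'p, 'b) fib" where
  "grothendieck B Pr Le Re = \<lparr>
     Base = B,
     Total = \<lparr>
       Obj = {(M, \<phi>). M \<in> Obj B \<and> \<phi> \<in> Pr M},
       Arr = {((N, \<phi>), u, (M, \<psi>)) | N \<phi> u M \<psi>.
                u \<in> hom B N M \<and> \<phi> \<in> Pr N \<and> \<psi> \<in> Pr M \<and> Le N \<phi> (Re u \<psi>)},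
       Dom = fst,
       Cod = snd \<circ> snd,
       Ident = (\<lambda>x. (x, Ident B (fst x), x)),
       Comp = (\<lambda>g f. (fst f, Comp B (fst (snd g)) (fst (snd f)), snd (snd g)))\<rparr>,
     Proj = \<lparr>on_obj = fst, on_arr = fst \<circ> snd\<rparr>\<rparr>"

text \<open>The subset fibration, for \<open>B\<close> a category of sets.\<close>

definition sub_fib :: "'v setcat \<Rightarrow>
    ('v set \<times> 'v set, ('v set \<times> 'v set) \<times> 'v setfun \<times> ('v set \<times> 'v set), 'v) setfib" where
  "sub_fib B = grothendieck B Pow (\<lambda>M U V. U \<subseteq> V) (\<lambda>u V. {n \<in> fst u. fn u n \<in> V})"


section \<open>The functors delta, pi and gamma\<close>

definition delta :: "('o, 'a, 'v) setfib \<Rightarrow> 'v set \<times> 'v set \<Rightarrow> 'o" where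
  "delta X = (\<lambda>(M, U). ex X (inclusion U M) (truth X U))"

definition finite_meet_preserving ::
  "('o, 'a, 'p, 'b) fib \<Rightarrow> ('q, 'c, 'p, 'b) fib \<Rightarrow> ('o, 'a, 'q, 'c) ftor \<Rightarrow> bool" where
  "finite_meet_preserving X Y F \<longleftrightarrow>
     (\<forall>M\<in>Obj (Base X).
        (\<forall>\<tau>. is_truth X M \<tau> \<longrightarrow> is_truth Y M (on_obj F \<tau>)) \<and>
        (\<forall>\<phi>\<in>fiber X M. \<forall>\<psi>\<in>fiber X M. \<forall>\<mu>. is_meet X M \<phi> \<psi> \<mu> \<longrightarrow>
           is_meet Y M (on_obj F \<phi>) (on_obj F \<psi>) (on_obj F \<mu>)))"

definition fibered_left_adjoint_of_delta ::
  "('o, 'a, 'v) setfib \<Rightarrow>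
   ('o, 'a, 'v set \<times> 'v set, ('v set \<times> 'v set) \<times> 'v setfun \<times> ('v set \<times> 'v set)) ftor \<Rightarrow> bool" where
  "fibered_left_adjoint_of_delta X P \<longleftrightarrow>
     fibered_ftor X (sub_fib (Base X)) P \<and>
     (\<forall>M\<in>Obj (Base X). \<forall>\<phi>\<in>fiber X M. \<forall>U\<in>fiber (sub_fib (Base X)) M.
        fle (sub_fib (Base X)) (on_obj P \<phi>) U \<longleftrightarrow> fle X \<phi> (delta X U))"

text \<open>
  Determined up to vertical isomorphism where it exists, in particular under \<open>R1\<close> and \<open>R2\<close>;
  unspecified otherwise.
\<close>

definition pi_ftor :: "('o, 'a, 'v) setfib \<Rightarrow>
    ('o, 'a, 'v set \<times> 'v set, ('v set \<times> 'v set) \<times> 'v setfun \<times> ('v set \<times> 'v set)) ftor" where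
  "pi_ftor X = (SOME P. fibered_left_adjoint_of_delta X P \<and>
     finite_meet_preserving X (sub_fib (Base X)) P)"

definition gamma_obj :: "('o, 'a, 'v) setfib \<Rightarrow> 'o \<Rightarrow> 'v set \<times> 'v set" where
  "gamma_obj X \<phi> = (on_obj (Proj X) \<phi>,
     {m \<in> on_obj (Proj X) \<phi>.
        fle X (truth X one_set) (reindex X (point (on_obj (Proj X) \<phi>) m) \<phi>)})"

definition gamma_ftor :: "('o, 'a, 'v) setfib \<Rightarrow>
    ('o, 'a, 'v set \<times> 'v set, ('v set \<times> 'v set) \<times> 'v setfun \<times> ('v set \<times> 'v set)) ftor" where
  "gamma_ftor X = \<lparr>
     on_obj = gamma_obj X,
     on_arr = (\<lambda>f. (gamma_obj X (Dom (Total X) f), on_arr (Proj X) f,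
                    gamma_obj X (Cod (Total X) f)))\<rparr>"

definition gamma_iso_pi :: "('o, 'a, 'v) setfib \<Rightarrow> bool" where
  "gamma_iso_pi X \<longleftrightarrow> vertical_iso X (sub_fib (Base X)) (gamma_ftor X) (pi_ftor X)"


section \<open>Partial combinatory algebras\<close>

text \<open>Application of possibly undefined terms, strict in both arguments.\<close>

definition papp :: "('b \<Rightarrow> 'b \<Rightarrow> 'b option) \<Rightarrow> 'b option \<Rightarrow> 'b option \<Rightarrow> 'b option" where
  "papp f s t = Option.bind s (\<lambda>x. Option.bind t (f x))"

definition refines :: "'b option \<Rightarrow> 'b option \<Rightarrow> bool" where
  "refines t s \<longleftrightarrow> (s \<noteq> None \<longrightarrow> t = s)"

text \<open>
  \<open>tapp T i j\<close> is application \<open>B (i \<Rightarrow> j) \<times> B i \<rightharpoonup> B j\<close>; its values outside this domain are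
  irrelevant.
\<close>

record 'v tpca =
  types :: "'v set"
  tprod :: "'v \<Rightarrow> 'v \<Rightarrow> 'v"
  timp :: "'v \<Rightarrow> 'v \<Rightarrow> 'v"
  elems :: "'v \<Rightarrow> 'v set"
  tapp :: "'v \<Rightarrow> 'v \<Rightarrow> 'v \<Rightarrow> 'v \<Rightarrow> 'v option"

text \<open>
  The set of types is required to be non-empty: otherwise the realizability hyperdoctrine would
  have no predicates at all, in particular no truth predicate.
  Definedness of \<open>k x\<close> is part of \<open>k x y = x\<close> and is spelled out because it would not follow from
  the equation for all \<open>y \<in> B j\<close> if \<open>B j\<close> is empty; without it the order of the realizability
  hyperdoctrine need not be transitive.
\<close>

definition typed_pca :: "'v setcat \<Rightarrow> 'v tpca \<Rightarrow> bool" where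
  "typed_pca B T \<longleftrightarrow>
     types T \<in> Obj B \<and> types T \<noteq> {} \<and>
     (\<forall>i\<in>types T. elems T i \<in> Obj B) \<and>
     (\<forall>i\<in>types T. \<forall>j\<in>types T. tprod T i j \<in> types T \<and> timp T i j \<in> types T) \<and>
     (\<forall>i\<in>types T. \<forall>j\<in>types T. \<forall>f\<in>elems T (timp T i j). \<forall>x\<in>elems T i. \<forall>y.
        tapp T i j f x = Some y \<longrightarrow> y \<in> elems T j) \<and>
     (\<forall>i\<in>types T. \<forall>j\<in>types T. \<forall>k\<in>types T.
        (\<exists>kk\<in>elems T (timp T i (timp T j i)).
           \<forall>x\<in>elems T i. tapp T i (timp T j i) kk x \<noteq> None \<and>
             (\<forall>y\<in>elems T j.
                papp (tapp T j i) (tapp T i (timp T j i) kk x) (Some y) = Some x)) \<and>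
        (let ijk = timp T i (timp T j k); ij = timp T i j; ik = timp T i k in
         \<exists>ss\<in>elems T (timp T ijk (timp T ij ik)).
           \<forall>x\<in>elems T ijk. \<forall>y\<in>elems T ij.
             papp (tapp T ij ik) (tapp T ijk (timp T ij ik) ss x) (Some y) \<noteq> None \<and>
             (\<forall>z\<in>elems T i.
               refines
                 (papp (tapp T i k)
                    (papp (tapp T ij ik) (tapp T ijk (timp T ij ik) ss x) (Some y)) (Some z))
                 (papp (tapp T j k) (tapp T i (timp T j k) x z) (tapp T i j y z)))) \<and>
        (let p = tprod T i j in
         \<exists>pr\<in>elems T (timp T i (timp T j p)). \<exists>fs\<in>elems T (timp T p i). \<exists>sn\<in>elems T (timp T p j).
           \<forall>x\<in>elems T i. \<forall>y\<in>elems T j.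
             papp (tapp T p i) (Some fs)
               (papp (tapp T j p) (tapp T i (timp T j p) pr x) (Some y)) = Some x \<and>
             papp (tapp T p j) (Some sn)
               (papp (tapp T j p) (tapp T i (timp T j p) pr x) (Some y)) = Some y))"

definition realizability_hyperdoctrine :: "'v setcat \<Rightarrow> 'v tpca \<Rightarrow>
    ('v set \<times> 'v \<times> ('v \<Rightarrow> 'v set),
     ('v set \<times> 'v \<times> ('v \<Rightarrow> 'v set)) \<times> 'v setfun \<times> ('v set \<times> 'v \<times> ('v \<Rightarrow> 'v set)), 'v) setfib" where
  "realizability_hyperdoctrine B T = grothendieck B
     (\<lambda>M. {(i, \<phi>). i \<in> types T \<and> \<phi> \<in> M \<rightarrow>\<^sub>E Pow (elems T i)})
     (\<lambda>M (i, \<phi>) (j, \<psi>). \<exists>e\<in>elems T (timp T i j). \<forall>m\<in>M. \<forall>a\<in>\<phi> m. \<exists>b\<in>\<psi> m. tapp T i j e a = Some b)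
     (\<lambda>u (j, \<psi>). (j, restrict (\<psi> \<circ> fn u) (fst u)))"

record 'v pca =
  carr :: "'v set"
  app :: "'v \<Rightarrow> 'v \<Rightarrow> 'v option"

definition is_pca :: "'v setcat \<Rightarrow> 'v pca \<Rightarrow> bool" where
  "is_pca B Q \<longleftrightarrow>
     carr Q \<in> Obj B \<and>
     (\<forall>f\<in>carr Q. \<forall>x\<in>carr Q. \<forall>y. app Q f x = Some y \<longrightarrow> y \<in> carr Q) \<and>
     (\<exists>kk\<in>carr Q. \<exists>ss\<in>carr Q.
        (\<forall>x\<in>carr Q. \<forall>y\<in>carr Q. papp (app Q) (app Q kk x) (Some y) = Some x) \<and>
        (\<forall>x\<in>carr Q. \<forall>y\<in>carr Q.
           papp (app Q) (app Q ss x) (Some y) \<noteq> None \<and>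
           (\<forall>z\<in>carr Q.
              refines (papp (app Q) (papp (app Q) (app Q ss x) (Some y)) (Some z))
                      (papp (app Q) (app Q x z) (app Q y z)))))"

definition realizability_tripos :: "'v setcat \<Rightarrow> 'v pca \<Rightarrow>
    ('v set \<times> ('v \<Rightarrow> 'v set),
     ('v set \<times> ('v \<Rightarrow> 'v set)) \<times> 'v setfun \<times> ('v set \<times> ('v \<Rightarrow> 'v set)), 'v) setfib" where
  "realizability_tripos B Q = grothendieck B
     (\<lambda>M. M \<rightarrow>\<^sub>E Pow (carr Q))
     (\<lambda>M \<phi> \<psi>. \<exists>e\<in>carr Q. \<forall>m\<in>M. \<forall>a\<in>\<phi> m. \<exists>b\<in>\<psi> m. app Q e a = Some b)
     (\<lambda>u \<psi>. restrict (\<psi> \<circ> fn u) (fst u))"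

end

theory Submission
  imports Defs
begin

text \<open>
  The family \<open>\<pi>\<close> of (R2) becomes a typed pca with \<open>B\<^sub>i = A\<^sub>i\<close>. For the universal relation \<open>r \<subseteq> A\<^sub>i \<times> A\<^sub>j\<close>
  the predicate \<open>\<forall>(a, b) \<in> r. \<pi>\<^sub>i(a) \<Rightarrow> \<pi>\<^sub>j(b)\<close> is of the form \<open>\<exists>\<^sub>u g\<^sup>*\<pi>\<^sub>k\<close>; one takes \<open>k\<close> as the type
  \<open>i \<Rightarrow> j\<close>, and modesty of \<open>\<pi>\<^sub>j\<close> turns the relation coded by an element of \<open>A\<^sub>k\<close> into a partial function.
  \<open>\<exists>\<close>-primeness and modesty together say that every partial function tracked by the predicates \<open>\<pi>\<close>
  is represented, which gives the combinators and identifies \<open>\<exists>\<^sub>u g\<^sup>*\<pi>\<^sub>i\<close> with the realizability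
  predicate \<open>m \<mapsto> {g n | u n = m}\<close>. The condition \<open>\<gamma> \<cong> \<pi>\<close> amounts to all points of the \<open>\<pi>\<^sub>i\<close> being
  true, so that every element of \<open>A\<^sub>i\<close> may be used as a realizer.
  Conversely, in a realizability hyperdoctrine the singleton predicates \<open>b \<mapsto> {b}\<close> on the \<open>B\<^sub>i\<close> witness (R2).
\<close>

section \<open>Posetal fibrations and their equivalences\<close>

text \<open>Chosen reindexings compose only up to isomorphism. The proof therefore never relies on
  equations between them in \<open>X\<close>; it works with the judgement "\<open>x\<close> is below
  \<open>y\<close> along the function \<open>f\<close>" (\<open>over\<close>, later
  \<open>L\<close>) and restates every universal property for maps along functions.

  Primeness and modesty act in tandem. Primeness produces witnesses only on a cover of the given
  set; modesty makes the code of the witness, an element of some A_j, descend from the cover. The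
  arrow type exists because all tracked relations from A_i to A_j are governed by the single
  predicate \<open>theta\<close>, which has a presentation with a single index k. Afterwards
  \<open>theta\<close> is used only through \<open>lam\<close>: a partial operation that is tracked
  in every context \<open>Q\<close> has a code. All combinators come from it.

  In the converse direction the obstacle is emptiness. A type may have no elements and a map may
  miss points; at such places a realizer has nothing to compute but must still return a value. This
  shapes currying (\<open>cur\<close>) and the universal quantifier (\<open>AL\<close>).\<close>

definition over :: "('o, 'a, 'p, 'b) fib \<Rightarrow> 'o \<Rightarrow> 'b \<Rightarrow> 'o \<Rightarrow> bool" where
  "over X x u y \<longleftrightarrow> (\<exists>f\<in>hom (Total X) x y. on_arr (Proj X) f = u)"

text \<open>By faithfulness an arrow is determined by its ends and its image in the base. Equations
  between arrows of the total category are therefore checked in the base, and arrows can be traded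
  for the relation \<open>over\<close>.\<close>

locale faithful_fib =
  fixes X :: "('o, 'a, 'p, 'b) fib"
  assumes cat_base: "category (Base X)"
    and cat_total: "category (Total X)"
    and ftor_proj: "is_ftor (Total X) (Base X) (Proj X)"
    and faithful_proj: "faithful (Total X) (Proj X)"
begin

lemma over_hom: "over X x u y \<Longrightarrow> u \<in> hom (Base X) (on_obj (Proj X) x) (on_obj (Proj X) y)"
  using ftor_proj by (auto simp: over_def is_ftor_def)

lemma over_obj: "over X x u y \<Longrightarrow> x \<in> Obj (Total X) \<and> y \<in> Obj (Total X)"
  using cat_total by (auto simp: over_def category_def hom_def)

lemma proj_obj: "x \<in> Obj (Total X) \<Longrightarrow> on_obj (Proj X) x \<in> Obj (Base X)"
  using ftor_proj by (auto simp: is_ftor_def)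

lemma over_refl: "x \<in> Obj (Total X) \<Longrightarrow> over X x (Ident (Base X) (on_obj (Proj X) x)) x"
  using ftor_proj cat_total by (auto simp: over_def is_ftor_def category_def)

lemma over_unique:
  "f \<in> hom (Total X) x y \<Longrightarrow> g \<in> hom (Total X) x y \<Longrightarrow>
   on_arr (Proj X) f = on_arr (Proj X) g \<Longrightarrow> f = g"
  using faithful_proj by (auto simp: faithful_def)

lemma comp_hom:
  "f \<in> hom (Total X) x y \<Longrightarrow> g \<in> hom (Total X) y z \<Longrightarrow>
    Comp (Total X) g f \<in> hom (Total X) x z \<and>
    on_arr (Proj X) (Comp (Total X) g f) = Comp (Base X) (on_arr (Proj X) g) (on_arr (Proj X) f)"
  using ftor_proj cat_total unfolding is_ftor_def category_def by metis

lemma over_trans: "over X x u y \<Longrightarrow> over X y v z \<Longrightarrow> over X x (Comp (Base X) v u) z"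
  unfolding over_def using comp_hom by metis

lemma ident_hom: "x \<in> Obj (Total X) \<Longrightarrow> Ident (Total X) x \<in> hom (Total X) x x \<and>
    on_arr (Proj X) (Ident (Total X) x) = Ident (Base X) (on_obj (Proj X) x)"
  using ftor_proj cat_total unfolding is_ftor_def category_def by metis

lemma proj_hom: "f \<in> hom (Total X) x y \<Longrightarrow>
    on_arr (Proj X) f \<in> hom (Base X) (on_obj (Proj X) x) (on_obj (Proj X) y)"
  using ftor_proj by (auto simp: is_ftor_def)

lemma base_unit: "u \<in> hom (Base X) M N \<Longrightarrow>
    Comp (Base X) u (Ident (Base X) M) = u \<and> Comp (Base X) (Ident (Base X) N) u = u"
  using cat_base unfolding category_def by metis

text \<open>Uniqueness of the factorization and commutation of the triangle come for free from
  faithfulness; what remains of cartesianness is the existence of an arrow, a statement about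
  \<open>over\<close>.\<close>

lemma cartesian_iff:
  "cartesian X f \<longleftrightarrow> f \<in> Arr (Total X) \<and>
    (\<forall>z\<in>Obj (Total X). \<forall>w\<in>hom (Base X) (on_obj (Proj X) z) (on_obj (Proj X) (Dom (Total X) f)).
       over X z (Comp (Base X) (on_arr (Proj X) f) w) (Cod (Total X) f) \<longrightarrow>
       over X z w (Dom (Total X) f))" (is "_ \<longleftrightarrow> ?A \<and> ?B")
proof
  assume c: "cartesian X f"
  have "over X z w (Dom (Total X) f)"
    if z: "z \<in> Obj (Total X)"
      and w: "w \<in> hom (Base X) (on_obj (Proj X) z) (on_obj (Proj X) (Dom (Total X) f))"
      and o: "over X z (Comp (Base X) (on_arr (Proj X) f) w) (Cod (Total X) f)" for z w
  proof -
    obtain g where g: "g \<in> hom (Total X) z (Cod (Total X) f)"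
      "on_arr (Proj X) g = Comp (Base X) (on_arr (Proj X) f) w"
      using o by (auto simp: over_def)
    then obtain h where "h \<in> hom (Total X) z (Dom (Total X) f)" "on_arr (Proj X) h = w"
      using c z w unfolding cartesian_def by metis
    then show ?thesis by (auto simp: over_def)
  qed
  then show "?A \<and> ?B" using c by (auto simp: cartesian_def)
next
  assume r: "?A \<and> ?B"
  then have f: "f \<in> hom (Total X) (Dom (Total X) f) (Cod (Total X) f)" by (auto simp: hom_def)
  show "cartesian X f"
    unfolding cartesian_def
  proof (intro conjI ballI impI)
    show "f \<in> Arr (Total X)" using r by blast
    fix z g w
    assume z: "z \<in> Obj (Total X)" and g: "g \<in> hom (Total X) z (Cod (Total X) f)"
      and w: "w \<in> hom (Base X) (on_obj (Proj X) z) (on_obj (Proj X) (Dom (Total X) f))"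
      and e: "Comp (Base X) (on_arr (Proj X) f) w = on_arr (Proj X) g"
    have "over X z (Comp (Base X) (on_arr (Proj X) f) w) (Cod (Total X) f)"
      using g e by (auto simp: over_def)
    then have "over X z w (Dom (Total X) f)" using r z w by blast
    then obtain h where h: "h \<in> hom (Total X) z (Dom (Total X) f)" "on_arr (Proj X) h = w"
      by (auto simp: over_def)
    have "Comp (Total X) f h = g"
      using over_unique[of "Comp (Total X) f h" z "Cod (Total X) f" g] comp_hom[OF h(1) f] g h e
      by auto
    then show "\<exists>!h. h \<in> hom (Total X) z (Dom (Total X) f) \<and>
        on_arr (Proj X) h = w \<and> Comp (Total X) f h = g"
      using h over_unique by metis
  qed
qed

end

text \<open>Two families of arrows over identities, in opposite directions, suffice: the inverse
  laws and the naturality squares are equations between parallel arrows with the same image in the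
  base.\<close>

lemma vertical_isoI:
  assumes Y: "faithful_fib Y" and X: "category (Total X)"
    and F: "\<And>x y f. f \<in> hom (Total X) x y \<Longrightarrow>
      on_arr F f \<in> hom (Total Y) (on_obj F x) (on_obj F y) \<and> on_arr (Proj Y) (on_arr F f) = on_arr (Proj X) f"
    and G: "\<And>x y f. f \<in> hom (Total X) x y \<Longrightarrow>
      on_arr G f \<in> hom (Total Y) (on_obj G x) (on_obj G y) \<and> on_arr (Proj Y) (on_arr G f) = on_arr (Proj X) f"
    and B: "Base X = Base Y"
    and PF: "\<And>x. x \<in> Obj (Total X) \<Longrightarrow> on_obj (Proj Y) (on_obj F x) = on_obj (Proj X) x"
    and PG: "\<And>x. x \<in> Obj (Total X) \<Longrightarrow> on_obj (Proj Y) (on_obj G x) = on_obj (Proj X) x"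
    and FG: "\<And>x. x \<in> Obj (Total X) \<Longrightarrow>
      over Y (on_obj F x) (Ident (Base X) (on_obj (Proj X) x)) (on_obj G x)"
    and GF: "\<And>x. x \<in> Obj (Total X) \<Longrightarrow>
      over Y (on_obj G x) (Ident (Base X) (on_obj (Proj X) x)) (on_obj F x)"
  shows "vertical_iso X Y F G"
proof -
  interpret Y: faithful_fib Y by (rule Y)
  let ?i = "\<lambda>x. Ident (Base X) (on_obj (Proj X) x)"
  obtain \<eta> where \<eta>: "\<And>x. x \<in> Obj (Total X) \<Longrightarrow>
      \<eta> x \<in> hom (Total Y) (on_obj F x) (on_obj G x) \<and> on_arr (Proj Y) (\<eta> x) = ?i x"
    using FG unfolding over_def by metis
  obtain \<theta> where \<theta>: "\<And>x. x \<in> Obj (Total X) \<Longrightarrow>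
      \<theta> x \<in> hom (Total Y) (on_obj G x) (on_obj F x) \<and> on_arr (Proj Y) (\<theta> x) = ?i x"
    using GF unfolding over_def by metis
  have iso: "iso_arr (Total Y) (\<eta> x)" if x: "x \<in> Obj (Total X)" for x
  proof -
    have ob: "on_obj F x \<in> Obj (Total Y)" "on_obj G x \<in> Obj (Total Y)"
      using Y.over_obj FG[OF x] by auto
    have ii: "?i x \<in> hom (Base Y) (on_obj (Proj X) x) (on_obj (Proj X) x)"
      using Y.over_hom[OF FG[OF x]] PF PG x by simp
    have "Comp (Base Y) (?i x) (?i x) = ?i x" using Y.base_unit[OF ii] B by simp
    moreover have "Comp (Total Y) (\<theta> x) (\<eta> x) \<in> hom (Total Y) (on_obj F x) (on_obj F x)"
      "Comp (Total Y) (\<eta> x) (\<theta> x) \<in> hom (Total Y) (on_obj G x) (on_obj G x)"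
      using Y.comp_hom \<eta> \<theta> x by blast+
    ultimately have "Comp (Total Y) (\<theta> x) (\<eta> x) = Ident (Total Y) (on_obj F x)"
      "Comp (Total Y) (\<eta> x) (\<theta> x) = Ident (Total Y) (on_obj G x)"
      using Y.over_unique Y.ident_hom[OF ob(1)] Y.ident_hom[OF ob(2)] Y.comp_hom[of "\<eta> x" _ _ "\<theta> x"]
        Y.comp_hom[of "\<theta> x" _ _ "\<eta> x"] \<eta>[OF x] \<theta>[OF x] PF PG x B by metis+
    then show ?thesis using \<eta>[OF x] \<theta>[OF x] by (auto simp: iso_arr_def hom_def)
  qed
  have nat: "Comp (Total Y) (on_arr G f) (\<eta> x) = Comp (Total Y) (\<eta> y) (on_arr F f)"
    if f: "f \<in> hom (Total X) x y" for x y f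
  proof -
    have xy: "x \<in> Obj (Total X)" "y \<in> Obj (Total X)"
      using f X by (auto simp: category_def hom_def)
    have "on_arr (Proj X) f \<in> hom (Base Y) (on_obj (Proj X) x) (on_obj (Proj X) y)"
      using F[OF f] Y.proj_hom PF xy by metis
    then have u: "Comp (Base Y) (on_arr (Proj X) f) (?i x) = Comp (Base Y) (?i y) (on_arr (Proj X) f)"
      using Y.base_unit B by metis
    have 1: "Comp (Total Y) (on_arr G f) (\<eta> x) \<in> hom (Total Y) (on_obj F x) (on_obj G y) \<and>
       on_arr (Proj Y) (Comp (Total Y) (on_arr G f) (\<eta> x)) = Comp (Base Y) (on_arr (Proj X) f) (?i x)"
      using Y.comp_hom[of "\<eta> x" _ _ "on_arr G f"] \<eta>[OF xy(1)] G[OF f] by metis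
    have 2: "Comp (Total Y) (\<eta> y) (on_arr F f) \<in> hom (Total Y) (on_obj F x) (on_obj G y) \<and>
       on_arr (Proj Y) (Comp (Total Y) (\<eta> y) (on_arr F f)) = Comp (Base Y) (?i y) (on_arr (Proj X) f)"
      using Y.comp_hom[of "on_arr F f" _ _ "\<eta> y"] \<eta>[OF xy(2)] F[OF f] by metis
    show ?thesis using Y.over_unique 1 2 u by metis
  qed
  show ?thesis
    unfolding vertical_iso_def using \<eta> iso nat by blast
qed

text \<open>The arrow part is a choice of an arrow with the same image in the base. Where
  \<open>F\<close> preserves \<open>over\<close> such an arrow exists, and in a faithful target it
  is unique, which makes the choice functorial.\<close>

definition lift_ftor ::
  "('o, 'a, 'p, 'b) fib \<Rightarrow> ('q, 'c, 'p, 'b) fib \<Rightarrow> ('o \<Rightarrow> 'q) \<Rightarrow> ('o, 'a, 'q, 'c) ftor" where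
  "lift_ftor X Y F = \<lparr>on_obj = F, on_arr = (\<lambda>f. SOME g.
     g \<in> hom (Total Y) (F (Dom (Total X) f)) (F (Cod (Total X) f)) \<and>
     on_arr (Proj Y) g = on_arr (Proj X) f)\<rparr>"

lemma on_obj_lift [simp]: "on_obj (lift_ftor X Y F) = F"
  by (simp add: lift_ftor_def)

lemma lift_arr:
  assumes "\<And>x u y. over X x u y \<Longrightarrow> over Y (F x) u (F y)" and f: "f \<in> hom (Total X) x y"
  shows "on_arr (lift_ftor X Y F) f \<in> hom (Total Y) (F x) (F y) \<and>
    on_arr (Proj Y) (on_arr (lift_ftor X Y F) f) = on_arr (Proj X) f"
proof -
  have "over X x (on_arr (Proj X) f) y" using f by (auto simp: over_def)
  then have "over Y (F x) (on_arr (Proj X) f) (F y)" using assms by blast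
  moreover have "Dom (Total X) f = x" "Cod (Total X) f = y" using f by (auto simp: hom_def)
  ultimately show ?thesis
    unfolding lift_ftor_def over_def by simp (rule someI_ex, blast)
qed

text \<open>Functoriality rests on \<open>F\<close> preserving \<open>over\<close>. Cartesian arrows
  have to be tested against arbitrary objects of \<open>Y\<close>; \<open>S\<close> replaces such an
  object by an isomorphic one in the image of \<open>F\<close>, where \<open>over\<close> is
  reflected back to \<open>X\<close>.\<close>

lemma fibered_lift_ftor:
  assumes "faithful_fib X" "faithful_fib Y" and B: "Base X = Base Y"
    and P: "\<And>x. x \<in> Obj (Total X) \<Longrightarrow> F x \<in> Obj (Total Y) \<and> on_obj (Proj Y) (F x) = on_obj (Proj X) x"
    and O: "\<And>x u y. x \<in> Obj (Total X) \<Longrightarrow> y \<in> Obj (Total X) \<Longrightarrow>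
       over X x u y \<longleftrightarrow> over Y (F x) u (F y)"
    and S: "\<And>y. y \<in> Obj (Total Y) \<Longrightarrow> \<exists>x\<in>Obj (Total X).
       over Y y (Ident (Base Y) (on_obj (Proj Y) y)) (F x) \<and>
       over Y (F x) (Ident (Base Y) (on_obj (Proj Y) y)) y"
  shows "fibered_ftor X Y (lift_ftor X Y F)"
proof -
  interpret X: faithful_fib X by fact
  interpret Y: faithful_fib Y by fact
  have A: "on_arr (lift_ftor X Y F) f \<in> hom (Total Y) (F x) (F y) \<and>
    on_arr (Proj Y) (on_arr (lift_ftor X Y F) f) = on_arr (Proj X) f"
    if "f \<in> hom (Total X) x y" for f x y
    using that by (rule lift_arr[rotated]) (use O X.over_obj in blast)
  have ftor: "is_ftor (Total X) (Total Y) (lift_ftor X Y F)"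
    unfolding is_ftor_def
  proof (intro conjI ballI allI)
    fix x assume x: "x \<in> Obj (Total X)"
    then show "on_obj (lift_ftor X Y F) x \<in> Obj (Total Y)" using P by simp
    show "on_arr (lift_ftor X Y F) (Ident (Total X) x) = Ident (Total Y) (on_obj (lift_ftor X Y F) x)"
      using A[of "Ident (Total X) x" x x] X.ident_hom[OF x] Y.ident_hom[of "F x"] P[OF x] B
        Y.over_unique[of _ "F x" "F x"] by simp
  next
    fix x y f assume "f \<in> hom (Total X) x y"
    then show "on_arr (lift_ftor X Y F) f \<in> hom (Total Y) (on_obj (lift_ftor X Y F) x) (on_obj (lift_ftor X Y F) y)"
      using A by simp
  next
    fix x y z f g assume f: "f \<in> hom (Total X) x y" and g: "g \<in> hom (Total X) y z"
    show "on_arr (lift_ftor X Y F) (Comp (Total X) g f) =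
       Comp (Total Y) (on_arr (lift_ftor X Y F) g) (on_arr (lift_ftor X Y F) f)"
      using A[OF f] A[OF g] X.comp_hom[OF f g] A[of "Comp (Total X) g f" x z] B
        Y.comp_hom[of "on_arr (lift_ftor X Y F) f" _ _ "on_arr (lift_ftor X Y F) g"]
        Y.over_unique[of _ "F x" "F z"] by metis
  qed
  have cart: "cartesian Y (on_arr (lift_ftor X Y F) f)" if c: "cartesian X f" for f
  proof -
    let ?x = "Dom (Total X) f" and ?y = "Cod (Total X) f"
    have fh: "f \<in> hom (Total X) ?x ?y" using c by (auto simp: cartesian_def hom_def)
    then have xy: "?x \<in> Obj (Total X)" "?y \<in> Obj (Total X)"
      using X.cat_total by (auto simp: category_def hom_def)
    note Af = A[OF fh]
    have dc: "Dom (Total Y) (on_arr (lift_ftor X Y F) f) = F ?x"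
      "Cod (Total Y) (on_arr (lift_ftor X Y F) f) = F ?y"
      "on_arr (lift_ftor X Y F) f \<in> Arr (Total Y)" using Af by (auto simp: hom_def)
    have "over Y z w (F ?x)" if z: "z \<in> Obj (Total Y)"
      and w: "w \<in> hom (Base Y) (on_obj (Proj Y) z) (on_obj (Proj X) ?x)"
      and o: "over Y z (Comp (Base Y) (on_arr (Proj X) f) w) (F ?y)" for z w
    proof -
      obtain x where x: "x \<in> Obj (Total X)"
        "over Y z (Ident (Base Y) (on_obj (Proj Y) z)) (F x)"
        "over Y (F x) (Ident (Base Y) (on_obj (Proj Y) z)) z"
        using S[OF z] by blast
      have "on_obj (Proj Y) z \<in> Obj (Base Y)" using z Y.proj_obj by blast
      then have px: "on_obj (Proj X) x = on_obj (Proj Y) z"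
        using P[OF x(1)] Y.over_hom[OF x(2)] Y.cat_base by (auto simp: hom_def category_def)
      have "over Y (F x) (Comp (Base Y) (on_arr (Proj X) f) w) (F ?y)"
        using Y.over_trans[OF x(3) o] Y.base_unit Y.over_hom[OF o] by simp
      then have "over X x (Comp (Base X) (on_arr (Proj X) f) w) ?y" using O x xy B by metis
      then have "over X x w ?x" using c x w px B unfolding X.cartesian_iff by metis
      then have "over Y (F x) w (F ?x)" using O x xy by metis
      then show ?thesis using Y.over_trans[OF x(2)] Y.base_unit w by metis
    qed
    then show ?thesis
      unfolding Y.cartesian_iff dc using dc(3) Af P[OF xy(1)] by auto
  qed
  show ?thesis unfolding fibered_ftor_def
  proof (intro conjI ballI allI impI)
    fix f assume "f \<in> Arr (Total X)"
    then show "on_arr (Proj Y) (on_arr (lift_ftor X Y F) f) = on_arr (Proj X) f"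
      using A[of f] by (auto simp: hom_def)
  qed (use B ftor P cart in auto)
qed

text \<open>The fibered form of: fully faithful and essentially surjective implies equivalence. The
  quasi-inverse is chosen object by object; it again preserves and reflects \<open>over\<close>, by
  conjugation with the isomorphisms that \<open>S\<close> provides.\<close>

lemma fibered_equivalentI:
  assumes "faithful_fib X" "faithful_fib Y" and B: "Base X = Base Y"
    and P: "\<And>x. x \<in> Obj (Total X) \<Longrightarrow> F x \<in> Obj (Total Y) \<and> on_obj (Proj Y) (F x) = on_obj (Proj X) x"
    and O: "\<And>x u y. x \<in> Obj (Total X) \<Longrightarrow> y \<in> Obj (Total X) \<Longrightarrow>
       over X x u y \<longleftrightarrow> over Y (F x) u (F y)"
    and S: "\<And>y. y \<in> Obj (Total Y) \<Longrightarrow> \<exists>x\<in>Obj (Total X). on_obj (Proj X) x = on_obj (Proj Y) y \<and>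
       over Y y (Ident (Base Y) (on_obj (Proj Y) y)) (F x) \<and>
       over Y (F x) (Ident (Base Y) (on_obj (Proj Y) y)) y"
  shows "fibered_equivalent X Y"
proof -
  interpret X: faithful_fib X by fact
  interpret Y: faithful_fib Y by fact
  obtain G where G: "\<And>y. y \<in> Obj (Total Y) \<Longrightarrow> G y \<in> Obj (Total X) \<and>
       on_obj (Proj X) (G y) = on_obj (Proj Y) y \<and>
       over Y y (Ident (Base Y) (on_obj (Proj Y) y)) (F (G y)) \<and>
       over Y (F (G y)) (Ident (Base Y) (on_obj (Proj Y) y)) y"
    using S by metis
  have fg: "over Y (F (G y)) (Ident (Base Y) (on_obj (Proj Y) y)) y"
    "over Y y (Ident (Base Y) (on_obj (Proj Y) y)) (F (G y))"
    if "y \<in> Obj (Total Y)" for y using G that by blast+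
  have OG: "over Y y u y' \<longleftrightarrow> over X (G y) u (G y')"
    if y: "y \<in> Obj (Total Y)" "y' \<in> Obj (Total Y)" for y y' u
  proof -
    have "over X (G y) u (G y') \<longleftrightarrow> over Y (F (G y)) u (F (G y'))" using O G y by metis
    also have "\<dots> \<longleftrightarrow> over Y y u y'"
    proof
      assume o: "over Y (F (G y)) u (F (G y'))"
      have "over Y y (Comp (Base Y) u (Ident (Base Y) (on_obj (Proj Y) y))) (F (G y'))"
        using Y.over_trans[OF fg(2)[OF y(1)] o] .
      moreover have u: "u \<in> hom (Base Y) (on_obj (Proj Y) y) (on_obj (Proj Y) y')"
        using Y.over_hom[OF o] P G y by metis
      ultimately have "over Y y u (F (G y'))" using Y.base_unit by metis
      from Y.over_trans[OF this fg(1)[OF y(2)]] show "over Y y u y'" using Y.base_unit[OF u] by metis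
    next
      assume o: "over Y y u y'"
      then have u: "u \<in> hom (Base Y) (on_obj (Proj Y) y) (on_obj (Proj Y) y')" by (rule Y.over_hom)
      have "over Y (F (G y)) u y'"
        using Y.over_trans[OF fg(1)[OF y(1)] o] Y.base_unit[OF u] by metis
      from Y.over_trans[OF this fg(2)[OF y(2)]] show "over Y (F (G y)) u (F (G y'))"
        using Y.base_unit[OF u] by metis
    qed
    finally show ?thesis by blast
  qed
  have gf: "over X x (Ident (Base X) (on_obj (Proj X) x)) (G (F x)) \<and>
      over X (G (F x)) (Ident (Base X) (on_obj (Proj X) x)) x" if x: "x \<in> Obj (Total X)" for x
    using O[of x "G (F x)"] O[of "G (F x)" x] x G[of "F x"] P[OF x] B by simp
  let ?F = "lift_ftor X Y F" and ?G = "lift_ftor Y X G"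
  have FF: "fibered_ftor X Y ?F"
  proof (rule fibered_lift_ftor)
    fix y assume "y \<in> Obj (Total Y)"
    then show "\<exists>x\<in>Obj (Total X). over Y y (Ident (Base Y) (on_obj (Proj Y) y)) (F x) \<and>
        over Y (F x) (Ident (Base Y) (on_obj (Proj Y) y)) y" using S by blast
  qed (use assms in auto)
  have GG: "fibered_ftor Y X ?G"
  proof (rule fibered_lift_ftor)
    fix x assume "x \<in> Obj (Total X)"
    then show "\<exists>y\<in>Obj (Total Y). over X x (Ident (Base X) (on_obj (Proj X) x)) (G y) \<and>
        over X (G y) (Ident (Base X) (on_obj (Proj X) x)) x" using gf P by blast
  qed (use assms G OG in auto)
  have aF: "on_arr ?F f \<in> hom (Total Y) (F x) (F y) \<and> on_arr (Proj Y) (on_arr ?F f) = on_arr (Proj X) f"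
    if "f \<in> hom (Total X) x y" for f x y
    using that by (rule lift_arr[rotated]) (use O X.over_obj in blast)
  have aG: "on_arr ?G f \<in> hom (Total X) (G x) (G y) \<and> on_arr (Proj X) (on_arr ?G f) = on_arr (Proj Y) f"
    if "f \<in> hom (Total Y) x y" for f x y
    using that by (rule lift_arr[rotated]) (use OG Y.over_obj in blast)
  have 1: "vertical_iso X X (comp_ftor ?G ?F) id_ftor"
  proof (rule vertical_isoI)
    fix x y f assume "f \<in> hom (Total X) x y"
    then show "on_arr (comp_ftor ?G ?F) f \<in> hom (Total X) (on_obj (comp_ftor ?G ?F) x) (on_obj (comp_ftor ?G ?F) y) \<and>
      on_arr (Proj X) (on_arr (comp_ftor ?G ?F) f) = on_arr (Proj X) f"
      using aF[of f x y] aG[of "on_arr ?F f" "F x" "F y"] by (simp add: comp_ftor_def)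
  qed (use assms X.cat_total gf G P in \<open>auto simp: comp_ftor_def id_ftor_def\<close>)
  have 2: "vertical_iso Y Y (comp_ftor ?F ?G) id_ftor"
  proof (rule vertical_isoI)
    fix x y f assume "f \<in> hom (Total Y) x y"
    then show "on_arr (comp_ftor ?F ?G) f \<in> hom (Total Y) (on_obj (comp_ftor ?F ?G) x) (on_obj (comp_ftor ?F ?G) y) \<and>
      on_arr (Proj Y) (on_arr (comp_ftor ?F ?G) f) = on_arr (Proj Y) f"
      using aG[of f x y] aF[of "on_arr ?G f" "G x" "G y"] by (simp add: comp_ftor_def)
  qed (use assms Y.cat_total fg G P in \<open>auto simp: comp_ftor_def id_ftor_def\<close>)
  show ?thesis unfolding fibered_equivalent_def using FF GG 1 2 by blast
qed

lemma over_fibered_ftor: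
  "fibered_ftor X Y F \<Longrightarrow> over X x u y \<Longrightarrow> over Y (on_obj F x) u (on_obj F y)"
proof -
  assume F: "fibered_ftor X Y F" and "over X x u y"
  then obtain f where f: "f \<in> hom (Total X) x y" "on_arr (Proj X) f = u" by (auto simp: over_def)
  then have "on_arr F f \<in> hom (Total Y) (on_obj F x) (on_obj F y)"
    using F by (simp add: fibered_ftor_def is_ftor_def)
  moreover have "on_arr (Proj Y) (on_arr F f) = u"
    using F f by (simp add: fibered_ftor_def hom_def)
  ultimately show ?thesis by (auto simp: over_def)
qed

text \<open>Only the object part of the equivalence is kept. Reflection of \<open>over\<close> is
  obtained by applying the inverse functor and composing with the unit isomorphisms at both
  ends.\<close>

lemma fibered_equivalentE:
  assumes "faithful_fib X" "faithful_fib Y" and E: "fibered_equivalent X Y"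
  obtains F where
    "\<And>x. x \<in> Obj (Total X) \<Longrightarrow> F x \<in> Obj (Total Y) \<and> on_obj (Proj Y) (F x) = on_obj (Proj X) x"
    "\<And>x u y. x \<in> Obj (Total X) \<Longrightarrow> y \<in> Obj (Total X) \<Longrightarrow> over X x u y \<longleftrightarrow> over Y (F x) u (F y)"
    "\<And>y. y \<in> Obj (Total Y) \<Longrightarrow> \<exists>x\<in>Obj (Total X). on_obj (Proj X) x = on_obj (Proj Y) y \<and>
       over Y y (Ident (Base Y) (on_obj (Proj Y) y)) (F x) \<and>
       over Y (F x) (Ident (Base Y) (on_obj (Proj Y) y)) y"
proof -
  interpret X: faithful_fib X by fact
  interpret Y: faithful_fib Y by fact
  obtain F G where FG: "fibered_ftor X Y F" "fibered_ftor Y X G"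
    "vertical_iso X X (comp_ftor G F) id_ftor" "vertical_iso Y Y (comp_ftor F G) id_ftor"
    using E by (auto simp: fibered_equivalent_def)
  have B: "Base Y = Base X" using FG by (simp add: fibered_ftor_def)
  \<comment> \<open>Used for both composites, hence stated for a fresh fibration \<open>Z\<close>.
    The inverse arrow lies over a right inverse of an identity, that is, over the identity
    itself.\<close>
  have iso: "over Z (on_obj (comp_ftor G' F') x) (Ident (Base Z) (on_obj (Proj Z) x)) x \<and>
      over Z x (Ident (Base Z) (on_obj (Proj Z) x)) (on_obj (comp_ftor G' F') x)"
    if pr: "faithful_fib Z" "vertical_iso Z Z (comp_ftor G' F') id_ftor" "x \<in> Obj (Total Z)"
      "on_obj (Proj Z) (on_obj (comp_ftor G' F') x) = on_obj (Proj Z) x"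
    for Z :: "('x,'y,'z,'w) fib" and G' and F' :: "('x,'y,'s,'t) ftor" and x
  proof -
    interpret Z: faithful_fib Z by (rule pr(1))
    let ?y = "on_obj (comp_ftor G' F') x"
    obtain h where h: "h \<in> hom (Total Z) ?y x" "iso_arr (Total Z) h"
      "on_arr (Proj Z) h = Ident (Base Z) (on_obj (Proj Z) x)"
      using pr(2,3) by (auto simp: vertical_iso_def id_ftor_def)
    then obtain g where g: "g \<in> hom (Total Z) x ?y" "Comp (Total Z) h g = Ident (Total Z) x"
      unfolding iso_arr_def by (auto simp: hom_def)
    have "Comp (Base Z) (Ident (Base Z) (on_obj (Proj Z) x)) (on_arr (Proj Z) g) = Ident (Base Z) (on_obj (Proj Z) x)"
      using Z.comp_hom[OF g(1) h(1)] h g Z.ident_hom[OF pr(3)] by simp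
    then have "on_arr (Proj Z) g = Ident (Base Z) (on_obj (Proj Z) x)"
      using Z.base_unit Z.proj_hom[OF g(1)] pr(4) by metis
    then show ?thesis using g h by (auto simp: over_def)
  qed
  have PF: "on_obj F x \<in> Obj (Total Y) \<and> on_obj (Proj Y) (on_obj F x) = on_obj (Proj X) x"
    if "x \<in> Obj (Total X)" for x using FG that by (auto simp: fibered_ftor_def is_ftor_def)
  have PG: "on_obj G x \<in> Obj (Total X) \<and> on_obj (Proj X) (on_obj G x) = on_obj (Proj Y) x"
    if "x \<in> Obj (Total Y)" for x using FG that by (auto simp: fibered_ftor_def is_ftor_def)
  have gf: "over X (on_obj G (on_obj F x)) (Ident (Base X) (on_obj (Proj X) x)) x \<and>
      over X x (Ident (Base X) (on_obj (Proj X) x)) (on_obj G (on_obj F x))"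
    if "x \<in> Obj (Total X)" for x
    using iso[OF assms(1) FG(3) that] PF PG that by (simp add: comp_ftor_def)
  have fg: "over Y (on_obj F (on_obj G x)) (Ident (Base Y) (on_obj (Proj Y) x)) x \<and>
      over Y x (Ident (Base Y) (on_obj (Proj Y) x)) (on_obj F (on_obj G x))"
    if "x \<in> Obj (Total Y)" for x
    using iso[OF assms(2) FG(4) that] PF PG that by (simp add: comp_ftor_def)
  show ?thesis
  proof (rule that)
    fix x u y assume xy: "x \<in> Obj (Total X)" "y \<in> Obj (Total X)"
    show "over X x u y \<longleftrightarrow> over Y (on_obj F x) u (on_obj F y)"
    proof
      assume "over Y (on_obj F x) u (on_obj F y)"
      then have o: "over X (on_obj G (on_obj F x)) u (on_obj G (on_obj F y))" by (rule over_fibered_ftor[OF FG(2)])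
      then have u: "u \<in> hom (Base X) (on_obj (Proj X) x) (on_obj (Proj X) y)"
        using X.over_hom PF PG xy by metis
      have "over X x u (on_obj G (on_obj F y))"
        using X.over_trans[OF conjunct2[OF gf[OF xy(1)]] o] X.base_unit[OF u] by metis
      from X.over_trans[OF this conjunct1[OF gf[OF xy(2)]]]
      show "over X x u y" using X.base_unit[OF u] by metis
    qed (rule over_fibered_ftor[OF FG(1)])
  qed (use PF PG fg in blast)+
qed

section \<open>The posetal fibration of an indexed preorder\<close>

lemma grothendieck_sel [simp]:
  "Base (grothendieck B Pr Le Re) = B"
  "Obj (Total (grothendieck B Pr Le Re)) = {(M, \<phi>). M \<in> Obj B \<and> \<phi> \<in> Pr M}"
  "on_obj (Proj (grothendieck B Pr Le Re)) = fst"
  by (simp_all add: grothendieck_def)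

lemma over_grothendieck:
  "over (grothendieck B Pr Le Re) (N, \<phi>) u (M, \<psi>) \<longleftrightarrow>
    u \<in> hom B N M \<and> \<phi> \<in> Pr N \<and> \<psi> \<in> Pr M \<and> Le N \<phi> (Re u \<psi>)"
  by (auto simp: over_def grothendieck_def hom_def)

lemma fiber_grothendieck:
  "fiber (grothendieck B Pr Le Re) M = (if M \<in> Obj B then {M} \<times> Pr M else {})"
  by (auto simp: fiber_def)

lemma faithful_fib_grothendieck:
  assumes B: "category B"
    and re: "\<And>N M u \<psi>. u \<in> hom B N M \<Longrightarrow> \<psi> \<in> Pr M \<Longrightarrow> Re u \<psi> \<in> Pr N"
    and id: "\<And>M \<phi>. M \<in> Obj B \<Longrightarrow> \<phi> \<in> Pr M \<Longrightarrow> Re (Ident B M) \<phi> = \<phi>"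
    and comp: "\<And>L N M u v \<phi>. v \<in> hom B L N \<Longrightarrow> u \<in> hom B N M \<Longrightarrow> \<phi> \<in> Pr M \<Longrightarrow>
       Re (Comp B u v) \<phi> = Re v (Re u \<phi>)"
    and refl: "\<And>M \<phi>. M \<in> Obj B \<Longrightarrow> \<phi> \<in> Pr M \<Longrightarrow> Le M \<phi> \<phi>"
    and trans: "\<And>M \<phi> \<psi> \<theta>. M \<in> Obj B \<Longrightarrow> \<phi> \<in> Pr M \<Longrightarrow> \<psi> \<in> Pr M \<Longrightarrow> \<theta> \<in> Pr M \<Longrightarrow>
       Le M \<phi> \<psi> \<Longrightarrow> Le M \<psi> \<theta> \<Longrightarrow> Le M \<phi> \<theta>"
    and mono: "\<And>N M u \<phi> \<psi>. u \<in> hom B N M \<Longrightarrow> \<phi> \<in> Pr M \<Longrightarrow> \<psi> \<in> Pr M \<Longrightarrow>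
       Le M \<phi> \<psi> \<Longrightarrow> Le N (Re u \<phi>) (Re u \<psi>)"
  shows "faithful_fib (grothendieck B Pr Le Re)"
proof
  have ob: "N \<in> Obj B" "M \<in> Obj B" if "u \<in> hom B N M" for u N M
    using that B by (auto simp: category_def hom_def)
  have unit: "Comp B u (Ident B N) = u" "Comp B (Ident B M) u = u" if "u \<in> hom B N M" for u N M
    using that B unfolding category_def by metis+
  have ch: "Comp B u v \<in> hom B L M" if "v \<in> hom B L N" "u \<in> hom B N M" for u v L N M
    using that B unfolding category_def by metis
  have ih: "Ident B M \<in> hom B M M" if "M \<in> Obj B" for M
    using that B unfolding category_def by metis
  have assoc: "Comp B h (Comp B g f) = Comp B (Comp B h g) f"
    if "f \<in> hom B w x" "g \<in> hom B x y" "h \<in> hom B y z" for f g h w x y z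
    using that B unfolding category_def by metis
  let ?T = "Total (grothendieck B Pr Le Re)"
  have hom: "f \<in> hom ?T (N, \<phi>) (M, \<psi>) \<longleftrightarrow> (\<exists>u. f = ((N, \<phi>), u, (M, \<psi>)) \<and> u \<in> hom B N M \<and> \<phi> \<in> Pr N \<and> \<psi> \<in> Pr M \<and> Le N \<phi> (Re u \<psi>))"
    for f N M \<phi> \<psi> by (auto simp: grothendieck_def hom_def)
  have le: "Le L \<phi> (Re (Comp B u v) \<theta>)"
    if "v \<in> hom B L N" "u \<in> hom B N M" "\<phi> \<in> Pr L" "\<psi> \<in> Pr N" "\<theta> \<in> Pr M"
      "Le L \<phi> (Re v \<psi>)" "Le N \<psi> (Re u \<theta>)" for u v L N M \<phi> \<psi> \<theta>
    using that trans[of L \<phi> "Re v \<psi>" "Re v (Re u \<theta>)"] mono[of v L N \<psi> "Re u \<theta>"] comp re ob by metis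
  show "category (Base (grothendieck B Pr Le Re))" using B by simp
  show "category ?T"
    unfolding category_def
  proof (intro conjI ballI allI)
    fix f assume "f \<in> Arr ?T"
    then show "Dom ?T f \<in> Obj ?T" "Cod ?T f \<in> Obj ?T"
      using ob by (auto simp: grothendieck_def)
  next
    fix x assume "x \<in> Obj ?T"
    then show "Ident ?T x \<in> hom ?T x x"
      using ih refl id by (auto simp: grothendieck_def hom_def)
  next
    fix x y z f g assume "f \<in> hom ?T x y" "g \<in> hom ?T y z"
    moreover obtain N \<phi> M \<psi> L \<theta> where xyz: "x = (N, \<phi>)" "y = (M, \<psi>)" "z = (L, \<theta>)"
      by (cases x; cases y; cases z)
    ultimately obtain u v where uv: "f = ((N, \<phi>), u, (M, \<psi>))" "g = ((M, \<psi>), v, (L, \<theta>))"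
      "u \<in> hom B N M" "v \<in> hom B M L" "\<phi> \<in> Pr N" "\<psi> \<in> Pr M" "\<theta> \<in> Pr L"
      "Le N \<phi> (Re u \<psi>)" "Le M \<psi> (Re v \<theta>)"
      by (auto simp: hom)
    have "Comp ?T g f = ((N, \<phi>), Comp B v u, (L, \<theta>))"
      by (simp add: uv grothendieck_def)
    then show "Comp ?T g f \<in> hom ?T x z"
      using ch[OF uv(3,4)] le[OF uv(3-9)] uv(5,7) by (simp add: xyz hom)
  next
    fix x y f assume "f \<in> hom ?T x y"
    then show "Comp ?T f (Ident ?T x) = f" "Comp ?T (Ident ?T y) f = f"
      using unit by (cases x; cases y; auto simp: hom; auto simp: grothendieck_def)+
  next
    fix w x y z f g h assume "f \<in> hom ?T w x" "g \<in> hom ?T x y" "h \<in> hom ?T y z"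
    then show "Comp ?T h (Comp ?T g f) = Comp ?T (Comp ?T h g) f"
      using assoc by (cases w; cases x; cases y; cases z; auto simp: hom; auto simp: grothendieck_def)
  qed
  show "is_ftor ?T (Base (grothendieck B Pr Le Re)) (Proj (grothendieck B Pr Le Re))"
    using ob by (auto simp: is_ftor_def grothendieck_def hom_def)
  show "faithful ?T (Proj (grothendieck B Pr Le Re))"
    by (auto simp: faithful_def grothendieck_def hom_def)
qed

section \<open>Fibrations over the category of sets\<close>

text \<open>Restricting here lets functions be written as plain HOL lambda terms: the values of
  \<open>f\<close> outside \<open>N\<close> are cut off, as the extensional arrows of
  \<open>set_cat\<close> require.\<close>

definition arr :: "'v set \<Rightarrow> ('v \<Rightarrow> 'v) \<Rightarrow> 'v set \<Rightarrow> 'v setfun" where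
  "arr N f M = (N, restrict f N, M)"

lemma arr_sel [simp]: "fst (arr N f M) = N" "snd (snd (arr N f M)) = M" "fn (arr N f M) = restrict f N"
  by (simp_all add: arr_def fn_def)

lemma arr_cong: "(\<And>x. x \<in> N \<Longrightarrow> f x = g x) \<Longrightarrow> arr N f M = arr N g M"
  by (auto simp: arr_def intro: restrict_ext)

lemma arr_eq_iff: "arr N f M = arr N g M \<longleftrightarrow> (\<forall>x\<in>N. f x = g x)"
  unfolding arr_def by (metis (no_types, lifting) Pair_inject restrict_apply' restrict_ext)

section \<open>Closure properties of the universe of sets\<close>

locale set_univ =
  fixes elts :: "'v \<Rightarrow> 'v set"
  assumes set_universe: "set_universe elts"
begin

definition U :: "'v set set" where "U = range elts"

lemma U_E: assumes "S \<in> U" obtains x where "S = elts x"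
  using assms by (auto simp: U_def)

lemma elts_U: "elts x \<in> U" by (simp add: U_def)

definition mk :: "'v set \<Rightarrow> 'v" where "mk S = (THE x. elts x = S)"

lemma elts_inject: "elts x = elts y \<longleftrightarrow> x = y"
  using set_universe by (auto simp: set_universe_def)

lemma elts_mk: assumes "S \<in> U" shows "elts (mk S) = S"
proof -
  obtain x where x: "S = elts x" using assms by (auto elim: U_E)
  then have "mk S = x" by (simp add: mk_def elts_inject)
  then show ?thesis using x by simp
qed

lemma universe_closure:
  "\<exists>z. elts z = {x, y}" "\<exists>z. elts z = \<Union> (elts ` elts x)"
  "\<exists>z. elts z = {y. elts y \<subseteq> elts x}" "\<exists>z. elts z = {y \<in> elts x. P y}"
  "\<exists>z. elts z = f ` elts x"
  using set_universe unfolding set_universe_def by iprover+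

lemma upair_U: "{x, y} \<in> U"
  using universe_closure(1)[of x y] by (metis elts_U)

lemma sep_U: assumes "S \<in> U" "T \<subseteq> S" shows "T \<in> U"
proof -
  obtain x where x: "elts x = S" using assms by (auto elim: U_E)
  obtain z where "elts z = {y \<in> elts x. y \<in> T}" using universe_closure(4)[of x "\<lambda>y. y \<in> T"] by blast
  then have "elts z = T" using assms x by auto
  then show ?thesis using elts_U by blast
qed

lemma image_U: assumes "S \<in> U" shows "f ` S \<in> U"
proof -
  obtain x where x: "S = elts x" using assms by (auto elim: U_E)
  show ?thesis unfolding x using universe_closure(5)[of f x] by (metis elts_U)
qed

lemma Union_U: assumes "S \<in> U" shows "\<Union> (elts ` S) \<in> U"
proof -
  obtain x where x: "S = elts x" using assms by (auto elim: U_E)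
  show ?thesis unfolding x using universe_closure(2)[of x] by (metis elts_U)
qed

lemma Pow_U: assumes "S \<in> U" shows "{y. elts y \<subseteq> S} \<in> U"
proof -
  obtain x where x: "S = elts x" using assms by (auto elim: U_E)
  show ?thesis unfolding x using universe_closure(3)[of x] by (metis elts_U)
qed

text \<open>The sets \<open>F x\<close> are turned into elements of the universe by
  \<open>mk\<close>, so that replacement and union apply.\<close>

lemma UN_U: assumes "S \<in> U" "\<And>x. x \<in> S \<Longrightarrow> F x \<in> U" shows "(\<Union>x\<in>S. F x) \<in> U"
proof -
  have "(\<Union>x\<in>S. F x) = \<Union> (elts ` ((\<lambda>x. mk (F x)) ` S))"
    using assms(2) by (auto simp: elts_mk)
  then show ?thesis using assms(1) Union_U image_U by metis
qed

lemma single_U: "{x} \<in> U" using upair_U[of x x] by simp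

lemma one_U: "one_set \<in> U" by (simp add: one_set_def single_U)

section \<open>Ordered pairs and dependent sums inside the universe\<close>

definition kpair :: "'v \<Rightarrow> 'v \<Rightarrow> 'v" where "kpair a b = mk {mk {a}, mk {a, b}}"

lemma mk_inject: "S \<in> U \<Longrightarrow> T \<in> U \<Longrightarrow> mk S = mk T \<longleftrightarrow> S = T"
  using elts_mk by metis

lemma kpair_inject [simp]: "kpair a b = kpair c d \<longleftrightarrow> a = c \<and> b = d"
  unfolding kpair_def by (auto simp: mk_inject upair_U single_U doubleton_eq_iff)

definition pfst :: "'v \<Rightarrow> 'v" where "pfst z = (THE a. \<exists>b. z = kpair a b)"
definition psnd :: "'v \<Rightarrow> 'v" where "psnd z = (THE b. \<exists>a. z = kpair a b)"

lemma pfst_kpair [simp]: "pfst (kpair a b) = a" by (simp add: pfst_def)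
lemma psnd_kpair [simp]: "psnd (kpair a b) = b" by (simp add: psnd_def)

definition sig :: "'v set \<Rightarrow> ('v \<Rightarrow> 'v set) \<Rightarrow> 'v set" where
  "sig A B = (\<Union>a\<in>A. kpair a ` B a)"

abbreviation prd :: "'v set \<Rightarrow> 'v set \<Rightarrow> 'v set" where "prd A B \<equiv> sig A (\<lambda>_. B)"

lemma sig_U: "A \<in> U \<Longrightarrow> (\<And>a. a \<in> A \<Longrightarrow> B a \<in> U) \<Longrightarrow> sig A B \<in> U"
  unfolding sig_def by (intro UN_U image_U) auto

lemma kpair_sig [simp]: "kpair a b \<in> sig A B \<longleftrightarrow> a \<in> A \<and> b \<in> B a"
  by (auto simp: sig_def)

lemma sigE: "z \<in> sig A B \<Longrightarrow> (\<And>a b. z = kpair a b \<Longrightarrow> a \<in> A \<Longrightarrow> b \<in> B a \<Longrightarrow> P) \<Longrightarrow> P"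
  by (auto simp: sig_def)

lemma sig_fst: "z \<in> sig A B \<Longrightarrow> pfst z \<in> A" by (auto elim: sigE)
lemma sig_snd: "z \<in> sig A B \<Longrightarrow> psnd z \<in> B (pfst z)" by (auto elim: sigE)

section \<open>The category of sets in terms of HOL functions\<close>

lemma set_cat_sel [simp]:
  "Obj (set_cat elts) = U" "Dom (set_cat elts) = fst" "Cod (set_cat elts) = snd \<circ> snd"
  "Ident (set_cat elts) M = arr M (\<lambda>x. x) M"
  by (simp_all add: set_cat_def arr_def id_def U_def)

lemma comp_arr [simp]:
  "f \<in> N \<rightarrow> M \<Longrightarrow> Comp (set_cat elts) (arr M g L) (arr N f M) = arr N (\<lambda>x. g (f x)) L"
  by (auto simp: set_cat_def arr_def fn_def intro!: restrict_ext)

lemma hom_arr [simp]: "arr N f M \<in> hom (set_cat elts) N' M' \<longleftrightarrow>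
    N' = N \<and> M' = M \<and> N \<in> U \<and> M \<in> U \<and> f \<in> N \<rightarrow> M"
  by (auto simp: hom_def set_cat_def arr_def U_def)

lemma homE:
  assumes "u \<in> hom (set_cat elts) N M"
  obtains f where "u = arr N f M" "N \<in> U" "M \<in> U" "f \<in> N \<rightarrow> M"
proof -
  obtain f where "u = (N, f, M)" "f \<in> N \<rightarrow>\<^sub>E M" "N \<in> U" "M \<in> U"
    using assms by (auto simp: hom_def set_cat_def U_def)
  moreover then have "u = arr N f M" by (auto simp: arr_def)
  ultimately show ?thesis using that by blast
qed

lemma surjection_arr [simp]: "surjection (arr N f M) \<longleftrightarrow> f ` N = M"
  by (auto simp: surjection_def)

lemma point_arr: "point M m = arr one_set (\<lambda>_. m) M"
  by (simp add: point_def arr_def)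

lemma inclusion_arr: "inclusion V M = arr V (\<lambda>x. x) M"
  by (simp add: inclusion_def arr_def id_def)

lemma category_set_cat: "category (set_cat elts)"
  unfolding category_def
proof (intro conjI ballI allI)
  fix f assume "f \<in> Arr (set_cat elts)"
  then show "Dom (set_cat elts) f \<in> Obj (set_cat elts)" "Cod (set_cat elts) f \<in> Obj (set_cat elts)"
    by (auto simp: set_cat_def)
next
  fix x assume "x \<in> Obj (set_cat elts)"
  then show "Ident (set_cat elts) x \<in> hom (set_cat elts) x x" by simp
next
  fix x y z f g assume "f \<in> hom (set_cat elts) x y" "g \<in> hom (set_cat elts) y z"
  then show "Comp (set_cat elts) g f \<in> hom (set_cat elts) x z"
    by (elim homE) auto
next
  fix x y f assume "f \<in> hom (set_cat elts) x y"
  then show "Comp (set_cat elts) f (Ident (set_cat elts) x) = f"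
    "Comp (set_cat elts) (Ident (set_cat elts) y) f = f"
    by (auto elim!: homE)
next
  fix w x y z f g h
  assume "f \<in> hom (set_cat elts) w x" "g \<in> hom (set_cat elts) x y" "h \<in> hom (set_cat elts) y z"
  then show "Comp (set_cat elts) h (Comp (set_cat elts) g f) = Comp (set_cat elts) (Comp (set_cat elts) h g) f"
    by (elim homE) (simp add: comp_arr[of "\<lambda>x. _ (_ x)" w y] Pi_iff)
qed

section \<open>Explicit pullbacks\<close>

definition pb :: "'v set \<Rightarrow> ('v \<Rightarrow> 'v) \<Rightarrow> 'v set \<Rightarrow> ('v \<Rightarrow> 'v) \<Rightarrow> 'v set" where
  "pb N u K v = sig N (\<lambda>n. {k \<in> K. u n = v k})"

lemma pb_U: "N \<in> U \<Longrightarrow> K \<in> U \<Longrightarrow> pb N u K v \<in> U"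
  unfolding pb_def by (rule sig_U) (auto intro: sep_U)

lemma kpair_pb [simp]: "kpair n k \<in> pb N u K v \<longleftrightarrow> n \<in> N \<and> k \<in> K \<and> u n = v k"
  by (auto simp: pb_def)

lemma pbD: "z \<in> pb N u K v \<Longrightarrow> pfst z \<in> N \<and> psnd z \<in> K \<and> u (pfst z) = v (psnd z) \<and> z = kpair (pfst z) (psnd z)"
  by (auto simp: pb_def elim!: sigE)

text \<open>The Beck-Chevalley condition of \<open>X\<close> is applied only to squares with this
  explicit pullback.\<close>

lemma is_pullback_pb:
  assumes "N \<in> U" "K \<in> U" "M \<in> U" "u \<in> N \<rightarrow> M" "v \<in> K \<rightarrow> M"
  shows "is_pullback (set_cat elts) (arr (pb N u K v) pfst N) (arr (pb N u K v) psnd K) (arr N u M) (arr K v M)"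
proof -
  let ?P = "pb N u K v"
  have P: "?P \<in> U" "pfst \<in> ?P \<rightarrow> N" "psnd \<in> ?P \<rightarrow> K" using assms pb_U pbD by auto
  have A: "arr N' f M' \<in> Arr (set_cat elts)" if "N' \<in> U" "M' \<in> U" "f \<in> N' \<rightarrow> M'" for N' M' f
    using that hom_arr[of N' f M' N' M'] by (auto simp: hom_def)
  have uniq: "\<exists>!h. h \<in> hom (set_cat elts) Z ?P \<and> Comp (set_cat elts) (arr ?P pfst N) h = a \<and>
       Comp (set_cat elts) (arr ?P psnd K) h = b"
    if a: "a \<in> hom (set_cat elts) Z N" and b: "b \<in> hom (set_cat elts) Z K"
      and e: "Comp (set_cat elts) (arr N u M) a = Comp (set_cat elts) (arr K v M) b" for Z a b
  proof -
    obtain f where f: "a = arr Z f N" "f \<in> Z \<rightarrow> N" "Z \<in> U" using a by (auto elim: homE)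
    obtain g where g: "b = arr Z g K" "g \<in> Z \<rightarrow> K" using b by (auto elim: homE)
    have e': "u (f z) = v (g z)" if "z \<in> Z" for z
      using e f g that by (simp add: arr_eq_iff)
    have h: "(\<lambda>z. kpair (f z) (g z)) \<in> Z \<rightarrow> ?P" using f g e' by auto
    show ?thesis
    proof (rule ex1I[of _ "arr Z (\<lambda>z. kpair (f z) (g z)) ?P"])
      show "arr Z (\<lambda>z. kpair (f z) (g z)) ?P \<in> hom (set_cat elts) Z ?P \<and>
        Comp (set_cat elts) (arr ?P pfst N) (arr Z (\<lambda>z. kpair (f z) (g z)) ?P) = a \<and>
        Comp (set_cat elts) (arr ?P psnd K) (arr Z (\<lambda>z. kpair (f z) (g z)) ?P) = b"
        using h f g P by simp
      fix h assume h: "h \<in> hom (set_cat elts) Z ?P \<and> Comp (set_cat elts) (arr ?P pfst N) h = a \<and>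
       Comp (set_cat elts) (arr ?P psnd K) h = b"
      then obtain k where k: "h = arr Z k ?P" "k \<in> Z \<rightarrow> ?P" by (auto elim: homE)
      then have "pfst (k z) = f z" "psnd (k z) = g z" if "z \<in> Z" for z
        using h f g that by (simp_all add: arr_eq_iff)
      then have "k z = kpair (f z) (g z)" if "z \<in> Z" for z
        using that pbD[of "k z" N u K v] k(2) by (metis PiE)
      then show "h = arr Z (\<lambda>z. kpair (f z) (g z)) ?P" unfolding k by (rule arr_cong)
    qed
  qed
  have "Comp (set_cat elts) (arr N u M) (arr ?P pfst N) = Comp (set_cat elts) (arr K v M) (arr ?P psnd K)"
    using P pbD by (auto intro!: arr_cong)
  then show ?thesis
    unfolding is_pullback_def using A P assms uniq by simp
qed

end

section \<open>Predicates over sets, ordered along functions\<close>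

locale set_fib = set_univ elts for elts :: "'v \<Rightarrow> 'v set" +
  fixes X :: "('o, 'a, 'v) setfib"
  assumes base: "Base X = set_cat elts" and posetal: "posetal_fibration X"
begin

sublocale faithful_fib X
  using posetal by unfold_locales (auto simp: posetal_fibration_def fibration_def)

abbreviation p :: "'o \<Rightarrow> 'v set" where "p x \<equiv> on_obj (Proj X) x"
abbreviation fb :: "'v set \<Rightarrow> 'o set" where "fb M \<equiv> fiber X M"

text \<open>\<open>L x f y\<close> says \<open>x \<le> f\<^sup>*y\<close>; values of \<open>f\<close> outside the set that \<open>x\<close> lives on are irrelevant.\<close>

definition L :: "'o \<Rightarrow> ('v \<Rightarrow> 'v) \<Rightarrow> 'o \<Rightarrow> bool" where
  "L x f y \<longleftrightarrow> over X x (arr (p x) f (p y)) y"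

definition rx :: "'v set \<Rightarrow> ('v \<Rightarrow> 'v) \<Rightarrow> 'o \<Rightarrow> 'o" where
  "rx N f y = reindex X (arr N f (p y)) y"

lemma fbI: "x \<in> Obj (Total X) \<Longrightarrow> x \<in> fb (p x)"
  by (simp add: fiber_def)

lemma fbD: assumes "x \<in> fb M" shows "p x = M" "x \<in> Obj (Total X)" "M \<in> U"
  using assms proj_obj[of x] base by (auto simp: fiber_def)

lemma L_obj: "L x f y \<Longrightarrow> x \<in> Obj (Total X) \<and> y \<in> Obj (Total X)"
  unfolding L_def by (rule over_obj)

lemma L_fun: "L x f y \<Longrightarrow> f \<in> p x \<rightarrow> p y"
  unfolding L_def using over_hom base by fastforce

lemma L_cong: "L x f y \<Longrightarrow> (\<And>a. a \<in> p x \<Longrightarrow> f a = g a) \<Longrightarrow> L x g y"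
  unfolding L_def using arr_cong[of "p x" f g "p y"] by simp

lemma L_refl: "x \<in> Obj (Total X) \<Longrightarrow> L x (\<lambda>a. a) x"
  unfolding L_def using over_refl[of x] base by simp

lemma L_trans: "L x f y \<Longrightarrow> L y g z \<Longrightarrow> L x (\<lambda>a. g (f a)) z"
  using L_fun[of x f y] over_trans[of x _ y _ z] base unfolding L_def by (metis comp_arr)

lemma over_L: "over X x u y \<longleftrightarrow> (\<exists>f. u = arr (p x) f (p y) \<and> L x f y)"
  unfolding L_def using over_hom[of x u y] base by (auto elim!: homE)

lemma reindex_cartesian:
  assumes y: "y \<in> fb M" and N: "N \<in> U" and f: "f \<in> N \<rightarrow> M"
  obtains c where "cartesian X c" "Dom (Total X) c = rx N f y" "Cod (Total X) c = y"
    "on_arr (Proj X) c = arr N f M"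
proof -
  have "\<exists>c. cartesian X c \<and> Cod (Total X) c = y \<and> on_arr (Proj X) c = arr N f M"
    using posetal fbD[OF y] N f base hom_arr[of N f M N M]
    unfolding posetal_fibration_def fibration_def
    by (auto simp: hom_def)
  then have "\<exists>\<psi> c. cartesian X c \<and> Dom (Total X) c = \<psi> \<and> Cod (Total X) c = y \<and> on_arr (Proj X) c = arr N f M"
    by blast
  then have "\<exists>c. cartesian X c \<and> Dom (Total X) c = rx N f y \<and> Cod (Total X) c = y \<and> on_arr (Proj X) c = arr N f M"
    unfolding rx_def reindex_def fbD(1)[OF y] by (rule someI_ex)
  then show ?thesis using that by blast
qed

lemma rx_fb: "y \<in> fb M \<Longrightarrow> N \<in> U \<Longrightarrow> f \<in> N \<rightarrow> M \<Longrightarrow> rx N f y \<in> fb N"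
proof -
  assume y: "y \<in> fb M" and "N \<in> U" "f \<in> N \<rightarrow> M"
  then obtain c where c: "cartesian X c" "Dom (Total X) c = rx N f y" "Cod (Total X) c = y"
    "on_arr (Proj X) c = arr N f M" by (rule reindex_cartesian)
  then have "c \<in> hom (Total X) (rx N f y) y" by (auto simp: cartesian_def hom_def)
  then have "over X (rx N f y) (arr N f M) y" using c by (auto simp: over_def)
  then show ?thesis using over_obj over_hom base by (fastforce simp: fiber_def)
qed

text \<open>The cartesian property in terms of \<open>L\<close>. Together with
  \<open>rx_proj\<close> it takes the place of functoriality of reindexing.\<close>

lemma rx_L:
  assumes y: "y \<in> fb M" and N: "N \<in> U" and f: "f \<in> N \<rightarrow> M"
    and w: "w \<in> p z \<rightarrow> N"
  shows "L z w (rx N f y) \<longleftrightarrow> L z (\<lambda>a. f (w a)) y"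
proof -
  obtain c where c: "cartesian X c" "Dom (Total X) c = rx N f y" "Cod (Total X) c = y"
    "on_arr (Proj X) c = arr N f M" using y N f by (rule reindex_cartesian)
  then have "c \<in> hom (Total X) (rx N f y) y" by (auto simp: cartesian_def hom_def)
  then have o: "over X (rx N f y) (arr N f M) y" using c by (auto simp: over_def)
  note pr = fbD[OF rx_fb[OF y N f]] fbD[OF y]
  have l: "L (rx N f y) f y" using o pr unfolding L_def by simp
  show ?thesis
  proof
    assume "L z w (rx N f y)" from L_trans[OF this l] show "L z (\<lambda>a. f (w a)) y" .
  next
    assume a: "L z (\<lambda>a. f (w a)) y"
    then have "z \<in> Obj (Total X)" using L_obj by blast
    moreover have "arr (p z) w N \<in> hom (Base X) (p z) (p (Dom (Total X) c))"
      using w pr c base proj_obj \<open>z \<in> Obj (Total X)\<close> by simp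
    moreover have "over X z (Comp (Base X) (on_arr (Proj X) c) (arr (p z) w N)) (Cod (Total X) c)"
      using a w pr c base unfolding L_def by simp
    ultimately have "over X z (arr (p z) w N) (rx N f y)" using c(1,2) unfolding cartesian_iff by metis
    then show "L z w (rx N f y)" unfolding L_def using pr by simp
  qed
qed

lemma rx_proj: "y \<in> fb M \<Longrightarrow> N \<in> U \<Longrightarrow> f \<in> N \<rightarrow> M \<Longrightarrow> L (rx N f y) f y"
  using rx_L[of y M N f "\<lambda>a. a" "rx N f y"] rx_fb[of y M N f] L_refl fbD by auto

lemma reindex_rx: "y \<in> fb M \<Longrightarrow> reindex X (arr N f M) y = rx N f y"
  by (simp add: rx_def fbD)

lemma fle_L: "x \<in> fb M \<Longrightarrow> y \<in> fb M \<Longrightarrow> fle X x y \<longleftrightarrow> L x (\<lambda>a. a) y"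
  using base fbD[of x M] fbD[of y M] by (simp add: fle_def L_def over_def)

lemma fle_rx: "x \<in> fb N \<Longrightarrow> y \<in> fb M \<Longrightarrow> f \<in> N \<rightarrow> M \<Longrightarrow> fle X x (rx N f y) \<longleftrightarrow> L x f y"
  using fle_L[of x N "rx N f y"] rx_fb[of y M N f] rx_L[of y M N f "\<lambda>a. a" x] fbD[of x N] by simp

text \<open>A cartesian arrow is compared with the chosen lift over the same function, so that a
  single inequality in the fiber of its domain decides. This serves to show that functors into
  subsets preserve cartesian arrows.\<close>

lemma cartesian_L:
  "cartesian X c \<longleftrightarrow> (\<exists>x y f. c \<in> hom (Total X) x y \<and> on_arr (Proj X) c = arr (p x) f (p y) \<and> L x f y \<and>
     fle X (rx (p x) f y) x)"
proof
  assume c: "cartesian X c"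
  let ?x = "Dom (Total X) c" and ?y = "Cod (Total X) c"
  have h: "c \<in> hom (Total X) ?x ?y" using c by (auto simp: cartesian_def hom_def)
  then have "over X ?x (on_arr (Proj X) c) ?y" by (auto simp: over_def)
  then obtain f where f: "on_arr (Proj X) c = arr (p ?x) f (p ?y)" "L ?x f ?y" by (auto simp: over_L)
  let ?z = "rx (p ?x) f ?y"
  have ob: "?x \<in> fb (p ?x)" "?y \<in> fb (p ?y)" using L_obj[OF f(2)] fbI by auto
  have z: "?z \<in> fb (p ?x)" using rx_fb[OF ob(2) fbD(3)[OF ob(1)] L_fun[OF f(2)]] .
  have "L ?z f ?y" using rx_proj[OF ob(2) fbD(3)[OF ob(1)] L_fun[OF f(2)]] .
  then have "over X ?z (arr (p ?x) f (p ?y)) ?y" using fbD[OF z] by (simp add: L_def)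
  moreover have "arr (p ?x) (\<lambda>a. a) (p ?x) \<in> hom (Base X) (p ?z) (p ?x)" using fbD[OF z] base by simp
  ultimately have "over X ?z (arr (p ?x) (\<lambda>a. a) (p ?x)) ?x"
    using c fbD[OF z] base f unfolding cartesian_iff by simp
  then have "fle X ?z ?x" using fle_L[OF z ob(1)] fbD[OF z] by (simp add: L_def)
  then show "\<exists>x y f. c \<in> hom (Total X) x y \<and> on_arr (Proj X) c = arr (p x) f (p y) \<and> L x f y \<and>
     fle X (rx (p x) f y) x" using f h by blast
next
  assume "\<exists>x y f. c \<in> hom (Total X) x y \<and> on_arr (Proj X) c = arr (p x) f (p y) \<and> L x f y \<and>
     fle X (rx (p x) f y) x"
  then obtain x y f where c: "c \<in> hom (Total X) x y" "on_arr (Proj X) c = arr (p x) f (p y)"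
    "L x f y" "fle X (rx (p x) f y) x" by blast
  have ob: "x \<in> fb (p x)" "y \<in> fb (p y)" using L_obj[OF c(3)] fbI by auto
  let ?z = "rx (p x) f y"
  have z: "?z \<in> fb (p x)" using rx_fb[OF ob(2) fbD(3)[OF ob(1)] L_fun[OF c(3)]] .
  have zx: "L ?z (\<lambda>a. a) x" using fle_L[OF z ob(1)] c by simp
  have "over X z w x" if zw: "z \<in> Obj (Total X)" "w \<in> hom (Base X) (p z) (p x)"
    "over X z (Comp (Base X) (arr (p x) f (p y)) w) y" for z w
  proof -
    obtain g where g: "w = arr (p z) g (p x)" "g \<in> p z \<rightarrow> p x" using zw(2)[unfolded base] by (rule homE)
    then have "L z (\<lambda>a. f (g a)) y" using zw(3) base by (simp add: L_def)
    then have "L z g ?z" using rx_L[OF ob(2) fbD(3)[OF ob(1)] L_fun[OF c(3)] g(2)] by blast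
    from L_trans[OF this zx] show ?thesis by (simp add: L_def g)
  qed
  then show "cartesian X c" unfolding cartesian_iff using c by (auto simp: hom_def)
qed

lemma L_rx_dom: "L x g y \<Longrightarrow> x \<in> fb M \<Longrightarrow> N \<in> U \<Longrightarrow> f \<in> N \<rightarrow> M \<Longrightarrow> L (rx N f x) (\<lambda>a. g (f a)) y"
  by (rule L_trans[OF rx_proj])

end

section \<open>First-order structure and primitive predicates\<close>

locale hyper = set_fib elts X for elts :: "'v \<Rightarrow> 'v set" and X :: "('o, 'a, 'v) setfib" +
  assumes R1: "R1 X"
begin

lemmas R1_parts = R1[unfolded R1_def base]
lemmas R1_lattice = R1_parts[THEN conjunct1]
lemmas R1_stable = R1_parts[THEN conjunct2, THEN conjunct1]
lemmas R1_quant = R1_parts[THEN conjunct2, THEN conjunct2, THEN conjunct1]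
lemmas R1_BC = R1_parts[THEN conjunct2, THEN conjunct2, THEN conjunct2]

abbreviation tt :: "'v set \<Rightarrow> 'o" where "tt M \<equiv> truth X M"

definition mt :: "'o \<Rightarrow> 'o \<Rightarrow> 'o" where "mt \<phi> \<psi> = (SOME \<mu>. is_meet X (p \<phi>) \<phi> \<psi> \<mu>)"
definition im :: "'o \<Rightarrow> 'o \<Rightarrow> 'o" where "im \<phi> \<psi> = (SOME \<iota>. is_imp X (p \<phi>) \<phi> \<psi> \<iota>)"
definition E :: "'v set \<Rightarrow> ('v \<Rightarrow> 'v) \<Rightarrow> 'o \<Rightarrow> 'o" where "E M u \<phi> = ex X (arr (p \<phi>) u M) \<phi>"
definition A :: "'v set \<Rightarrow> ('v \<Rightarrow> 'v) \<Rightarrow> 'o \<Rightarrow> 'o" where "A M u \<phi> = univ X (arr (p \<phi>) u M) \<phi>"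

lemma is_truth_tt: assumes "M \<in> U" shows "is_truth X M (tt M)"
proof -
  have "\<exists>\<tau>. is_truth X M \<tau>" using R1_lattice assms by simp
  then show ?thesis unfolding truth_def by (rule someI_ex)
qed

lemma is_meet_mt: assumes "\<phi> \<in> fb M" "\<psi> \<in> fb M" shows "is_meet X M \<phi> \<psi> (mt \<phi> \<psi>)"
proof -
  have "\<exists>\<mu>. is_meet X M \<phi> \<psi> \<mu>" using R1_lattice assms fbD(3)[OF assms(1)] by simp
  then show ?thesis unfolding mt_def fbD(1)[OF assms(1)] by (rule someI_ex)
qed

lemma is_imp_im: assumes "\<phi> \<in> fb M" "\<psi> \<in> fb M" shows "is_imp X M \<phi> \<psi> (im \<phi> \<psi>)"
proof -
  have "\<exists>\<mu>. is_imp X M \<phi> \<psi> \<mu>" using R1_lattice assms fbD(3)[OF assms(1)] by simp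
  then show ?thesis unfolding im_def fbD(1)[OF assms(1)] by (rule someI_ex)
qed

lemma is_ex_E: assumes "\<phi> \<in> fb N" "M \<in> U" "u \<in> N \<rightarrow> M" shows "is_ex X (arr N u M) \<phi> (E M u \<phi>)"
proof -
  have "arr N u M \<in> hom (set_cat elts) N M" using assms fbD by simp
  then have "\<exists>\<epsilon>. is_ex X (arr N u M) \<phi> \<epsilon>" using R1_quant assms by blast
  then show ?thesis unfolding E_def ex_def fbD(1)[OF assms(1)] by (rule someI_ex)
qed

lemma is_all_A: assumes "\<phi> \<in> fb N" "M \<in> U" "u \<in> N \<rightarrow> M" shows "is_all X (arr N u M) \<phi> (A M u \<phi>)"
proof -
  have "arr N u M \<in> hom (set_cat elts) N M" using assms fbD by simp
  then have "\<exists>\<epsilon>. is_all X (arr N u M) \<phi> \<epsilon>" using R1_quant assms by blast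
  then show ?thesis unfolding A_def univ_def fbD(1)[OF assms(1)] by (rule someI_ex)
qed

lemma tt_fb: "M \<in> U \<Longrightarrow> tt M \<in> fb M"
  using is_truth_tt by (simp add: is_truth_def)

lemma tt_L: assumes "M \<in> U" "z \<in> Obj (Total X)" "f \<in> p z \<rightarrow> M" shows "L z f (tt M)"
proof -
  have z: "z \<in> fb (p z)" using assms fbI by blast
  have "arr (p z) f M \<in> hom (set_cat elts) (p z) M" using assms fbD[OF z] by simp
  then have "is_truth X (p z) (reindex X (arr (p z) f M) (tt M))"
    using R1_stable is_truth_tt[OF assms(1)] by blast
  then have "fle X z (rx (p z) f (tt M))"
    using z reindex_rx[OF tt_fb[OF assms(1)]] by (simp add: is_truth_def)
  then show ?thesis using fle_rx[OF z tt_fb[OF assms(1)] assms(3)] by simp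
qed

lemma mt_fb: "\<phi> \<in> fb M \<Longrightarrow> \<psi> \<in> fb M \<Longrightarrow> mt \<phi> \<psi> \<in> fb M"
  using is_meet_mt by (simp add: is_meet_def)

lemma is_meet_rx:
  assumes "is_meet X M \<phi> \<psi> \<mu>" "\<phi> \<in> fb M" "\<psi> \<in> fb M" "N \<in> U" "f \<in> N \<rightarrow> M"
  shows "is_meet X N (rx N f \<phi>) (rx N f \<psi>) (rx N f \<mu>)"
proof -
  have "arr N f M \<in> hom (set_cat elts) N M" using assms fbD[OF assms(2)] by simp
  then have "is_meet X N (reindex X (arr N f M) \<phi>) (reindex X (arr N f M) \<psi>) (reindex X (arr N f M) \<mu>)"
    using R1_stable assms(1-3) by blast
  moreover have "\<mu> \<in> fb M" using assms by (simp add: is_meet_def)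
  ultimately show ?thesis using assms by (simp add: reindex_rx)
qed

lemma is_imp_rx:
  assumes "is_imp X M \<phi> \<psi> \<mu>" "\<phi> \<in> fb M" "\<psi> \<in> fb M" "N \<in> U" "f \<in> N \<rightarrow> M"
  shows "is_imp X N (rx N f \<phi>) (rx N f \<psi>) (rx N f \<mu>)"
proof -
  have "arr N f M \<in> hom (set_cat elts) N M" using assms fbD[OF assms(2)] by simp
  then have "is_imp X N (reindex X (arr N f M) \<phi>) (reindex X (arr N f M) \<psi>) (reindex X (arr N f M) \<mu>)"
    using R1_stable assms(1-3) by blast
  moreover have "\<mu> \<in> fb M" using assms by (simp add: is_imp_def)
  ultimately show ?thesis using assms by (simp add: reindex_rx)
qed

text \<open>Stability under reindexing extends the universal property from the fiber to maps along
  an arbitrary \<open>f\<close>; the same move gives \<open>im_L\<close>.\<close>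

lemma meet_L:
  assumes m: "is_meet X M \<phi> \<psi> \<mu>" and ph: "\<phi> \<in> fb M" "\<psi> \<in> fb M" and f: "f \<in> p z \<rightarrow> M"
    and z: "z \<in> Obj (Total X)"
  shows "L z f \<mu> \<longleftrightarrow> L z f \<phi> \<and> L z f \<psi>"
proof -
  have zf: "z \<in> fb (p z)" using z fbI by blast
  have mu: "\<mu> \<in> fb M" using m by (simp add: is_meet_def)
  have "fle X z (rx (p z) f \<mu>) \<longleftrightarrow> fle X z (rx (p z) f \<phi>) \<and> fle X z (rx (p z) f \<psi>)"
    using is_meet_rx[OF m ph fbD(3)[OF zf] f] zf by (simp add: is_meet_def)
  then show ?thesis using fle_rx[OF zf _ f] mu ph by simp
qed

lemma mt_L:
  "\<phi> \<in> fb M \<Longrightarrow> \<psi> \<in> fb M \<Longrightarrow> f \<in> p z \<rightarrow> M \<Longrightarrow> z \<in> Obj (Total X) \<Longrightarrow>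
    L z f (mt \<phi> \<psi>) \<longleftrightarrow> L z f \<phi> \<and> L z f \<psi>"
  using meet_L is_meet_mt by blast

lemma mt_fst: "\<phi> \<in> fb M \<Longrightarrow> \<psi> \<in> fb M \<Longrightarrow> L (mt \<phi> \<psi>) (\<lambda>a. a) \<phi>"
  and mt_snd: "\<phi> \<in> fb M \<Longrightarrow> \<psi> \<in> fb M \<Longrightarrow> L (mt \<phi> \<psi>) (\<lambda>a. a) \<psi>"
  using mt_L[of \<phi> M \<psi> "\<lambda>a. a" "mt \<phi> \<psi>"] L_refl[of "mt \<phi> \<psi>"] mt_fb[of \<phi> M \<psi>] fbD[of "mt \<phi> \<psi>" M]
  by auto

lemma im_fb: "\<phi> \<in> fb M \<Longrightarrow> \<psi> \<in> fb M \<Longrightarrow> im \<phi> \<psi> \<in> fb M"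
  using is_imp_im by (simp add: is_imp_def)

lemma im_L:
  assumes ph: "\<phi> \<in> fb M" "\<psi> \<in> fb M" and f: "f \<in> p z \<rightarrow> M" and z: "z \<in> Obj (Total X)"
  shows "L z f (im \<phi> \<psi>) \<longleftrightarrow> L (mt z (rx (p z) f \<phi>)) f \<psi>"
proof -
  have zf: "z \<in> fb (p z)" using z fbI by blast
  have r: "rx (p z) f \<phi> \<in> fb (p z)" using rx_fb[OF ph(1) fbD(3)[OF zf] f] .
  have "fle X z (rx (p z) f (im \<phi> \<psi>)) \<longleftrightarrow> fle X (mt z (rx (p z) f \<phi>)) (rx (p z) f \<psi>)"
    using is_imp_rx[OF is_imp_im[OF ph] ph fbD(3)[OF zf] f] zf is_meet_mt[OF zf r]
    by (simp add: is_imp_def)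
  then show ?thesis using fle_rx[OF zf im_fb[OF ph] f] fle_rx[OF mt_fb[OF zf r] ph(2) f] by simp
qed

lemma E_fb: "\<phi> \<in> fb N \<Longrightarrow> M \<in> U \<Longrightarrow> u \<in> N \<rightarrow> M \<Longrightarrow> E M u \<phi> \<in> fb M"
  using is_ex_E[of \<phi> N M u] base by (simp add: is_ex_def)

lemma A_fb: "\<phi> \<in> fb N \<Longrightarrow> M \<in> U \<Longrightarrow> u \<in> N \<rightarrow> M \<Longrightarrow> A M u \<phi> \<in> fb M"
  using is_all_A[of \<phi> N M u] base by (simp add: is_all_def)

text \<open>Maps out of \<exists> along a function: the adjunction, applied to the reindexed
  target.\<close>

lemma E_L:
  assumes ph: "\<phi> \<in> fb N" and M: "M \<in> U" and u: "u \<in> N \<rightarrow> M" and f: "f \<in> M \<rightarrow> p y"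
    and y: "y \<in> Obj (Total X)"
  shows "L (E M u \<phi>) f y \<longleftrightarrow> L \<phi> (\<lambda>a. f (u a)) y"
proof -
  have yf: "y \<in> fb (p y)" using y fbI by blast
  have r: "rx M f y \<in> fb M" using rx_fb[OF yf M f] .
  have "fle X (E M u \<phi>) (rx M f y) \<longleftrightarrow> fle X \<phi> (rx N u (rx M f y))"
    using is_ex_E[OF ph M u] r base by (simp add: is_ex_def reindex_rx)
  then show ?thesis
    using fle_rx[OF E_fb[OF ph M u] yf f] fle_rx[OF ph r u] rx_L[OF yf M f, of u \<phi>] fbD(1)[OF ph] u
    by simp
qed

lemma E_unit:
  assumes "\<phi> \<in> fb N" "M \<in> U" "u \<in> N \<rightarrow> M" shows "L \<phi> u (E M u \<phi>)"
  using E_L[OF assms, of "\<lambda>a. a" "E M u \<phi>"] L_refl[of "E M u \<phi>"] fbD[OF E_fb[OF assms]] by simp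

text \<open>Maps into \<exists>: Beck-Chevalley moves the quantifier into the fiber of
  \<open>z\<close>, where primeness can be applied to it.\<close>

lemma E_BC:
  assumes ph: "\<phi> \<in> fb N" and M: "M \<in> U" and u: "u \<in> N \<rightarrow> M" and f: "f \<in> p z \<rightarrow> M"
    and z: "z \<in> Obj (Total X)"
  shows "L z f (E M u \<phi>) \<longleftrightarrow> fle X z (E (p z) psnd (rx (pb N u (p z) f) pfst \<phi>))"
proof -
  have zf: "z \<in> fb (p z)" using z fbI by blast
  have U: "N \<in> U" "p z \<in> U" using fbD[OF ph] fbD[OF zf] by auto
  let ?P = "pb N u (p z) f"
  have P: "?P \<in> U" "pfst \<in> ?P \<rightarrow> N" "psnd \<in> ?P \<rightarrow> p z" using pb_U[OF U] by (auto dest: pbD)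
  have r: "rx ?P pfst \<phi> \<in> fb ?P" using rx_fb[OF ph P(1,2)] .
  have "fiso X (reindex X (arr (p z) f M) (ex X (arr N u M) \<phi>))
      (ex X (arr ?P psnd (p z)) (reindex X (arr ?P pfst N) \<phi>))"
    using R1_BC[rule_format, OF is_pullback_pb[OF U M u f], of \<phi>] ph by simp
  then have i: "fiso X (rx (p z) f (E M u \<phi>)) (E (p z) psnd (rx ?P pfst \<phi>))"
    using fbD(1)[OF ph] fbD(1)[OF r] reindex_rx[OF E_fb[OF ph M u]] reindex_rx[OF ph] by (simp add: E_def)
  note e = E_fb[OF ph M u] E_fb[OF r U(2) P(3)]
  have re: "rx (p z) f (E M u \<phi>) \<in> fb (p z)" using rx_fb[OF e(1) U(2) f] .
  have "L z f (E M u \<phi>) \<longleftrightarrow> fle X z (rx (p z) f (E M u \<phi>))" using fle_rx[OF zf e(1) f] by simp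
  also have "\<dots> \<longleftrightarrow> fle X z (E (p z) psnd (rx ?P pfst \<phi>))"
    using i L_trans unfolding fiso_def fle_L[OF zf re] fle_L[OF zf e(2)] fle_L[OF re e(2)] fle_L[OF e(2) re]
    by blast
  finally show ?thesis .
qed

text \<open>Maps into \<forall>: Beck-Chevalley, followed by the adjunction over the
  pullback.\<close>

lemma A_L:
  assumes ph: "\<phi> \<in> fb N" and M: "M \<in> U" and u: "u \<in> N \<rightarrow> M" and f: "f \<in> p z \<rightarrow> M"
    and z: "z \<in> Obj (Total X)"
  shows "L z f (A M u \<phi>) \<longleftrightarrow> L (rx (pb N u (p z) f) psnd z) pfst \<phi>"
proof -
  have zf: "z \<in> fb (p z)" using z fbI by blast
  have U: "N \<in> U" "p z \<in> U" using fbD[OF ph] fbD[OF zf] by auto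
  let ?P = "pb N u (p z) f"
  have P: "?P \<in> U" "pfst \<in> ?P \<rightarrow> N" "psnd \<in> ?P \<rightarrow> p z" using pb_U[OF U] by (auto dest: pbD)
  have r: "rx ?P pfst \<phi> \<in> fb ?P" using rx_fb[OF ph P(1,2)] .
  have rz: "rx ?P psnd z \<in> fb ?P" using rx_fb[OF zf P(1,3)] .
  have "fiso X (reindex X (arr (p z) f M) (univ X (arr N u M) \<phi>))
      (univ X (arr ?P psnd (p z)) (reindex X (arr ?P pfst N) \<phi>))"
    using R1_BC[rule_format, OF is_pullback_pb[OF U M u f], of \<phi>] ph by simp
  then have i: "fiso X (rx (p z) f (A M u \<phi>)) (A (p z) psnd (rx ?P pfst \<phi>))"
    using fbD(1)[OF ph] fbD(1)[OF r] reindex_rx[OF A_fb[OF ph M u]] reindex_rx[OF ph] by (simp add: A_def)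
  note e = A_fb[OF ph M u] A_fb[OF r U(2) P(3)]
  have re: "rx (p z) f (A M u \<phi>) \<in> fb (p z)" using rx_fb[OF e(1) U(2) f] .
  have "L z f (A M u \<phi>) \<longleftrightarrow> fle X z (rx (p z) f (A M u \<phi>))" using fle_rx[OF zf e(1) f] by simp
  also have "\<dots> \<longleftrightarrow> fle X z (A (p z) psnd (rx ?P pfst \<phi>))"
    using i L_trans unfolding fiso_def fle_L[OF zf re] fle_L[OF zf e(2)] fle_L[OF re e(2)] fle_L[OF e(2) re]
    by blast
  also have "\<dots> \<longleftrightarrow> fle X (rx ?P psnd z) (rx ?P pfst \<phi>)"
    using is_all_A[OF r U(2) P(3)] zf base by (simp add: is_all_def reindex_rx)
  also have "\<dots> \<longleftrightarrow> L (rx ?P psnd z) pfst \<phi>" using fle_rx[OF rz ph P(2)] .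
  finally show ?thesis .
qed

lemma delta_E: "delta X (M, V) = (E M (\<lambda>x. x) (tt V))" if "V \<in> U"
  using fbD(1)[OF tt_fb[OF that]] by (simp add: delta_def E_def inclusion_arr)

end

section \<open>Primeness, modesty and presentations in terms of maps along functions\<close>

locale prim = hyper elts X for elts :: "'v \<Rightarrow> 'v set" and X :: "('o, 'a, 'v) setfib" +
  fixes I :: "'v set" and Ai :: "'v \<Rightarrow> 'v set" and \<pi> :: "'v \<Rightarrow> 'o"
  assumes R2f: "R2_family X I Ai \<pi>"
begin

lemmas R2f_parts = R2f[unfolded R2_family_def base set_cat_sel]
lemmas I_U = R2f_parts[THEN conjunct1]
lemmas R2f_prime = R2f_parts[THEN conjunct2, THEN conjunct1]
lemmas R2f_closed = R2f_parts[THEN conjunct2, THEN conjunct2, THEN conjunct1]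
lemmas R2f_modest = R2f_parts[THEN conjunct2, THEN conjunct2, THEN conjunct2, THEN conjunct1]
lemmas R2f_gen = R2f_parts[THEN conjunct2, THEN conjunct2, THEN conjunct2, THEN conjunct2]

abbreviation S :: "'o set" where "S \<equiv> generated X I Ai \<pi>"

lemma Ai_U: "i \<in> I \<Longrightarrow> Ai i \<in> U" using R2f_prime by blast

lemma pi_fb: "i \<in> I \<Longrightarrow> \<pi> i \<in> fb (Ai i)" using R2f_prime by (simp add: ex_prime_def)

lemma pi_p [simp]: "i \<in> I \<Longrightarrow> p (\<pi> i) = Ai i" using pi_fb fbD by blast

lemma S_iff: "\<chi> \<in> S \<longleftrightarrow> \<chi> \<in> Obj (Total X) \<and>
    (\<exists>i\<in>I. \<exists>g\<in>p \<chi> \<rightarrow> Ai i. L \<chi> g (\<pi> i) \<and> L (rx (p \<chi>) g (\<pi> i)) (\<lambda>a. a) \<chi>)"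
proof -
  have *: "(\<exists>f\<in>hom (Base X) (p \<chi>) (Ai i). fiso X \<chi> (reindex X f (\<pi> i))) \<longleftrightarrow>
      (\<exists>g\<in>p \<chi> \<rightarrow> Ai i. L \<chi> g (\<pi> i) \<and> L (rx (p \<chi>) g (\<pi> i)) (\<lambda>a. a) \<chi>)"
    if x: "\<chi> \<in> Obj (Total X)" and i: "i \<in> I" for i
  proof -
    have c: "\<chi> \<in> fb (p \<chi>)" using x fbI by blast
    have k: "fiso X \<chi> (reindex X (arr (p \<chi>) g (Ai i)) (\<pi> i)) \<longleftrightarrow>
      L \<chi> g (\<pi> i) \<and> L (rx (p \<chi>) g (\<pi> i)) (\<lambda>a. a) \<chi>" if g: "g \<in> p \<chi> \<rightarrow> Ai i" for g
      unfolding fiso_def reindex_rx[OF pi_fb[OF i]] fle_rx[OF c pi_fb[OF i] g]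
        fle_L[OF rx_fb[OF pi_fb[OF i] fbD(3)[OF c] g] c] ..
    show ?thesis
    proof
      assume "\<exists>f\<in>hom (Base X) (p \<chi>) (Ai i). fiso X \<chi> (reindex X f (\<pi> i))"
      then obtain f where f: "f \<in> hom (set_cat elts) (p \<chi>) (Ai i)" "fiso X \<chi> (reindex X f (\<pi> i))"
        unfolding base by blast
      then obtain g where "f = arr (p \<chi>) g (Ai i)" "g \<in> p \<chi> \<rightarrow> Ai i" by (auto elim: homE)
      then show "\<exists>g\<in>p \<chi> \<rightarrow> Ai i. L \<chi> g (\<pi> i) \<and> L (rx (p \<chi>) g (\<pi> i)) (\<lambda>a. a) \<chi>" using f k by blast
    next
      assume "\<exists>g\<in>p \<chi> \<rightarrow> Ai i. L \<chi> g (\<pi> i) \<and> L (rx (p \<chi>) g (\<pi> i)) (\<lambda>a. a) \<chi>"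
      then obtain g where g: "g \<in> p \<chi> \<rightarrow> Ai i" "L \<chi> g (\<pi> i)" "L (rx (p \<chi>) g (\<pi> i)) (\<lambda>a. a) \<chi>" by blast
      have "arr (p \<chi>) g (Ai i) \<in> hom (Base X) (p \<chi>) (Ai i)"
        using base fbD[OF c] Ai_U[OF i] g by simp
      then show "\<exists>f\<in>hom (Base X) (p \<chi>) (Ai i). fiso X \<chi> (reindex X f (\<pi> i))"
        using k g by blast
    qed
  qed
  show ?thesis unfolding generated_def using * by blast
qed

lemma S_obj: "\<chi> \<in> S \<Longrightarrow> \<chi> \<in> Obj (Total X)" by (simp add: S_iff)
lemma S_fb: "\<chi> \<in> S \<Longrightarrow> \<chi> \<in> fb (p \<chi>)" by (simp add: S_iff fbI)

lemma tt_S: "M \<in> U \<Longrightarrow> tt M \<in> S"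
  using R2f_closed[unfolded closed_under_finite_meets_def base set_cat_sel] is_truth_tt by blast

lemma mt_S: "\<phi> \<in> S \<Longrightarrow> \<psi> \<in> S \<Longrightarrow> \<phi> \<in> fb M \<Longrightarrow> \<psi> \<in> fb M \<Longrightarrow> mt \<phi> \<psi> \<in> S"
  using R2f_closed[unfolded closed_under_finite_meets_def base set_cat_sel]
    is_meet_mt[of \<phi> M \<psi>] fbD(3)[of \<phi> M] by blast

lemma rx_S: assumes c: "\<chi> \<in> S" "\<chi> \<in> fb M" and f: "N \<in> U" "f \<in> N \<rightarrow> M" shows "rx N f \<chi> \<in> S"
proof -
  obtain i g where i: "i \<in> I" "g \<in> M \<rightarrow> Ai i" "L \<chi> g (\<pi> i)" "L (rx M g (\<pi> i)) (\<lambda>a. a) \<chi>"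
    using c fbD[OF c(2)] unfolding S_iff by blast
  have r: "rx N f \<chi> \<in> fb N" using rx_fb[OF c(2) f] .
  have g: "(\<lambda>a. g (f a)) \<in> N \<rightarrow> Ai i" using f i by auto
  have 1: "L (rx N f \<chi>) (\<lambda>a. g (f a)) (\<pi> i)" using L_trans[OF rx_proj[OF c(2) f] i(3)] .
  let ?z = "rx N (\<lambda>a. g (f a)) (\<pi> i)"
  have z: "?z \<in> fb N" using rx_fb[OF pi_fb[OF i(1)] f(1) g] .
  have "L ?z (\<lambda>a. g (f a)) (\<pi> i)" using rx_proj[OF pi_fb[OF i(1)] f(1) g] .
  then have "L ?z f (rx M g (\<pi> i))"
    using rx_L[OF pi_fb[OF i(1)] fbD(3)[OF c(2)] i(2), of f ?z] fbD(1)[OF z] f by simp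
  from L_trans[OF this i(4)] have "L ?z f \<chi>" .
  then have "L ?z (\<lambda>a. a) (rx N f \<chi>)" using rx_L[OF c(2) f, of "\<lambda>a. a" ?z] fbD(1)[OF z] by simp
  then show ?thesis unfolding S_iff using fbD[OF r] i(1) g 1 by auto
qed

lemma pi_S: "i \<in> I \<Longrightarrow> \<pi> i \<in> S"
  using R2f_modest by (simp add: modest_in_def)

text \<open>Primeness is given for reindexings of \<open>\<pi> i\<close> and for inequalities within
  one fiber. It passes to every \<chi> in \<open>S\<close> along the isomorphism with some reindexed
  \<open>\<pi> i\<close>, and to maps along \<open>f\<close> by pulling the existential back with
  \<open>E_BC\<close>.\<close>

lemma prime:
  assumes c: "\<chi> \<in> S" and u: "M \<in> U" "u \<in> N \<rightarrow> M" "\<psi> \<in> fb N" and l: "L \<chi> f (E M u \<psi>)"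
  obtains K e w where "K \<in> U" "e \<in> K \<rightarrow> p \<chi>" "e ` K = p \<chi>" "w \<in> K \<rightarrow> N" "\<And>k. k \<in> K \<Longrightarrow> u (w k) = f (e k)"
    "L (rx K e \<chi>) w \<psi>"
proof -
  let ?Z = "p \<chi>"
  have cf: "\<chi> \<in> fb ?Z" using S_fb c by blast
  have f: "f \<in> ?Z \<rightarrow> M" using L_fun[OF l] fbD[OF E_fb[OF u(3,1,2)]] by simp
  note U = fbD(3)[OF cf] fbD(3)[OF u(3)]
  \<comment> \<open>Witnesses live on this pullback: a point of \<open>?Z\<close> together with an
    element of \<open>N\<close> over its image under \<open>f\<close>.\<close>
  let ?P = "pb N u ?Z f"
  have P: "?P \<in> U" "pfst \<in> ?P \<rightarrow> N" "psnd \<in> ?P \<rightarrow> ?Z" using pb_U[OF U(2,1)] by (auto dest: pbD)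
  let ?\<theta> = "rx ?P pfst \<psi>"
  have th: "?\<theta> \<in> fb ?P" using rx_fb[OF u(3) P(1,2)] .
  have e: "E ?Z psnd ?\<theta> \<in> fb ?Z" using E_fb[OF th U(1) P(3)] .
  have le: "L \<chi> (\<lambda>a. a) (E ?Z psnd ?\<theta>)"
    using l unfolding E_BC[OF u(3,1,2) f S_obj[OF c]] fle_L[OF cf e] .
  obtain i g where i: "i \<in> I" "g \<in> ?Z \<rightarrow> Ai i" "L \<chi> g (\<pi> i)" "L (rx ?Z g (\<pi> i)) (\<lambda>a. a) \<chi>"
    using c unfolding S_iff by blast
  have r: "rx ?Z g (\<pi> i) \<in> fb ?Z" using rx_fb[OF pi_fb[OF i(1)] U(1) i(2)] .
  have ho: "arr ?Z g (Ai i) \<in> hom (set_cat elts) ?Z (Ai i)" "arr ?P psnd ?Z \<in> hom (set_cat elts) ?P ?Z"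
    using U i P Ai_U by auto
  have "L (rx ?Z g (\<pi> i)) (\<lambda>a. a) (E ?Z psnd ?\<theta>)" using L_trans[OF i(4) le] .
  then have "fle X (reindex X (arr ?Z g (Ai i)) (\<pi> i)) (ex X (arr ?P psnd ?Z) ?\<theta>)"
    using fle_L[OF r e] reindex_rx[OF pi_fb[OF i(1)]] fbD(1)[OF th] by (simp add: E_def)
  moreover have "ex_prime X (Ai i) (\<pi> i)" using R2f_prime i by blast
  ultimately obtain K e' w' where K: "e' \<in> hom (set_cat elts) K ?Z" "w' \<in> hom (set_cat elts) K ?P"
    "surjection e'" "Comp (set_cat elts) (arr ?P psnd ?Z) w' = e'"
    "fle X (reindex X (Comp (set_cat elts) (arr ?Z g (Ai i)) e') (\<pi> i)) (reindex X w' ?\<theta>)"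
    unfolding ex_prime_def base using ho th by blast
  obtain e where ee: "e' = arr K e ?Z" "K \<in> U" "e \<in> K \<rightarrow> ?Z" using K(1) by (rule homE)
  obtain w where ww: "w' = arr K w ?P" "w \<in> K \<rightarrow> ?P" using K(2) by (rule homE)
  have pw: "psnd (w k) = e k" if "k \<in> K" for k
    using K(4) that ww(2) by (simp add: ee ww arr_eq_iff)
  have ge: "(\<lambda>a. g (e a)) \<in> K \<rightarrow> Ai i" using ee i by auto
  have wf: "(\<lambda>a. pfst (w a)) \<in> K \<rightarrow> N" using ww P by auto
  have rk: "rx K (\<lambda>a. g (e a)) (\<pi> i) \<in> fb K" using rx_fb[OF pi_fb[OF i(1)] ee(2) ge] .
  have "fle X (rx K (\<lambda>a. g (e a)) (\<pi> i)) (rx K w ?\<theta>)"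
    using K(5) reindex_rx[OF pi_fb[OF i(1)]] reindex_rx[OF th] ee ww by simp
  then have "L (rx K (\<lambda>a. g (e a)) (\<pi> i)) w ?\<theta>" using fle_rx[OF rk th ww(2)] by simp
  then have k: "L (rx K (\<lambda>a. g (e a)) (\<pi> i)) (\<lambda>a. pfst (w a)) \<psi>"
    using L_trans rx_proj[OF u(3) P(1,2)] by blast
  have rc: "rx K e \<chi> \<in> fb K" using rx_fb[OF cf ee(2,3)] .
  have "L (rx K e \<chi>) (\<lambda>a. g (e a)) (\<pi> i)" using L_trans[OF rx_proj[OF cf ee(2,3)] i(3)] .
  then have "L (rx K e \<chi>) (\<lambda>a. a) (rx K (\<lambda>a. g (e a)) (\<pi> i))"
    using rx_L[OF pi_fb[OF i(1)] ee(2) ge, of "\<lambda>a. a"] fbD(1)[OF rc] by simp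
  from L_trans[OF this k] have fin: "L (rx K e \<chi>) (\<lambda>a. pfst (w a)) \<psi>" .
  show ?thesis
  proof (rule that[OF ee(2,3) _ wf _ fin])
    show "e ` K = ?Z" using K(3) ee by simp
    fix k assume "k \<in> K"
    then show "u (pfst (w k)) = f (e k)" using ww pw pbD[of "w k" N u ?Z f] by (metis PiE)
  qed
qed

text \<open>Modesty as descent: a function tracked on a cover factors through the cover, and the
  factor is tracked. This is what makes the codes found by \<open>prime\<close>
  single-valued.\<close>

lemma modest:
  assumes i: "i \<in> I" and c: "\<chi> \<in> S" "\<chi> \<in> fb J" and e: "K \<in> U" "e \<in> K \<rightarrow> J" "e ` K = J"
    and l: "L (rx K e \<chi>) f (\<pi> i)"
  obtains h where "h \<in> J \<rightarrow> Ai i" "\<And>k. k \<in> K \<Longrightarrow> h (e k) = f k" "L \<chi> h (\<pi> i)"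
proof -
  have r: "rx K e \<chi> \<in> fb K" using rx_fb[OF c(2) e(1,2)] .
  have f: "f \<in> K \<rightarrow> Ai i" using L_fun[OF l] fbD(1)[OF r] i by simp
  have J: "J \<in> U" using fbD(3)[OF c(2)] .
  have "fle X (reindex X (arr K e J) \<chi>) (reindex X (arr K f (Ai i)) (\<pi> i))"
    using l fle_rx[OF r pi_fb[OF i] f] reindex_rx[OF c(2)] reindex_rx[OF pi_fb[OF i]] by simp
  moreover have "arr K e J \<in> hom (set_cat elts) K J" "arr K f (Ai i) \<in> hom (set_cat elts) K (Ai i)"
    using e f J Ai_U[OF i] by simp_all
  moreover have "modest_in X S (Ai i) (\<pi> i)" using R2f_modest i by blast
  moreover have "surjection (arr K e J)" using e by simp
  ultimately obtain h' where h': "h' \<in> hom (set_cat elts) J (Ai i)"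
    "Comp (set_cat elts) h' (arr K e J) = arr K f (Ai i)" "fle X \<chi> (reindex X h' (\<pi> i))"
    using c unfolding modest_in_def base by blast
  obtain h where h: "h' = arr J h (Ai i)" "h \<in> J \<rightarrow> Ai i" using h'(1) by (rule homE)
  show ?thesis
  proof (rule that[OF h(2)])
    fix k assume "k \<in> K"
    then show "h (e k) = f k" using h'(2) h(1) e(2) by (simp add: arr_eq_iff)
  next
    show "L \<chi> h (\<pi> i)"
      using h'(3) fle_rx[OF c(2) pi_fb[OF i] h(2)] reindex_rx[OF pi_fb[OF i]] h(1) by simp
  qed
qed

text \<open>\<open>pres \<phi> N u i g\<close> says \<open>\<phi> \<cong> \<exists>\<^sub>u g\<^sup>*\<pi>\<^sub>i\<close>, stated through the universal property of the right-hand side.\<close>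

definition pres :: "'o \<Rightarrow> 'v set \<Rightarrow> ('v \<Rightarrow> 'v) \<Rightarrow> 'v \<Rightarrow> ('v \<Rightarrow> 'v) \<Rightarrow> bool" where
  "pres \<phi> N u i g \<longleftrightarrow> \<phi> \<in> Obj (Total X) \<and> N \<in> U \<and> u \<in> N \<rightarrow> p \<phi> \<and> i \<in> I \<and> g \<in> N \<rightarrow> Ai i \<and>
     (\<forall>y\<in>Obj (Total X). \<forall>f\<in>p \<phi> \<rightarrow> p y. L \<phi> f y \<longleftrightarrow> L (rx N g (\<pi> i)) (\<lambda>a. f (u a)) y)"

lemma pres_E:
  assumes "M \<in> U" "N \<in> U" "u \<in> N \<rightarrow> M" "i \<in> I" "g \<in> N \<rightarrow> Ai i"
  shows "pres (E M u (rx N g (\<pi> i))) N u i g"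
proof -
  have r: "rx N g (\<pi> i) \<in> fb N" using rx_fb[OF pi_fb] assms by blast
  note e = fbD[OF E_fb[OF r assms(1,3)]]
  show ?thesis unfolding pres_def e(1) using e(2) assms E_L[OF r assms(1,3)] by blast
qed

lemma pres_exists:
  assumes ph: "\<phi> \<in> fb M" shows "\<exists>N u i g. pres \<phi> N u i g"
proof -
  have M: "M \<in> U" using fbD(3)[OF ph] .
  obtain N u' \<psi> where u': "u' \<in> hom (set_cat elts) N M" "\<psi> \<in> S" "\<psi> \<in> fb N" "fiso X \<phi> (ex X u' \<psi>)"
    using R2f_gen M ph by blast
  obtain u where u: "u' = arr N u M" "N \<in> U" "u \<in> N \<rightarrow> M" using u'(1) by (rule homE)
  obtain i g where i: "i \<in> I" "g \<in> N \<rightarrow> Ai i" "L \<psi> g (\<pi> i)" "L (rx N g (\<pi> i)) (\<lambda>a. a) \<psi>"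
    using u'(2) fbD(1)[OF u'(3)] unfolding S_iff by blast
  have e: "E M u \<psi> \<in> fb M" using E_fb[OF u'(3) M u(3)] .
  have "fiso X \<phi> (E M u \<psi>)" using u'(4) u(1) fbD(1)[OF u'(3)] by (simp add: E_def)
  then have ee: "L \<phi> (\<lambda>a. a) (E M u \<psi>)" "L (E M u \<psi>) (\<lambda>a. a) \<phi>"
    using fle_L[OF ph e] fle_L[OF e ph] by (auto simp: fiso_def)
  have r: "rx N g (\<pi> i) \<in> fb N" using rx_fb[OF pi_fb[OF i(1)] u(2) i(2)] .
  have b: "L \<psi> (\<lambda>a. a) (rx N g (\<pi> i))"
    using rx_L[OF pi_fb[OF i(1)] u(2) i(2), of "\<lambda>a. a" \<psi>] fbD(1)[OF u'(3)] i(3) by simp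
  have "L \<phi> f y \<longleftrightarrow> L (rx N g (\<pi> i)) (\<lambda>a. f (u a)) y" if y: "y \<in> Obj (Total X)" and f: "f \<in> p \<phi> \<rightarrow> p y" for y f
  proof -
    have "L \<phi> f y \<longleftrightarrow> L (E M u \<psi>) f y" using L_trans[OF ee(1), of f y] L_trans[OF ee(2), of f y] by blast
    also have "\<dots> \<longleftrightarrow> L \<psi> (\<lambda>a. f (u a)) y" using E_L[OF u'(3) M u(3)] y f fbD(1)[OF ph] by simp
    also have "\<dots> \<longleftrightarrow> L (rx N g (\<pi> i)) (\<lambda>a. f (u a)) y"
      using L_trans[OF b, of "\<lambda>a. f (u a)" y] L_trans[OF i(4), of "\<lambda>a. f (u a)" y] by blast
    finally show ?thesis .
  qed
  then have "pres \<phi> N u i g" unfolding pres_def using u(2,3) i fbD[OF ph] by simp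
  then show ?thesis by blast
qed

lemma pres_unit: assumes "pres \<phi> N u i g" shows "L (rx N g (\<pi> i)) u \<phi>"
proof -
  have "\<phi> \<in> Obj (Total X)" "L \<phi> (\<lambda>a. a) \<phi>" using assms L_refl by (auto simp: pres_def)
  then show ?thesis using assms unfolding pres_def by fastforce
qed

end

section \<open>Supports and the left adjoint of delta\<close>

context set_univ
begin

lemma faithful_fib_sub: "faithful_fib (sub_fib (set_cat elts))"
  unfolding sub_fib_def
proof (rule faithful_fib_grothendieck)
  show "category (set_cat elts)" by (rule category_set_cat)
  fix L N M u v and \<phi> :: "'v set" assume "v \<in> hom (set_cat elts) L N" "u \<in> hom (set_cat elts) N M"
  then show "{n \<in> fst (Comp (set_cat elts) u v). fn (Comp (set_cat elts) u v) n \<in> \<phi>} =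
       {n \<in> fst v. fn v n \<in> {n \<in> fst u. fn u n \<in> \<phi>}}"
    by (auto elim!: homE)
qed (auto elim!: homE)

lemma over_sub: "over (sub_fib (set_cat elts)) (N, V) u (M, W) \<longleftrightarrow>
    u \<in> hom (set_cat elts) N M \<and> V \<subseteq> N \<and> W \<subseteq> M \<and> (\<forall>n\<in>V. fn u n \<in> W)"
  unfolding sub_fib_def over_grothendieck by (auto elim!: homE)

lemma sub_sel [simp]: "Base (sub_fib B) = B" "on_obj (Proj (sub_fib B)) = fst"
  "on_arr (Proj (sub_fib B)) = fst \<circ> snd"
  "Obj (Total (sub_fib B)) = {(M, V). M \<in> Obj B \<and> V \<subseteq> M}"
  by (auto simp: sub_fib_def grothendieck_def)

lemma sub_hom: "c \<in> hom (Total (sub_fib (set_cat elts))) (N, V) (M, W) \<longleftrightarrow>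
   (\<exists>u. c = ((N, V), u, (M, W)) \<and> over (sub_fib (set_cat elts)) (N, V) u (M, W))"
  unfolding over_sub by (auto simp: sub_fib_def grothendieck_def hom_def set_cat_def)

lemma fle_sub: "V \<subseteq> M \<Longrightarrow> M \<in> U \<Longrightarrow> fle (sub_fib (set_cat elts)) (M, V) (M, W) \<longleftrightarrow> W \<subseteq> M \<and> V \<subseteq> W"
  using over_sub[of M V "arr M (\<lambda>x. x) M" M W] by (auto simp: fle_def over_def)

lemma fiber_sub: "fiber (sub_fib (set_cat elts)) M = (if M \<in> U then {M} \<times> Pow M else {})"
  unfolding sub_fib_def fiber_grothendieck by simp

end

context set_fib
begin

text \<open>The general form of a functor to subsets over the identity of sets, given by a subset
  \<open>s \<phi>\<close> of the set on which \<phi> lives. Support and global truth are both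
  treated as instances.\<close>

definition sub_ftor where
  "sub_ftor s = \<lparr>on_obj = (\<lambda>\<phi>. (p \<phi>, s \<phi>)),
     on_arr = (\<lambda>c. ((p (Dom (Total X) c), s (Dom (Total X) c)), on_arr (Proj X) c,
                     (p (Cod (Total X) c), s (Cod (Total X) c))))\<rparr>"

lemma sub_ftor_arr:
  assumes s: "\<And>\<phi>. \<phi> \<in> Obj (Total X) \<Longrightarrow> s \<phi> \<subseteq> p \<phi>"
    and m: "\<And>\<phi> f \<psi> a. L \<phi> f \<psi> \<Longrightarrow> a \<in> s \<phi> \<Longrightarrow> f a \<in> s \<psi>"
    and c: "c \<in> hom (Total X) x y"
  shows "on_arr (sub_ftor s) c \<in> hom (Total (sub_fib (set_cat elts))) (p x, s x) (p y, s y) \<and>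
    on_arr (Proj (sub_fib (set_cat elts))) (on_arr (sub_ftor s) c) = on_arr (Proj X) c"
proof -
  have dc: "Dom (Total X) c = x" "Cod (Total X) c = y" using c by (auto simp: hom_def)
  have o: "over X x (on_arr (Proj X) c) y" using c by (auto simp: over_def)
  then obtain f where f: "on_arr (Proj X) c = arr (p x) f (p y)" "L x f y" by (auto simp: over_L)
  have ob: "x \<in> Obj (Total X)" "y \<in> Obj (Total X)" using L_obj f by auto
  have "over (sub_fib (set_cat elts)) (p x, s x) (on_arr (Proj X) c) (p y, s y)"
    unfolding over_sub using over_hom[OF o] base s[OF ob(1)] s[OF ob(2)] m[OF f(2)] f(1)
    by (auto simp: subset_iff)
  then show ?thesis unfolding sub_hom by (simp add: sub_ftor_def dc)
qed

text \<open>Cartesian arrows between subsets are inverse images. Monotonicity \<open>m\<close> gives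
  one inclusion, \<open>r\<close> the other.\<close>

lemma fibered_sub_ftor:
  assumes s: "\<And>\<phi>. \<phi> \<in> Obj (Total X) \<Longrightarrow> s \<phi> \<subseteq> p \<phi>"
    and m: "\<And>\<phi> f \<psi> a. L \<phi> f \<psi> \<Longrightarrow> a \<in> s \<phi> \<Longrightarrow> f a \<in> s \<psi>"
    and r: "\<And>\<phi> N f a. \<phi> \<in> Obj (Total X) \<Longrightarrow> N \<in> U \<Longrightarrow> f \<in> N \<rightarrow> p \<phi> \<Longrightarrow> a \<in> N \<Longrightarrow> f a \<in> s \<phi> \<Longrightarrow> a \<in> s (rx N f \<phi>)"
  shows "fibered_ftor X (sub_fib (set_cat elts)) (sub_ftor s)"
proof -
  interpret Y: faithful_fib "sub_fib (set_cat elts)" by (rule faithful_fib_sub)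
  let ?Y = "sub_fib (set_cat elts)"
  have a: "on_arr (sub_ftor s) c \<in> hom (Total ?Y) (p x, s x) (p y, s y) \<and>
      on_arr (Proj ?Y) (on_arr (sub_ftor s) c) = on_arr (Proj X) c" if "c \<in> hom (Total X) x y" for c x y
    using that by (rule sub_ftor_arr[rotated 2]) (use s m in blast)+
  have ob: "on_obj (sub_ftor s) x = (p x, s x)" for x by (simp add: sub_ftor_def)
  have ft: "is_ftor (Total X) (Total ?Y) (sub_ftor s)"
    unfolding is_ftor_def
  proof (intro conjI ballI allI)
    fix x assume x: "x \<in> Obj (Total X)"
    show o: "on_obj (sub_ftor s) x \<in> Obj (Total ?Y)"
      using s[OF x] fbD(3)[OF fbI[OF x]] by (simp add: ob)
    show "on_arr (sub_ftor s) (Ident (Total X) x) = Ident (Total ?Y) (on_obj (sub_ftor s) x)"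
      using a[of "Ident (Total X) x" x x] ident_hom[OF x] Y.ident_hom[OF o] base
        Y.over_unique[of "on_arr (sub_ftor s) (Ident (Total X) x)" "(p x, s x)" "(p x, s x)"
          "Ident (Total ?Y) (p x, s x)"]
      by (simp add: ob)
  next
    fix x y f assume "f \<in> hom (Total X) x y"
    then show "on_arr (sub_ftor s) f \<in> hom (Total ?Y) (on_obj (sub_ftor s) x) (on_obj (sub_ftor s) y)"
      using a by (simp add: ob)
  next
    fix x y z f g assume f: "f \<in> hom (Total X) x y" and g: "g \<in> hom (Total X) y z"
    note 1 = conjunct1[OF a[OF f]] conjunct1[OF a[OF g]]
    have 2: "on_arr (Proj ?Y) (on_arr (sub_ftor s) (Comp (Total X) g f)) =
       on_arr (Proj ?Y) (Comp (Total ?Y) (on_arr (sub_ftor s) g) (on_arr (sub_ftor s) f))"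
      using Y.comp_hom[OF 1] a[OF f] a[OF g] comp_hom[OF f g] a[of "Comp (Total X) g f" x z] base by simp
    show "on_arr (sub_ftor s) (Comp (Total X) g f) =
       Comp (Total ?Y) (on_arr (sub_ftor s) g) (on_arr (sub_ftor s) f)"
      by (rule Y.over_unique[OF _ conjunct1[OF Y.comp_hom[OF 1]] 2])
        (use a comp_hom[OF f g] in blast)
  qed
  have ca: "cartesian ?Y (on_arr (sub_ftor s) c)" if cc: "cartesian X c" for c
  proof -
    obtain x y f where c: "c \<in> hom (Total X) x y" "on_arr (Proj X) c = arr (p x) f (p y)" "L x f y"
      "fle X (rx (p x) f y) x" using cc unfolding cartesian_L by blast
    have x: "x \<in> fb (p x)" and y: "y \<in> fb (p y)" using L_obj[OF c(3)] fbI by auto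
    note ac = a[OF c(1)]
    have z: "rx (p x) f y \<in> fb (p x)" using rx_fb[OF y fbD(3)[OF x] L_fun[OF c(3)]] .
    have reflect: "b \<in> s x" if "b \<in> p x" "f b \<in> s y" for b
      using m[of "rx (p x) f y" "\<lambda>a. a" x b] c(4) fle_L[OF z x]
        r[of y "p x" f b] that fbD(2)[OF y] fbD(3)[OF x] L_fun[OF c(3)] by simp
    have h: "arr (p x) f (p y) \<in> hom (set_cat elts) (p x) (p y)" using fbD(3)[OF x] fbD(3)[OF y] L_fun[OF c(3)] by simp
    have "over ?Y z w (p x, s x)" if z: "z \<in> Obj (Total ?Y)" and w: "w \<in> hom (set_cat elts) (fst z) (p x)"
      and o: "over ?Y z (Comp (set_cat elts) (arr (p x) f (p y)) w) (p y, s y)" for z w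
    proof -
      obtain K V where KV: "z = (K, V)" by (cases z)
      obtain g where g: "w = arr K g (p x)" "g \<in> K \<rightarrow> p x" using w[unfolded KV fst_conv] by (rule homE)
      have VK: "V \<subseteq> K" using z by (simp add: KV)
      have "f (g n) \<in> s y" if n: "n \<in> V" for n
      proof -
        have "n \<in> K" using n VK by blast
        then show ?thesis using o n g unfolding KV over_sub by (simp split: if_splits)
      qed
      then have "\<forall>n\<in>V. fn w n \<in> s x" using reflect g VK by (auto simp: subset_iff)
      then show ?thesis using w VK s[OF fbD(2)[OF x]] unfolding KV over_sub by simp
    qed
    moreover have "Dom (Total ?Y) (on_arr (sub_ftor s) c) = (p x, s x)"
      "Cod (Total ?Y) (on_arr (sub_ftor s) c) = (p y, s y)" "on_arr (sub_ftor s) c \<in> Arr (Total ?Y)"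
      using ac by (auto simp: hom_def)
    ultimately show ?thesis
      unfolding Y.cartesian_iff using ac c(2) by simp
  qed
  show ?thesis
    unfolding fibered_ftor_def
  proof (intro conjI ballI allI impI)
    fix f assume "f \<in> Arr (Total X)"
    then show "on_arr (Proj ?Y) (on_arr (sub_ftor s) f) = on_arr (Proj X) f"
      using a[of f] by (auto simp: hom_def)
  qed (use base ft ca in \<open>auto simp: ob\<close>)
qed

end

context prim
begin

text \<open>
  The support is the image of \<open>u\<close> for any presentation \<open>\<phi> \<cong> \<exists>\<^sub>u \<psi>\<close> with \<open>\<psi> \<in> S\<close>. Testing it on global points
  makes its stability under reindexing and meets immediate, without Frobenius reciprocity.
\<close>

definition supp :: "'o \<Rightarrow> 'v set" where
  "supp \<phi> = {m \<in> p \<phi>. \<exists>\<chi>\<in>S \<inter> fb one_set. L \<chi> (\<lambda>_. m) \<phi>}"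

text \<open>The test of \<open>supp\<close> with truth as the only test predicate. Truth belongs to
  \<open>S\<close>, so \<open>gam\<close> is always contained in \<open>supp\<close>, and the
  condition on \<gamma> amounts to the converse inclusion.\<close>

definition gam :: "'o \<Rightarrow> 'v set" where
  "gam \<phi> = {m \<in> p \<phi>. L (tt one_set) (\<lambda>_. m) \<phi>}"

lemma supp_mono: "L \<phi> f \<psi> \<Longrightarrow> a \<in> supp \<phi> \<Longrightarrow> f a \<in> supp \<psi>"
  using L_trans[of _ _ \<phi> f \<psi>] L_fun[of \<phi> f \<psi>] unfolding supp_def by blast

lemma gam_mono: "L \<phi> f \<psi> \<Longrightarrow> a \<in> gam \<phi> \<Longrightarrow> f a \<in> gam \<psi>"
  using L_trans[of _ _ \<phi> f \<psi>] L_fun[of \<phi> f \<psi>] unfolding gam_def by blast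

lemma delta_fb: assumes "M \<in> U" "V \<subseteq> M" shows "E M (\<lambda>x. x) (tt V) \<in> fb M"
proof -
  have "V \<in> U" using assms sep_U by blast
  then show ?thesis using E_fb[OF tt_fb[of V] assms(1), of "\<lambda>x. x"] assms(2) by auto
qed

text \<open>For a map into \<open>delta\<close>, primeness turns a test at \<open>m\<close> into an
  element of \<open>V\<close> equal to \<open>m\<close>. For the other direction take a presentation
  of \<phi> along \<open>u\<close>: each \<open>n\<close> yields a test predicate at
  \<open>u n\<close>, so \<open>u\<close> takes values in the support, hence in \<open>V\<close>,
  and \<phi> maps to truth on \<open>V\<close>.\<close>

lemma supp_delta:
  assumes ph: "\<phi> \<in> fb M" and V: "V \<subseteq> M"
  shows "fle X \<phi> (delta X (M, V)) \<longleftrightarrow> supp \<phi> \<subseteq> V"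
proof -
  have M: "M \<in> U" and VU: "V \<in> U" using fbD(3)[OF ph] sep_U V by auto
  let ?d = "E M (\<lambda>x. x) (tt V)"
  have d: "?d \<in> fb M" using delta_fb M V .
  have "L \<phi> (\<lambda>a. a) ?d \<longleftrightarrow> supp \<phi> \<subseteq> V"
  proof
    assume l: "L \<phi> (\<lambda>a. a) ?d"
    show "supp \<phi> \<subseteq> V"
    proof
      fix m assume "m \<in> supp \<phi>"
      then obtain \<chi> where c: "\<chi> \<in> S" "\<chi> \<in> fb one_set" "L \<chi> (\<lambda>_. m) \<phi>" by (auto simp: supp_def)
      have "L \<chi> (\<lambda>_. m) ?d" using L_trans[OF c(3) l] .
      have id: "(\<lambda>x. x) \<in> V \<rightarrow> M" using V by auto
      obtain K e w where k: "K \<in> U" "e \<in> K \<rightarrow> p \<chi>" "e ` K = p \<chi>" "w \<in> K \<rightarrow> V"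
        "\<And>k. k \<in> K \<Longrightarrow> w k = m" "L (rx K e \<chi>) w (tt V)"
        by (rule prime[OF c(1) M id tt_fb[OF VU] \<open>L \<chi> (\<lambda>_. m) ?d\<close>]) blast
      \<comment> \<open>The test lives on a one-element set, so the cover \<open>K\<close> has an
        element; its image under \<open>w\<close> lies in \<open>V\<close> and is
        \<open>m\<close>.\<close>
      have "p \<chi> \<noteq> {}" using fbD(1)[OF c(2)] by (simp add: one_set_def)
      then obtain k where "k \<in> K" using k(3) by blast
      then show "m \<in> V" using k(4,5) by (metis PiE)
    qed
  next
    assume s: "supp \<phi> \<subseteq> V"
    obtain N u i g where pr: "pres \<phi> N u i g" using pres_exists[OF ph] by blast
    then have N: "N \<in> U" "u \<in> N \<rightarrow> M" "i \<in> I" "g \<in> N \<rightarrow> Ai i" using fbD(1)[OF ph] by (auto simp: pres_def)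
    let ?r = "rx N g (\<pi> i)"
    have r: "?r \<in> fb N" "?r \<in> S" using rx_fb[OF pi_fb N(1,4)] rx_S[OF pi_S pi_fb N(1,4)] N by auto
    have ru: "L ?r u \<phi>" using pres_unit[OF pr] .
    have "u n \<in> V" if n: "n \<in> N" for n
    proof -
      have c: "(\<lambda>_. n) \<in> one_set \<rightarrow> N" using n by auto
      have "L (rx one_set (\<lambda>_. n) ?r) (\<lambda>_. u n) \<phi>" using L_rx_dom[OF ru r(1) one_U c] .
      moreover have "rx one_set (\<lambda>_. n) ?r \<in> S \<inter> fb one_set"
        using rx_S[OF r(2,1) one_U c] rx_fb[OF r(1) one_U c] by blast
      moreover have "u n \<in> p \<phi>" using n N fbD(1)[OF ph] by auto
      ultimately have "u n \<in> supp \<phi>" unfolding supp_def by blast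
      then show ?thesis using s by blast
    qed
    then have "L ?r u (tt V)" using tt_L[OF VU fbD(2)[OF r(1)]] fbD(1)[OF r(1)] by auto
    moreover have "L (tt V) (\<lambda>a. a) ?d" using E_unit[OF tt_fb[OF VU] M, of "\<lambda>a. a"] V by auto
    ultimately have "L ?r u ?d" using L_trans by blast
    then show "L \<phi> (\<lambda>a. a) ?d" using pr fbD[OF d] fbD[OF ph] unfolding pres_def by auto
  qed
  then show ?thesis unfolding delta_E[OF VU] fle_L[OF ph d] .
qed

lemma supp_sub: "supp \<phi> \<subseteq> p \<phi>" by (auto simp: supp_def)
lemma gam_sub: "gam \<phi> \<subseteq> p \<phi>" by (auto simp: gam_def)

lemma supp_adjoint: "fibered_left_adjoint_of_delta X (sub_ftor supp)"
  unfolding fibered_left_adjoint_of_delta_def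
proof (intro conjI ballI)
  show "fibered_ftor X (sub_fib (Base X)) (sub_ftor supp)"
    unfolding base
  proof (rule fibered_sub_ftor)
    fix \<phi> N f a assume ph: "\<phi> \<in> Obj (Total X)" and f: "N \<in> U" "f \<in> N \<rightarrow> p \<phi>" and a: "a \<in> N" "f a \<in> supp \<phi>"
    obtain \<chi> where c: "\<chi> \<in> S \<inter> fb one_set" "L \<chi> (\<lambda>_. f a) \<phi>" using a by (auto simp: supp_def)
    have "(\<lambda>_. a) \<in> p \<chi> \<rightarrow> N" using a by auto
    then have "L \<chi> (\<lambda>_. a) (rx N f \<phi>)" using rx_L[OF fbI[OF ph] f, of "\<lambda>_. a" \<chi>] c by simp
    then show "a \<in> supp (rx N f \<phi>)" using c a(1) fbD(1)[OF rx_fb[OF fbI[OF ph] f]] by (auto simp: supp_def)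
  qed (auto intro: supp_mono supp_sub[THEN subsetD])
next
  fix M \<phi> W assume M: "M \<in> Obj (Base X)" and ph: "\<phi> \<in> fb M" and W: "W \<in> fiber (sub_fib (Base X)) M"
  obtain V where V: "W = (M, V)" "V \<subseteq> M" using W unfolding base fiber_sub by (auto split: if_splits)
  show "fle (sub_fib (Base X)) (on_obj (sub_ftor supp) \<phi>) W \<longleftrightarrow> fle X \<phi> (delta X W)"
    using supp_delta[OF ph V(2)] fle_sub[of "supp \<phi>" M V] supp_sub[of \<phi>] V fbD[OF ph] base
    by (simp add: sub_ftor_def)
qed

text \<open>Two tests at the same point combine into their meet, which is again a test because
  \<open>S\<close> is closed under finite meets.\<close>

lemma supp_meets: "finite_meet_preserving X (sub_fib (Base X)) (sub_ftor supp)"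
  unfolding finite_meet_preserving_def base set_cat_sel
proof (intro conjI ballI allI impI)
  fix M \<tau> assume M: "M \<in> U" and t: "is_truth X M \<tau>"
  have tf: "\<tau> \<in> fb M" "L (tt M) (\<lambda>a. a) \<tau>"
    using t tt_fb[OF M] fle_L[OF tt_fb[OF M]] by (auto simp: is_truth_def)
  have "m \<in> supp \<tau>" if m: "m \<in> M" for m
  proof -
    have "L (tt one_set) (\<lambda>_. m) (tt M)"
      using tt_L[OF M fbD(2)[OF tt_fb[OF one_U]]] m by auto
    from L_trans[OF this tf(2)] show ?thesis
      using tt_S[OF one_U] tt_fb[OF one_U] m fbD(1)[OF tf(1)] by (auto simp: supp_def)
  qed
  then have "supp \<tau> = M" using supp_sub[of \<tau>] fbD(1)[OF tf(1)] by auto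
  then show "is_truth (sub_fib (set_cat elts)) M (on_obj (sub_ftor supp) \<tau>)"
    using M fbD(1)[OF tf(1)] fle_sub[of _ M M] by (auto simp: is_truth_def fiber_sub sub_ftor_def)
next
  fix M \<phi> \<psi> \<mu> assume M: "M \<in> U" and ph: "\<phi> \<in> fb M" "\<psi> \<in> fb M" and mu: "is_meet X M \<phi> \<psi> \<mu>"
  have mf: "\<mu> \<in> fb M" using mu by (simp add: is_meet_def)
  have "L \<mu> (\<lambda>a. a) \<phi>" "L \<mu> (\<lambda>a. a) \<psi>"
    using meet_L[OF mu ph, of "\<lambda>a. a" \<mu>] fbD[OF mf] L_refl[of \<mu>] by auto
  then have 1: "supp \<mu> \<subseteq> supp \<phi> \<inter> supp \<psi>" using supp_mono by fastforce
  have 2: "m \<in> supp \<mu>" if m: "m \<in> supp \<phi>" "m \<in> supp \<psi>" for m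
  proof -
    obtain \<chi> where c: "\<chi> \<in> S" "\<chi> \<in> fb one_set" "L \<chi> (\<lambda>_. m) \<phi>" using m by (auto simp: supp_def)
    obtain \<chi>' where c': "\<chi>' \<in> S" "\<chi>' \<in> fb one_set" "L \<chi>' (\<lambda>_. m) \<psi>" using m by (auto simp: supp_def)
    let ?c = "mt \<chi> \<chi>'"
    have cc: "?c \<in> S" "?c \<in> fb one_set" using mt_S c c' mt_fb by auto
    have "L ?c (\<lambda>_. m) \<phi>" "L ?c (\<lambda>_. m) \<psi>"
      using L_trans[OF mt_fst[OF c(2) c'(2)] c(3)] L_trans[OF mt_snd[OF c(2) c'(2)] c'(3)] by auto
    moreover have "m \<in> M" using m supp_sub[of \<phi>] fbD(1)[OF ph(1)] by auto
    ultimately have "L ?c (\<lambda>_. m) \<mu>" using meet_L[OF mu ph _ fbD(2)[OF cc(2)]] by auto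
    then show ?thesis using cc \<open>m \<in> M\<close> fbD(1)[OF mf] by (auto simp: supp_def)
  qed
  have "supp \<mu> = supp \<phi> \<inter> supp \<psi>" using 1 2 by blast
  then show "is_meet (sub_fib (set_cat elts)) M (on_obj (sub_ftor supp) \<phi>) (on_obj (sub_ftor supp) \<psi>)
     (on_obj (sub_ftor supp) \<mu>)"
    using M fbD(1)[OF mf] fbD(1)[OF ph(1)] fbD(1)[OF ph(2)] fle_sub[of _ M] supp_sub[of \<phi>] supp_sub[of \<psi>]
    by (auto simp: is_meet_def fiber_sub sub_ftor_def)
qed

lemma gamma_obj_gam: assumes ph: "\<phi> \<in> Obj (Total X)" shows "gamma_obj X \<phi> = (p \<phi>, gam \<phi>)"
proof -
  have "fle X (tt one_set) (reindex X (point (p \<phi>) m) \<phi>) \<longleftrightarrow> L (tt one_set) (\<lambda>_. m) \<phi>" if "m \<in> p \<phi>" for m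
    unfolding point_arr reindex_rx[OF fbI[OF ph]]
    using fle_rx[OF tt_fb[OF one_U] fbI[OF ph]] that by simp
  then show ?thesis by (auto simp: gamma_obj_def gam_def)
qed

lemma pi_ftor_spec:
  "fibered_left_adjoint_of_delta X (pi_ftor X)" "finite_meet_preserving X (sub_fib (Base X)) (pi_ftor X)"
  unfolding pi_ftor_def
  using someI[of "\<lambda>P. fibered_left_adjoint_of_delta X P \<and> finite_meet_preserving X (sub_fib (Base X)) P",
      OF conjI[OF supp_adjoint supp_meets]] by auto

text \<open>\<open>pi_ftor\<close> is an arbitrary choice among left adjoints. Fibers of the subset
  fibration are partial orders, so on objects the choice agrees with \<open>supp\<close> exactly,
  not only up to isomorphism.\<close>

lemma pi_obj: assumes ph: "\<phi> \<in> Obj (Total X)" shows "on_obj (pi_ftor X) \<phi> = (p \<phi>, supp \<phi>)"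
proof -
  let ?M = "p \<phi>"
  have f: "\<phi> \<in> fb ?M" using ph fbI by blast
  have "fibered_ftor X (sub_fib (set_cat elts)) (pi_ftor X)"
    using pi_ftor_spec(1) base by (simp add: fibered_left_adjoint_of_delta_def)
  then have o: "on_obj (pi_ftor X) \<phi> \<in> Obj (Total (sub_fib (set_cat elts)))"
    "fst (on_obj (pi_ftor X) \<phi>) = ?M"
    using ph by (auto simp: fibered_ftor_def is_ftor_def)
  then obtain W where W: "on_obj (pi_ftor X) \<phi> = (?M, W)" "W \<subseteq> ?M" by (cases "on_obj (pi_ftor X) \<phi>") auto
  have "W \<subseteq> V \<longleftrightarrow> supp \<phi> \<subseteq> V" if V: "V \<subseteq> ?M" for V
  proof -
    have "fle (sub_fib (set_cat elts)) (?M, W) (?M, V) \<longleftrightarrow> fle X \<phi> (delta X (?M, V))"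
      using pi_ftor_spec(1)[unfolded fibered_left_adjoint_of_delta_def base, THEN conjunct2, rule_format,
          of ?M \<phi> "(?M, V)"] f V fbD(3)[OF f] W(1)
      by (simp add: fiber_sub)
    then show ?thesis using fle_sub[OF W(2) fbD(3)[OF f]] supp_delta[OF f V] V by simp
  qed
  then have "W = supp \<phi>" using W(2) supp_sub[of \<phi>] by blast
  then show ?thesis using W by simp
qed

text \<open>Every point of \<open>Ai i\<close> lies in the support of \<open>\<pi> i\<close>, tested
  by the reindexing of \<open>\<pi> i\<close> to that point, so it must be true if
  \<open>gam\<close> and \<open>supp\<close> agree. Conversely every test predicate is isomorphic to
  such a reindexing; if these are all true, truth can replace every test.\<close>

lemma gamma_iso_pi_iff:
  "gamma_iso_pi X \<longleftrightarrow> (\<forall>i\<in>I. \<forall>a\<in>Ai i. L (tt one_set) (\<lambda>_. a) (\<pi> i))"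
proof
  assume "gamma_iso_pi X"
  then obtain \<eta> where \<eta>: "\<And>x. x \<in> Obj (Total X) \<Longrightarrow>
     \<eta> x \<in> hom (Total (sub_fib (set_cat elts))) (gamma_obj X x) (on_obj (pi_ftor X) x) \<and>
     iso_arr (Total (sub_fib (set_cat elts))) (\<eta> x) \<and>
     on_arr (Proj (sub_fib (set_cat elts))) (\<eta> x) = arr (p x) (\<lambda>x. x) (p x)"
    unfolding gamma_iso_pi_def vertical_iso_def base gamma_ftor_def by auto
  show "\<forall>i\<in>I. \<forall>a\<in>Ai i. L (tt one_set) (\<lambda>_. a) (\<pi> i)"
  proof (intro ballI)
    fix i a assume i: "i \<in> I" and a: "a \<in> Ai i"
    let ?x = "\<pi> i"
    have x: "?x \<in> Obj (Total X)" using pi_fb i fbD by blast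
    have h: "\<eta> ?x \<in> hom (Total (sub_fib (set_cat elts))) (Ai i, gam ?x) (Ai i, supp ?x)"
      "iso_arr (Total (sub_fib (set_cat elts))) (\<eta> ?x)"
      using \<eta>[OF x] gamma_obj_gam[OF x] pi_obj[OF x] i by auto
    have dc: "Dom (Total (sub_fib (set_cat elts))) (\<eta> ?x) = (Ai i, gam ?x)"
      "Cod (Total (sub_fib (set_cat elts))) (\<eta> ?x) = (Ai i, supp ?x)" using h(1) by (auto simp: hom_def)
    interpret Y: faithful_fib "sub_fib (set_cat elts)" by (rule faithful_fib_sub)
    obtain g where g: "g \<in> hom (Total (sub_fib (set_cat elts))) (Ai i, supp ?x) (Ai i, gam ?x)"
      "Comp (Total (sub_fib (set_cat elts))) (\<eta> ?x) g = Ident (Total (sub_fib (set_cat elts))) (Ai i, supp ?x)"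
      using h(2) unfolding iso_arr_def dc by blast
    let ?u = "on_arr (Proj (sub_fib (set_cat elts))) g"
    have gu: "over (sub_fib (set_cat elts)) (Ai i, supp ?x) ?u (Ai i, gam ?x)" using g by (auto simp: over_def)
    then have uh: "?u \<in> hom (set_cat elts) (Ai i) (Ai i)" unfolding over_sub by blast
    have so: "(Ai i, supp ?x) \<in> Obj (Total (sub_fib (set_cat elts)))" using Ai_U[OF i] supp_sub[of ?x] i by simp
    have "Comp (set_cat elts) (arr (Ai i) (\<lambda>x. x) (Ai i)) ?u = arr (Ai i) (\<lambda>x. x) (Ai i)"
      using Y.comp_hom[OF g(1) h(1)] g(2) Y.ident_hom[OF so] \<eta>[OF x] i by simp
    \<comment> \<open>The inverse isomorphism lies over the identity as well and is therefore an
      inclusion of \<open>supp\<close> in \<open>gam\<close>.\<close>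
    then have "?u = arr (Ai i) (\<lambda>x. x) (Ai i)" using Y.base_unit[of ?u] uh by simp
    then have "supp ?x \<subseteq> gam ?x" using gu supp_sub[of ?x] i unfolding over_sub by (auto simp: subset_iff)
    moreover have "a \<in> supp ?x"
    proof -
      have c: "(\<lambda>_. a) \<in> one_set \<rightarrow> Ai i" using a by auto
      show ?thesis
        using rx_S[OF pi_S[OF i] pi_fb[OF i] one_U c] rx_fb[OF pi_fb[OF i] one_U c]
          rx_proj[OF pi_fb[OF i] one_U c] a i unfolding supp_def by auto
    qed
    ultimately show "L (tt one_set) (\<lambda>_. a) (\<pi> i)" by (auto simp: gam_def)
  qed
next
  assume t: "\<forall>i\<in>I. \<forall>a\<in>Ai i. L (tt one_set) (\<lambda>_. a) (\<pi> i)"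
  have eq: "gam \<phi> = supp \<phi>" for \<phi>
  proof
    show "gam \<phi> \<subseteq> supp \<phi>" using tt_S[OF one_U] tt_fb[OF one_U] by (auto simp: gam_def supp_def)
    show "supp \<phi> \<subseteq> gam \<phi>"
    proof
      fix m assume "m \<in> supp \<phi>"
      then obtain \<chi> where m: "m \<in> p \<phi>" and c: "\<chi> \<in> S" "\<chi> \<in> fb one_set" "L \<chi> (\<lambda>_. m) \<phi>"
        by (auto simp: supp_def)
      obtain i g where i: "i \<in> I" "g \<in> one_set \<rightarrow> Ai i" "L (rx one_set g (\<pi> i)) (\<lambda>a. a) \<chi>"
        using c(1) fbD(1)[OF c(2)] unfolding S_iff by auto
      have "L (tt one_set) (\<lambda>_. g undefined) (\<pi> i)" using t i by (auto simp: one_set_def)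
      then have "L (tt one_set) g (\<pi> i)"
        by (rule L_cong) (use fbD(1)[OF tt_fb[OF one_U]] in \<open>simp add: one_set_def\<close>)
      then have "L (tt one_set) (\<lambda>a. a) (rx one_set g (\<pi> i))"
        using rx_L[OF pi_fb[OF i(1)] one_U i(2), of "\<lambda>a. a" "tt one_set"] fbD(1)[OF tt_fb[OF one_U]] by simp
      from L_trans[OF L_trans[OF this i(3)] c(3)] show "m \<in> gam \<phi>" using m by (simp add: gam_def)
    qed
  qed
  let ?Y = "sub_fib (set_cat elts)"
  interpret Y: faithful_fib ?Y by (rule faithful_fib_sub)
  have pf: "fibered_ftor X ?Y (pi_ftor X)"
    using pi_ftor_spec(1) base by (simp add: fibered_left_adjoint_of_delta_def)
  have ov: "over ?Y (p x, supp x) (arr (p x) (\<lambda>x. x) (p x)) (p x, supp x)" if "x \<in> Obj (Total X)" for x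
    unfolding over_sub using supp_sub[of x] fbD(3)[OF fbI[OF that]] by auto
  show "gamma_iso_pi X"
    unfolding gamma_iso_pi_def base
  proof (rule vertical_isoI)
    fix x y f assume f: "f \<in> hom (Total X) x y"
    then have xy: "x \<in> Obj (Total X)" "y \<in> Obj (Total X)" using cat_total by (auto simp: category_def hom_def)
    have dc: "Dom (Total X) f = x" "Cod (Total X) f = y" using f by (auto simp: hom_def)
    have "on_arr (gamma_ftor X) f = on_arr (sub_ftor gam) f"
      using gamma_obj_gam xy by (simp add: gamma_ftor_def sub_ftor_def dc)
    then show "on_arr (gamma_ftor X) f \<in> hom (Total ?Y) (on_obj (gamma_ftor X) x) (on_obj (gamma_ftor X) y) \<and>
      on_arr (Proj ?Y) (on_arr (gamma_ftor X) f) = on_arr (Proj X) f"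
      using sub_ftor_arr[of gam f x y] gam_sub gam_mono f gamma_obj_gam xy by (simp add: gamma_ftor_def)
    show "on_arr (pi_ftor X) f \<in> hom (Total ?Y) (on_obj (pi_ftor X) x) (on_obj (pi_ftor X) y) \<and>
      on_arr (Proj ?Y) (on_arr (pi_ftor X) f) = on_arr (Proj X) f"
      using pf f unfolding fibered_ftor_def is_ftor_def by (simp add: hom_def)
  qed (use faithful_fib_sub cat_total base gamma_obj_gam pi_obj eq ov in \<open>auto simp: gamma_ftor_def\<close>)
qed

end

section \<open>Typed partial combinatory algebras\<close>

lemma papp_Some_iff: "papp f s t = Some r \<longleftrightarrow> (\<exists>x y. s = Some x \<and> t = Some y \<and> f x y = Some r)"
  by (cases s; cases t; simp add: papp_def)

locale tp = set_univ elts for elts :: "'v \<Rightarrow> 'v set" +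
  fixes T :: "'v tpca"
  assumes T: "typed_pca (set_cat elts) T"
begin

abbreviation "J \<equiv> types T"
abbreviation "B \<equiv> elems T"
abbreviation arrow (infixr "\<rightharpoondown>" 60) where "i \<rightharpoondown> j \<equiv> timp T i j"
abbreviation "ap \<equiv> tapp T"

lemmas T_parts = T[unfolded typed_pca_def set_cat_sel]
lemmas T_types = T_parts[THEN conjunct1]
lemmas T_ne = T_parts[THEN conjunct2, THEN conjunct1]
lemmas T_elems = T_parts[THEN conjunct2, THEN conjunct2, THEN conjunct1]
lemmas T_ops = T_parts[THEN conjunct2, THEN conjunct2, THEN conjunct2, THEN conjunct1]
lemmas T_app = T_parts[THEN conjunct2, THEN conjunct2, THEN conjunct2, THEN conjunct2, THEN conjunct1]
lemmas T_comb = T_parts[THEN conjunct2, THEN conjunct2, THEN conjunct2, THEN conjunct2, THEN conjunct2, rule_format]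

lemma B_U: "i \<in> J \<Longrightarrow> B i \<in> U" using T_elems by blast
lemma arrow_J [simp]: "i \<in> J \<Longrightarrow> j \<in> J \<Longrightarrow> i \<rightharpoondown> j \<in> J" using T_ops by blast
lemma tprod_J [simp]: "i \<in> J \<Longrightarrow> j \<in> J \<Longrightarrow> tprod T i j \<in> J" using T_ops by blast

lemma ap_B: "ap i j f x = Some y \<Longrightarrow> i \<in> J \<Longrightarrow> j \<in> J \<Longrightarrow> f \<in> B (i \<rightharpoondown> j) \<Longrightarrow> x \<in> B i \<Longrightarrow> y \<in> B j"
  using T_app by blast

lemma k_ex:
  assumes "i \<in> J" "j \<in> J"
  obtains k where "k \<in> B (i \<rightharpoondown> j \<rightharpoondown> i)"
    "\<And>x. x \<in> B i \<Longrightarrow> \<exists>k'\<in>B (j \<rightharpoondown> i). ap i (j \<rightharpoondown> i) k x = Some k' \<and> (\<forall>y\<in>B j. ap j i k' y = Some x)"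
proof -
  obtain k where k: "k \<in> B (i \<rightharpoondown> j \<rightharpoondown> i)" and
    k': "\<forall>x\<in>B i. ap i (j \<rightharpoondown> i) k x \<noteq> None \<and> (\<forall>y\<in>B j. papp (ap j i) (ap i (j \<rightharpoondown> i) k x) (Some y) = Some x)"
    using T_comb[OF assms assms(1)] by blast
  show ?thesis
  proof (rule that[OF k])
    fix x assume x: "x \<in> B i"
    then obtain c where c: "ap i (j \<rightharpoondown> i) k x = Some c" using k' by blast
    moreover have "c \<in> B (j \<rightharpoondown> i)" using ap_B[OF c] assms k x by simp
    moreover have "\<forall>y\<in>B j. ap j i c y = Some x" using bspec[OF k' x] c by (simp add: papp_Some_iff)
    ultimately show "\<exists>k'\<in>B (j \<rightharpoondown> i). ap i (j \<rightharpoondown> i) k x = Some k' \<and> (\<forall>y\<in>B j. ap j i k' y = Some x)" by blast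
  qed
qed

lemma s_ex:
  assumes "i \<in> J" "j \<in> J" "k \<in> J"
  obtains s where "s \<in> B ((i \<rightharpoondown> j \<rightharpoondown> k) \<rightharpoondown> (i \<rightharpoondown> j) \<rightharpoondown> i \<rightharpoondown> k)"
    "\<And>x y. x \<in> B (i \<rightharpoondown> j \<rightharpoondown> k) \<Longrightarrow> y \<in> B (i \<rightharpoondown> j) \<Longrightarrow>
       \<exists>s' s''. ap (i \<rightharpoondown> j \<rightharpoondown> k) ((i \<rightharpoondown> j) \<rightharpoondown> i \<rightharpoondown> k) s x = Some s' \<and> s' \<in> B ((i \<rightharpoondown> j) \<rightharpoondown> i \<rightharpoondown> k) \<and>
         ap (i \<rightharpoondown> j) (i \<rightharpoondown> k) s' y = Some s'' \<and> s'' \<in> B (i \<rightharpoondown> k) \<and>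
         (\<forall>z\<in>B i. \<forall>a b r. ap i (j \<rightharpoondown> k) x z = Some a \<longrightarrow> ap i j y z = Some b \<longrightarrow> ap j k a b = Some r \<longrightarrow>
            ap i k s'' z = Some r)"
proof -
  obtain s where s: "s \<in> B ((i \<rightharpoondown> j \<rightharpoondown> k) \<rightharpoondown> (i \<rightharpoondown> j) \<rightharpoondown> i \<rightharpoondown> k)" and
    s': "\<forall>x\<in>B (i \<rightharpoondown> j \<rightharpoondown> k). \<forall>y\<in>B (i \<rightharpoondown> j).
       papp (ap (i \<rightharpoondown> j) (i \<rightharpoondown> k)) (ap (i \<rightharpoondown> j \<rightharpoondown> k) ((i \<rightharpoondown> j) \<rightharpoondown> i \<rightharpoondown> k) s x) (Some y) \<noteq> None \<and>
       (\<forall>z\<in>B i. refines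
          (papp (ap i k) (papp (ap (i \<rightharpoondown> j) (i \<rightharpoondown> k)) (ap (i \<rightharpoondown> j \<rightharpoondown> k) ((i \<rightharpoondown> j) \<rightharpoondown> i \<rightharpoondown> k) s x) (Some y)) (Some z))
          (papp (ap j k) (ap i (j \<rightharpoondown> k) x z) (ap i j y z)))"
    using T_comb[OF assms] unfolding Let_def by blast
  show ?thesis
  proof (rule that[OF s])
    fix x y assume x: "x \<in> B (i \<rightharpoondown> j \<rightharpoondown> k)" and y: "y \<in> B (i \<rightharpoondown> j)"
    obtain s2 where "papp (ap (i \<rightharpoondown> j) (i \<rightharpoondown> k)) (ap (i \<rightharpoondown> j \<rightharpoondown> k) ((i \<rightharpoondown> j) \<rightharpoondown> i \<rightharpoondown> k) s x) (Some y) = Some s2"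
      using s' x y by blast
    then obtain s1 where s1: "ap (i \<rightharpoondown> j \<rightharpoondown> k) ((i \<rightharpoondown> j) \<rightharpoondown> i \<rightharpoondown> k) s x = Some s1"
      and s2: "ap (i \<rightharpoondown> j) (i \<rightharpoondown> k) s1 y = Some s2" by (auto simp: papp_Some_iff)
    have b1: "s1 \<in> B ((i \<rightharpoondown> j) \<rightharpoondown> i \<rightharpoondown> k)" using ap_B[OF s1] assms s x by simp
    have b2: "s2 \<in> B (i \<rightharpoondown> k)" using ap_B[OF s2] assms b1 y by simp
    have "ap i k s2 z = Some r" if z: "z \<in> B i" and r: "ap i (j \<rightharpoondown> k) x z = Some a" "ap i j y z = Some b" "ap j k a b = Some r"
      for z a b r
    proof -
      have "refines (papp (ap i k) (Some s2) (Some z)) (papp (ap j k) (Some a) (Some b))"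
        using bspec[OF conjunct2[OF bspec[OF bspec[OF s' x] y]] z] s1 s2 r by (simp add: papp_def)
      then show ?thesis using r by (simp add: refines_def papp_def)
    qed
    then show "\<exists>s' s''. ap (i \<rightharpoondown> j \<rightharpoondown> k) ((i \<rightharpoondown> j) \<rightharpoondown> i \<rightharpoondown> k) s x = Some s' \<and> s' \<in> B ((i \<rightharpoondown> j) \<rightharpoondown> i \<rightharpoondown> k) \<and>
         ap (i \<rightharpoondown> j) (i \<rightharpoondown> k) s' y = Some s'' \<and> s'' \<in> B (i \<rightharpoondown> k) \<and>
         (\<forall>z\<in>B i. \<forall>a b r. ap i (j \<rightharpoondown> k) x z = Some a \<longrightarrow> ap i j y z = Some b \<longrightarrow> ap j k a b = Some r \<longrightarrow>
            ap i k s'' z = Some r)" using s1 s2 b1 b2 by blast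
  qed
qed

text \<open>Pairing is fixed as a function \<open>P\<close> on elements, while the combinators that
  compute it stay existential; conjunctions of predicates can then be written with \<open>P\<close>.
  That \<open>pair x y\<close> is always defined follows from the equations for the
  projections.\<close>

definition pairing :: "'v \<Rightarrow> 'v \<Rightarrow> ('v \<Rightarrow> 'v \<Rightarrow> 'v) \<Rightarrow> bool" where
  "pairing i j P \<longleftrightarrow> (\<exists>pr\<in>B (i \<rightharpoondown> j \<rightharpoondown> tprod T i j). \<exists>fs\<in>B (tprod T i j \<rightharpoondown> i). \<exists>sn\<in>B (tprod T i j \<rightharpoondown> j).
    \<forall>x\<in>B i. \<forall>y\<in>B j. P x y \<in> B (tprod T i j) \<and>
       papp (ap j (tprod T i j)) (ap i (j \<rightharpoondown> tprod T i j) pr x) (Some y) = Some (P x y) \<and>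
       ap (tprod T i j) i fs (P x y) = Some x \<and> ap (tprod T i j) j sn (P x y) = Some y)"

definition PR :: "'v \<Rightarrow> 'v \<Rightarrow> 'v \<Rightarrow> 'v \<Rightarrow> 'v" where "PR i j = (SOME P. pairing i j P)"

lemma pairing_PR:
  assumes "i \<in> J" "j \<in> J"
  shows "pairing i j (PR i j)"
proof -
  let ?p = "tprod T i j"
  obtain pr fs sn where m: "pr \<in> B (i \<rightharpoondown> j \<rightharpoondown> ?p)" "fs \<in> B (?p \<rightharpoondown> i)" "sn \<in> B (?p \<rightharpoondown> j)"
    and c: "\<forall>x\<in>B i. \<forall>y\<in>B j. papp (ap ?p i) (Some fs) (papp (ap j ?p) (ap i (j \<rightharpoondown> ?p) pr x) (Some y)) = Some x \<and>
       papp (ap ?p j) (Some sn) (papp (ap j ?p) (ap i (j \<rightharpoondown> ?p) pr x) (Some y)) = Some y"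
    using T_comb[OF assms assms(1)] unfolding Let_def by blast
  define P where "P x y = the (papp (ap j ?p) (ap i (j \<rightharpoondown> ?p) pr x) (Some y))" for x y
  have "P x y \<in> B ?p \<and> papp (ap j ?p) (ap i (j \<rightharpoondown> ?p) pr x) (Some y) = Some (P x y) \<and>
      ap ?p i fs (P x y) = Some x \<and> ap ?p j sn (P x y) = Some y" if x: "x \<in> B i" and y: "y \<in> B j" for x y
  proof -
    obtain v where v: "papp (ap j ?p) (ap i (j \<rightharpoondown> ?p) pr x) (Some y) = Some v" "ap ?p i fs v = Some x"
      using conjunct1[OF bspec[OF bspec[OF c x] y]] by (auto simp: papp_Some_iff)
    then have P: "P x y = v" by (simp add: P_def)
    obtain w where w: "ap i (j \<rightharpoondown> ?p) pr x = Some w" "ap j ?p w y = Some v" using v by (auto simp: papp_Some_iff)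
    have "w \<in> B (j \<rightharpoondown> ?p)" using ap_B[OF w(1)] assms m x by simp
    then have "v \<in> B ?p" using ap_B[OF w(2)] assms y by simp
    moreover have "ap ?p j sn v = Some y" using bspec[OF bspec[OF c x] y, unfolded v(1)] by (simp add: papp_def)
    ultimately show ?thesis using v P by simp
  qed
  then have "pairing i j P" using m unfolding pairing_def by blast
  then show ?thesis unfolding PR_def by (rule someI[of "pairing i j"])
qed

lemma PR:
  assumes "i \<in> J" "j \<in> J"
  obtains pr fs sn where "pr \<in> B (i \<rightharpoondown> j \<rightharpoondown> tprod T i j)" "fs \<in> B (tprod T i j \<rightharpoondown> i)" "sn \<in> B (tprod T i j \<rightharpoondown> j)"
    "\<And>x y. x \<in> B i \<Longrightarrow> y \<in> B j \<Longrightarrow> PR i j x y \<in> B (tprod T i j)"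
    "\<And>x y. x \<in> B i \<Longrightarrow> y \<in> B j \<Longrightarrow> papp (ap j (tprod T i j)) (ap i (j \<rightharpoondown> tprod T i j) pr x) (Some y) = Some (PR i j x y)"
    "\<And>x y. x \<in> B i \<Longrightarrow> y \<in> B j \<Longrightarrow> ap (tprod T i j) i fs (PR i j x y) = Some x"
    "\<And>x y. x \<in> B i \<Longrightarrow> y \<in> B j \<Longrightarrow> ap (tprod T i j) j sn (PR i j x y) = Some y"
  using pairing_PR[OF assms] unfolding pairing_def by blast

lemma PR_B: "i \<in> J \<Longrightarrow> j \<in> J \<Longrightarrow> x \<in> B i \<Longrightarrow> y \<in> B j \<Longrightarrow> PR i j x y \<in> B (tprod T i j)"
  using PR by metis

section \<open>Derived combinators\<close>

lemma app1:
  assumes "i \<in> J" "j \<in> J" "k \<in> J" "x \<in> B (i \<rightharpoondown> j \<rightharpoondown> k)" "y \<in> B (i \<rightharpoondown> j)"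
  shows "\<exists>c\<in>B (i \<rightharpoondown> k). \<forall>z\<in>B i. \<forall>a b r. ap i (j \<rightharpoondown> k) x z = Some a \<longrightarrow> ap i j y z = Some b \<longrightarrow>
     ap j k a b = Some r \<longrightarrow> ap i k c z = Some r"
  using s_ex[OF assms(1-3)] assms(4,5) by metis

lemma const1: assumes "i \<in> J" "j \<in> J" "x \<in> B i" shows "\<exists>c\<in>B (j \<rightharpoondown> i). \<forall>y\<in>B j. ap j i c y = Some x"
  using k_ex[OF assms(1,2)] assms(3) by metis

text \<open>The term \<open>s k k\<close>, with the first \<open>k\<close> at type \<open>i
  \<rightharpoondown> (i \<rightharpoondown> i) \<rightharpoondown> i\<close> and the second at type
  \<open>i \<rightharpoondown> i \<rightharpoondown> i\<close>.\<close>

lemma id1: assumes i: "i \<in> J" shows "\<exists>c\<in>B (i \<rightharpoondown> i). \<forall>x\<in>B i. ap i i c x = Some x"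
proof -
  have ii: "i \<rightharpoondown> i \<in> J" using i by simp
  obtain k where k: "k \<in> B (i \<rightharpoondown> (i \<rightharpoondown> i) \<rightharpoondown> i)"
    "\<And>x. x \<in> B i \<Longrightarrow> \<exists>k'\<in>B ((i \<rightharpoondown> i) \<rightharpoondown> i). ap i ((i \<rightharpoondown> i) \<rightharpoondown> i) k x = Some k' \<and> (\<forall>y\<in>B (i \<rightharpoondown> i). ap (i \<rightharpoondown> i) i k' y = Some x)"
    by (rule k_ex[OF i ii]) blast
  obtain l where l: "l \<in> B (i \<rightharpoondown> i \<rightharpoondown> i)"
    "\<And>x. x \<in> B i \<Longrightarrow> \<exists>k'\<in>B (i \<rightharpoondown> i). ap i (i \<rightharpoondown> i) l x = Some k' \<and> (\<forall>y\<in>B i. ap i i k' y = Some x)"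
    by (rule k_ex[OF i i]) blast
  obtain c where c: "c \<in> B (i \<rightharpoondown> i)" "\<forall>z\<in>B i. \<forall>a b r. ap i ((i \<rightharpoondown> i) \<rightharpoondown> i) k z = Some a \<longrightarrow> ap i (i \<rightharpoondown> i) l z = Some b \<longrightarrow>
     ap (i \<rightharpoondown> i) i a b = Some r \<longrightarrow> ap i i c z = Some r"
    using app1[OF i ii i k(1) l(1)] by blast
  have "ap i i c x = Some x" if x: "x \<in> B i" for x
  proof -
    obtain a where a: "ap i ((i \<rightharpoondown> i) \<rightharpoondown> i) k x = Some a" "\<forall>y\<in>B (i \<rightharpoondown> i). ap (i \<rightharpoondown> i) i a y = Some x"
      using k(2)[OF x] by blast
    obtain b where b: "ap i (i \<rightharpoondown> i) l x = Some b" "b \<in> B (i \<rightharpoondown> i)" using l(2)[OF x] by blast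
    show ?thesis using c(2) x a b by blast
  qed
  then show ?thesis using c(1) by blast
qed

text \<open>The term \<open>s (k g) f\<close>.\<close>

lemma comp1:
  assumes i: "i \<in> J" "j \<in> J" "k \<in> J" and f: "f \<in> B (i \<rightharpoondown> j)" and g: "g \<in> B (j \<rightharpoondown> k)"
  shows "\<exists>c\<in>B (i \<rightharpoondown> k). \<forall>z\<in>B i. \<forall>y r. ap i j f z = Some y \<longrightarrow> ap j k g y = Some r \<longrightarrow> ap i k c z = Some r"
proof -
  obtain c where c: "c \<in> B (i \<rightharpoondown> j \<rightharpoondown> k)" "\<forall>y\<in>B i. ap i (j \<rightharpoondown> k) c y = Some g"
    using const1[of "j \<rightharpoondown> k" i g] i g by auto
  show ?thesis using app1[OF i c(1) f] c(2) by meson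
qed

text \<open>The term \<open>s (s (k pr) f) g\<close>.\<close>

lemma pair1:
  assumes l: "l \<in> J" "i \<in> J" "j \<in> J" and f: "f \<in> B (l \<rightharpoondown> i)" and g: "g \<in> B (l \<rightharpoondown> j)"
  shows "\<exists>c\<in>B (l \<rightharpoondown> tprod T i j). \<forall>z\<in>B l. \<forall>x y. ap l i f z = Some x \<longrightarrow> ap l j g z = Some y \<longrightarrow>
     ap l (tprod T i j) c z = Some (PR i j x y)"
proof -
  let ?p = "tprod T i j"
  have p: "?p \<in> J" "j \<rightharpoondown> ?p \<in> J" using l by simp_all
  obtain pr where pr: "pr \<in> B (i \<rightharpoondown> j \<rightharpoondown> ?p)"
    "\<And>x y. x \<in> B i \<Longrightarrow> y \<in> B j \<Longrightarrow> papp (ap j ?p) (ap i (j \<rightharpoondown> ?p) pr x) (Some y) = Some (PR i j x y)"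
    by (rule PR[OF l(2,3)]) blast
  obtain c where c: "c \<in> B (l \<rightharpoondown> j \<rightharpoondown> ?p)"
    "\<forall>z\<in>B l. \<forall>y r. ap l i f z = Some y \<longrightarrow> ap i (j \<rightharpoondown> ?p) pr y = Some r \<longrightarrow> ap l (j \<rightharpoondown> ?p) c z = Some r"
    using comp1[OF l(1,2) p(2) f pr(1)] by blast
  obtain d where d: "d \<in> B (l \<rightharpoondown> ?p)"
    "\<forall>z\<in>B l. \<forall>a b r. ap l (j \<rightharpoondown> ?p) c z = Some a \<longrightarrow> ap l j g z = Some b \<longrightarrow> ap j ?p a b = Some r \<longrightarrow> ap l ?p d z = Some r"
    using app1[OF l(1,3) p(1) c(1) g] by blast
  have "ap l ?p d z = Some (PR i j x y)" if z: "z \<in> B l" and x: "ap l i f z = Some x" and y: "ap l j g z = Some y" for x y z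
  proof -
    have "x \<in> B i" "y \<in> B j" using ap_B[OF x] ap_B[OF y] l f g z by auto
    then obtain w where "ap i (j \<rightharpoondown> ?p) pr x = Some w" "ap j ?p w y = Some (PR i j x y)"
      using pr(2) by (auto simp: papp_Some_iff)
    then show ?thesis using c(2) d(2) z x y by blast
  qed
  then show ?thesis using d(1) by blast
qed

text \<open>
  The realizer \<open>e\<close> is required to be total in its first argument. This matters when \<open>B i\<close> is empty:
  then \<open>pair x\<close> need not be defined, yet currying still has to produce a value for every \<open>x\<close>.
\<close>

definition cur :: "'v \<Rightarrow> 'v \<Rightarrow> 'v \<Rightarrow> ('v \<Rightarrow> 'v \<Rightarrow> 'v option) \<Rightarrow> bool" where
  "cur l i j f \<longleftrightarrow> (\<exists>e\<in>B (l \<rightharpoondown> i \<rightharpoondown> j). \<forall>x\<in>B l. \<exists>e'\<in>B (i \<rightharpoondown> j). ap l (i \<rightharpoondown> j) e x = Some e' \<and>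
     (\<forall>y\<in>B i. \<forall>r. f x y = Some r \<longrightarrow> ap i j e' y = Some r))"

lemma cur_fst: "l \<in> J \<Longrightarrow> i \<in> J \<Longrightarrow> cur l i l (\<lambda>x y. Some x)"
  unfolding cur_def using k_ex[of l i] by (metis option.inject)

lemma cur_const: assumes "l \<in> J" "i \<in> J" "j \<in> J" "c \<in> B j" shows "cur l i j (\<lambda>x y. Some c)"
proof -
  obtain d where d: "d \<in> B (i \<rightharpoondown> j)" "\<forall>y\<in>B i. ap i j d y = Some c" using const1[OF assms(3,2,4)] by blast
  then obtain e where "e \<in> B (l \<rightharpoondown> i \<rightharpoondown> j)" "\<forall>y\<in>B l. ap l (i \<rightharpoondown> j) e y = Some d"
    using const1[of "i \<rightharpoondown> j" l d] assms by auto
  then show ?thesis unfolding cur_def using d by (metis option.inject)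
qed

lemma cur_snd: assumes "l \<in> J" "i \<in> J" shows "cur l i i (\<lambda>x y. Some y)"
proof -
  obtain d where d: "d \<in> B (i \<rightharpoondown> i)" "\<forall>y\<in>B i. ap i i d y = Some y" using id1[OF assms(2)] by blast
  then obtain e where "e \<in> B (l \<rightharpoondown> i \<rightharpoondown> i)" "\<forall>y\<in>B l. ap l (i \<rightharpoondown> i) e y = Some d"
    using const1[of "i \<rightharpoondown> i" l d] assms by auto
  then show ?thesis unfolding cur_def using d by (metis option.inject)
qed

text \<open>Bracket abstraction of an application: the realizer is
  \<open>\<lambda>x. s (e1 x) (e2 x)\<close>. It is total in \<open>x\<close> because
  \<open>s\<close> applied to two arguments is always defined, whatever becomes of the application
  itself.\<close>

lemma cur_app:
  assumes J: "l \<in> J" "i \<in> J" "a \<in> J" "b \<in> J" and f: "cur l i (a \<rightharpoondown> b) f" and g: "cur l i a g"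
  shows "cur l i b (\<lambda>x y. papp (ap a b) (f x y) (g x y))"
proof -
  let ?ab = "i \<rightharpoondown> a \<rightharpoondown> b" and ?a = "i \<rightharpoondown> a" and ?b = "i \<rightharpoondown> b"
  have JJ: "?ab \<in> J" "?a \<in> J" "?b \<in> J" "?a \<rightharpoondown> ?b \<in> J" using J by simp_all
  obtain e1 where e1: "e1 \<in> B (l \<rightharpoondown> ?ab)" "\<And>x. x \<in> B l \<Longrightarrow> \<exists>e'\<in>B ?ab. ap l ?ab e1 x = Some e' \<and>
     (\<forall>y\<in>B i. \<forall>r. f x y = Some r \<longrightarrow> ap i (a \<rightharpoondown> b) e' y = Some r)" using f unfolding cur_def by blast
  obtain e2 where e2: "e2 \<in> B (l \<rightharpoondown> ?a)" "\<And>x. x \<in> B l \<Longrightarrow> \<exists>e'\<in>B ?a. ap l ?a e2 x = Some e' \<and>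
     (\<forall>y\<in>B i. \<forall>r. g x y = Some r \<longrightarrow> ap i a e' y = Some r)" using g unfolding cur_def by blast
  obtain s where s: "s \<in> B (?ab \<rightharpoondown> ?a \<rightharpoondown> ?b)"
    "\<And>x y. x \<in> B ?ab \<Longrightarrow> y \<in> B ?a \<Longrightarrow>
       \<exists>s' s''. ap ?ab (?a \<rightharpoondown> ?b) s x = Some s' \<and> s' \<in> B (?a \<rightharpoondown> ?b) \<and>
         ap ?a ?b s' y = Some s'' \<and> s'' \<in> B ?b \<and>
         (\<forall>z\<in>B i. \<forall>u v r. ap i (a \<rightharpoondown> b) x z = Some u \<longrightarrow> ap i a y z = Some v \<longrightarrow> ap a b u v = Some r \<longrightarrow>
            ap i b s'' z = Some r)" by (rule s_ex[OF J(2,3,4)]) blast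
  obtain c where c: "c \<in> B (l \<rightharpoondown> ?a \<rightharpoondown> ?b)"
    "\<forall>z\<in>B l. \<forall>y r. ap l ?ab e1 z = Some y \<longrightarrow> ap ?ab (?a \<rightharpoondown> ?b) s y = Some r \<longrightarrow> ap l (?a \<rightharpoondown> ?b) c z = Some r"
    using comp1[OF J(1) JJ(1,4) e1(1) s(1)] by blast
  obtain d where d: "d \<in> B (l \<rightharpoondown> ?b)" "\<forall>z\<in>B l. \<forall>u v r. ap l (?a \<rightharpoondown> ?b) c z = Some u \<longrightarrow> ap l ?a e2 z = Some v \<longrightarrow>
     ap ?a ?b u v = Some r \<longrightarrow> ap l ?b d z = Some r" using app1[OF J(1) JJ(2,3) c(1) e2(1)] by blast
  have "\<exists>e'\<in>B ?b. ap l ?b d x = Some e' \<and> (\<forall>y\<in>B i. \<forall>r. papp (ap a b) (f x y) (g x y) = Some r \<longrightarrow> ap i b e' y = Some r)"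
    if x: "x \<in> B l" for x
  proof -
    obtain x1 where x1: "x1 \<in> B ?ab" "ap l ?ab e1 x = Some x1" "\<forall>y\<in>B i. \<forall>r. f x y = Some r \<longrightarrow> ap i (a \<rightharpoondown> b) x1 y = Some r"
      using e1(2)[OF x] by blast
    obtain x2 where x2: "x2 \<in> B ?a" "ap l ?a e2 x = Some x2" "\<forall>y\<in>B i. \<forall>r. g x y = Some r \<longrightarrow> ap i a x2 y = Some r"
      using e2(2)[OF x] by blast
    obtain s' s'' where ss: "ap ?ab (?a \<rightharpoondown> ?b) s x1 = Some s'" "ap ?a ?b s' x2 = Some s''" "s'' \<in> B ?b"
      "\<forall>z\<in>B i. \<forall>u v r. ap i (a \<rightharpoondown> b) x1 z = Some u \<longrightarrow> ap i a x2 z = Some v \<longrightarrow> ap a b u v = Some r \<longrightarrow>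
            ap i b s'' z = Some r" using s(2)[OF x1(1) x2(1)] by blast
    have "ap l ?b d x = Some s''" using d(2) c(2) x x1(2) x2(2) ss(1,2) by blast
    moreover have "ap i b s'' y = Some r" if y: "y \<in> B i" and fg: "papp (ap a b) (f x y) (g x y) = Some r" for y r
    proof -
      obtain u v where "f x y = Some u" "g x y = Some v" "ap a b u v = Some r"
        using fg by (auto simp: papp_Some_iff)
      then show ?thesis using ss(4) y x1(3) x2(3) by blast
    qed
    ultimately show ?thesis using ss(3) by blast
  qed
  then show ?thesis unfolding cur_def using d(1) by blast
qed

lemma cur_pair:
  assumes J: "l \<in> J" "i \<in> J"
  shows "cur l i (tprod T l i) (\<lambda>x y. if x \<in> B l \<and> y \<in> B i then Some (PR l i x y) else None)"
proof -
  let ?p = "tprod T l i"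
  obtain pr where pr: "pr \<in> B (l \<rightharpoondown> i \<rightharpoondown> ?p)"
    "\<And>x y. x \<in> B l \<Longrightarrow> y \<in> B i \<Longrightarrow> papp (ap i ?p) (ap l (i \<rightharpoondown> ?p) pr x) (Some y) = Some (PR l i x y)"
    by (rule PR[OF J]) blast
  \<comment> \<open>Eta-expansion: \<open>pr\<close> does not do as it stands, since
    \<open>pr x\<close> may be undefined when \<open>B i\<close> is empty, whereas the abstracted
    term is defined for every \<open>x\<close>.\<close>
  have "cur l i ?p (\<lambda>x y. papp (ap i ?p) (papp (ap l (i \<rightharpoondown> ?p)) (Some pr) (Some x)) (Some y))"
    using J pr(1) by (intro cur_app cur_const cur_fst cur_snd) simp_all
  then have c: "cur l i ?p (\<lambda>x y. papp (ap i ?p) (ap l (i \<rightharpoondown> ?p) pr x) (Some y))"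
    by (simp add: papp_def)
  then obtain e where e: "e \<in> B (l \<rightharpoondown> i \<rightharpoondown> ?p)" "\<forall>x\<in>B l. \<exists>e'\<in>B (i \<rightharpoondown> ?p). ap l (i \<rightharpoondown> ?p) e x = Some e' \<and>
     (\<forall>y\<in>B i. \<forall>r. papp (ap i ?p) (ap l (i \<rightharpoondown> ?p) pr x) (Some y) = Some r \<longrightarrow> ap i ?p e' y = Some r)"
    unfolding cur_def by blast
  show ?thesis unfolding cur_def
  proof (intro bexI[OF _ e(1)] ballI)
    fix x assume x: "x \<in> B l"
    then obtain e' where "e' \<in> B (i \<rightharpoondown> ?p)" "ap l (i \<rightharpoondown> ?p) e x = Some e'"
     "\<forall>y\<in>B i. \<forall>r. papp (ap i ?p) (ap l (i \<rightharpoondown> ?p) pr x) (Some y) = Some r \<longrightarrow> ap i ?p e' y = Some r" using e(2) by blast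
    then show "\<exists>e'\<in>B (i \<rightharpoondown> ?p). ap l (i \<rightharpoondown> ?p) e x = Some e' \<and>
     (\<forall>y\<in>B i. \<forall>r. (if x \<in> B l \<and> y \<in> B i then Some (PR l i x y) else None) = Some r \<longrightarrow> ap i ?p e' y = Some r)"
      using pr(2) x by (intro bexI[of _ e']) auto
  qed
qed

section \<open>The indexed preorder of realizability predicates\<close>

definition Pr :: "'v set \<Rightarrow> ('v \<times> ('v \<Rightarrow> 'v set)) set" where
  "Pr M = {a. fst a \<in> J \<and> snd a \<in> M \<rightarrow>\<^sub>E Pow (B (fst a))}"

definition le :: "'v set \<Rightarrow> 'v \<times> ('v \<Rightarrow> 'v set) \<Rightarrow> 'v \<times> ('v \<Rightarrow> 'v set) \<Rightarrow> bool" where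
  "le M a b \<longleftrightarrow> (\<exists>e\<in>B (fst a \<rightharpoondown> fst b). \<forall>m\<in>M. \<forall>x\<in>snd a m. \<exists>y\<in>snd b m. ap (fst a) (fst b) e x = Some y)"

definition RE :: "'v setfun \<Rightarrow> 'v \<times> ('v \<Rightarrow> 'v set) \<Rightarrow> 'v \<times> ('v \<Rightarrow> 'v set)" where
  "RE u b = (fst b, restrict (snd b \<circ> fn u) (fst u))"

lemma RH_eq: "realizability_hyperdoctrine (set_cat elts) T = grothendieck (set_cat elts) Pr le RE"
proof -
  have "(\<lambda>M. {(i, \<phi>). i \<in> J \<and> \<phi> \<in> M \<rightarrow>\<^sub>E Pow (B i)}) = Pr" by (force simp: Pr_def fun_eq_iff PiE_iff)
  moreover have "(\<lambda>M (i, \<phi>) (j, \<psi>). \<exists>e\<in>B (i \<rightharpoondown> j). \<forall>m\<in>M. \<forall>a\<in>\<phi> m. \<exists>b\<in>\<psi> m. ap i j e a = Some b) = le"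
    by (auto simp: le_def fun_eq_iff)
  moreover have "(\<lambda>u (j, \<psi>). (j, restrict (\<psi> \<circ> fn u) (fst u))) = RE" by (auto simp: RE_def fun_eq_iff)
  ultimately show ?thesis unfolding realizability_hyperdoctrine_def by simp
qed

lemma Pr_B: "a \<in> Pr M \<Longrightarrow> m \<in> M \<Longrightarrow> x \<in> snd a m \<Longrightarrow> x \<in> B (fst a)" by (auto simp: Pr_def)
lemma Pr_J: "a \<in> Pr M \<Longrightarrow> fst a \<in> J" by (auto simp: Pr_def)

lemma le_refl: "a \<in> Pr M \<Longrightarrow> le M a a"
  using id1[OF Pr_J] Pr_B unfolding le_def by blast

lemma le_trans: assumes "a \<in> Pr M" "b \<in> Pr M" "c \<in> Pr M" "le M a b" "le M b c" shows "le M a c"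
proof -
  obtain e where e: "e \<in> B (fst a \<rightharpoondown> fst b)" "\<forall>m\<in>M. \<forall>x\<in>snd a m. \<exists>y\<in>snd b m. ap (fst a) (fst b) e x = Some y"
    using assms(4) unfolding le_def by blast
  obtain f where f: "f \<in> B (fst b \<rightharpoondown> fst c)" "\<forall>m\<in>M. \<forall>x\<in>snd b m. \<exists>y\<in>snd c m. ap (fst b) (fst c) f x = Some y"
    using assms(5) unfolding le_def by blast
  obtain g where g: "g \<in> B (fst a \<rightharpoondown> fst c)" "\<forall>z\<in>B (fst a). \<forall>y r. ap (fst a) (fst b) e z = Some y \<longrightarrow>
     ap (fst b) (fst c) f y = Some r \<longrightarrow> ap (fst a) (fst c) g z = Some r"
    using comp1[OF assms(1-3)[THEN Pr_J] e(1) f(1)] by blast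
  show ?thesis unfolding le_def using e(2) f(2) g Pr_B[OF assms(1)] by meson
qed

lemma RE_arr: "RE (arr N u M) b = (fst b, \<lambda>n\<in>N. snd b (u n))"
  by (auto simp: RE_def intro!: restrict_ext)

lemma RE_Pr: "b \<in> Pr M \<Longrightarrow> u \<in> N \<rightarrow> M \<Longrightarrow> RE (arr N u M) b \<in> Pr N"
  unfolding RE_arr Pr_def by (auto simp: PiE_iff)

lemma le_RE: "u \<in> N \<rightarrow> M \<Longrightarrow> le N a (RE (arr N u M) b) \<longleftrightarrow>
   (\<exists>e\<in>B (fst a \<rightharpoondown> fst b). \<forall>n\<in>N. \<forall>x\<in>snd a n. \<exists>y\<in>snd b (u n). ap (fst a) (fst b) e x = Some y)"
  unfolding le_def RE_arr by simp

lemma RE_mono: "u \<in> N \<rightarrow> M \<Longrightarrow> le M a b \<Longrightarrow> le N (RE (arr N u M) a) (RE (arr N u M) b)"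
  unfolding le_def RE_arr by (auto simp: Pi_iff) blast

lemma RE_id: "b \<in> Pr M \<Longrightarrow> RE (arr M (\<lambda>x. x) M) b = b"
  unfolding RE_arr Pr_def by (cases b) (auto simp: PiE_iff extensional_restrict)

lemma RE_comp: "f \<in> K \<rightarrow> N \<Longrightarrow> RE (arr K f N) (RE (arr N u M) b) = RE (arr K (\<lambda>x. u (f x)) M) b"
  unfolding RE_arr by (auto simp: Pi_iff intro!: restrict_ext)

lemma faithful_fib_RH: "faithful_fib (grothendieck (set_cat elts) Pr le RE)"
proof (rule faithful_fib_grothendieck)
  show "category (set_cat elts)" by (rule category_set_cat)
qed (auto elim!: homE intro: RE_Pr le_refl le_trans RE_mono simp: RE_id RE_comp)

end

section \<open>The typed pca of a generating family\<close>

context prim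
begin

text \<open>Relations enter by their codes, as elements of the universe, so that they form a set
  over which \<open>X\<close> can quantify.\<close>

definition rel :: "'v \<Rightarrow> 'v \<Rightarrow> 'v set" where
  "rel i j = {r. elts r \<subseteq> prd (Ai i) (Ai j)}"

text \<open>Total space of the universal relation: a code of a relation together with a pair
  belonging to it.\<close>

definition graph :: "'v \<Rightarrow> 'v \<Rightarrow> 'v set" where
  "graph i j = sig (rel i j) elts"

text \<open>The predicate \<open>\<forall>(a, b) \<in> r. \<pi>\<^sub>i(a) \<Rightarrow> \<pi>\<^sub>j(b)\<close> in the variable \<open>r \<subseteq> A\<^sub>i \<times> A\<^sub>j\<close>.\<close>

definition theta :: "'v \<Rightarrow> 'v \<Rightarrow> 'o" where
  "theta i j = A (rel i j) pfst (im (rx (graph i j) (\<lambda>z. pfst (psnd z)) (\<pi> i)) (rx (graph i j) (\<lambda>z. psnd (psnd z)) (\<pi> j)))"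

lemma rel_U: "i \<in> I \<Longrightarrow> j \<in> I \<Longrightarrow> rel i j \<in> U"
  unfolding rel_def by (intro Pow_U sig_U Ai_U)

lemma graph_U: "i \<in> I \<Longrightarrow> j \<in> I \<Longrightarrow> graph i j \<in> U"
  unfolding graph_def by (intro sig_U rel_U elts_U)

lemma graphD: "z \<in> graph i j \<Longrightarrow> pfst z \<in> rel i j \<and> psnd z \<in> elts (pfst z) \<and>
   pfst (psnd z) \<in> Ai i \<and> psnd (psnd z) \<in> Ai j \<and> psnd z = kpair (pfst (psnd z)) (psnd (psnd z))"
proof -
  assume z: "z \<in> graph i j"
  then have r: "pfst z \<in> rel i j" "psnd z \<in> elts (pfst z)"
    unfolding graph_def by (rule sig_fst, rule sig_snd)
  then have "psnd z \<in> prd (Ai i) (Ai j)" by (auto simp: rel_def)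
  then show ?thesis using r by (auto elim!: sigE)
qed

text \<open>\<open>k\<close> is a candidate for the arrow type, \<open>W\<close> the domain of
  application inside the product of \<open>Ai k\<close> and \<open>Ai i\<close>, and
  \<open>h\<close> its values. The last conjunct says that applying the code \<open>g n\<close>
  extends the relation \<open>u n\<close>; in particular the relations occurring in that
  presentation of \<open>theta\<close> are functional.\<close>

definition is_app where
  "is_app i j k W h \<longleftrightarrow> k \<in> I \<and> W \<subseteq> prd (Ai k) (Ai i) \<and> h \<in> W \<rightarrow> Ai j \<and>
    L (mt (rx W pfst (\<pi> k)) (rx W psnd (\<pi> i))) h (\<pi> j) \<and>
    (\<exists>N u g. pres (theta i j) N u k g \<and>
      (\<forall>n\<in>N. \<forall>a b. kpair a b \<in> elts (u n) \<longrightarrow> kpair (g n) a \<in> W \<and> h (kpair (g n) a) = b))"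

context
  fixes i j assumes ij: "i \<in> I" "j \<in> I"
begin

lemma graph_fun: "pfst \<in> graph i j \<rightarrow> rel i j" "(\<lambda>z. pfst (psnd z)) \<in> graph i j \<rightarrow> Ai i"
  "(\<lambda>z. psnd (psnd z)) \<in> graph i j \<rightarrow> Ai j"
  using graphD by auto

lemma theta_parts: "rx (graph i j) (\<lambda>z. pfst (psnd z)) (\<pi> i) \<in> fb (graph i j)"
  "rx (graph i j) (\<lambda>z. psnd (psnd z)) (\<pi> j) \<in> fb (graph i j)"
  using rx_fb pi_fb graph_U graph_fun ij by blast+

lemma theta_fb: "theta i j \<in> fb (rel i j)"
  unfolding theta_def using A_fb[OF im_fb[OF theta_parts] rel_U[OF ij] graph_fun(1)] .

text \<open>Beck-Chevalley for \<forall> and the universal property of implication, applied in turn.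
  An element of \<open>P\<close> is a point of \<open>z\<close> with a pair in the relation that
  \<open>r\<close> assigns to it.\<close>

lemma theta_L:
  assumes z: "z \<in> Obj (Total X)" and r: "r \<in> p z \<rightarrow> rel i j"
  defines "P \<equiv> pb (graph i j) pfst (p z) r"
  shows "L z r (theta i j) \<longleftrightarrow>
    L (mt (rx P psnd z) (rx P pfst (rx (graph i j) (\<lambda>z. pfst (psnd z)) (\<pi> i)))) (\<lambda>x. psnd (psnd (pfst x))) (\<pi> j)"
    "rx P psnd z \<in> fb P" "rx P pfst (rx (graph i j) (\<lambda>z. pfst (psnd z)) (\<pi> i)) \<in> fb P"
    "pfst \<in> P \<rightarrow> graph i j" "psnd \<in> P \<rightarrow> p z" "P \<in> U"
proof -
  have zf: "z \<in> fb (p z)" using fbI[OF z] .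
  show PU: "P \<in> U" unfolding P_def using pb_U[OF graph_U[OF ij] fbD(3)[OF zf]] .
  show f: "pfst \<in> P \<rightarrow> graph i j" "psnd \<in> P \<rightarrow> p z" unfolding P_def by (auto dest: pbD)
  show a: "rx P psnd z \<in> fb P" using rx_fb[OF zf PU f(2)] .
  show b: "rx P pfst (rx (graph i j) (\<lambda>z. pfst (psnd z)) (\<pi> i)) \<in> fb P"
    using rx_fb[OF theta_parts(1) PU f(1)] .
  let ?Q = "mt (rx P psnd z) (rx P pfst (rx (graph i j) (\<lambda>z. pfst (psnd z)) (\<pi> i)))"
  have Q: "p ?Q = P" using fbD(1)[OF mt_fb[OF a b]] .
  have "L z r (theta i j) \<longleftrightarrow> L (rx P psnd z) pfst (im (rx (graph i j) (\<lambda>z. pfst (psnd z)) (\<pi> i)) (rx (graph i j) (\<lambda>z. psnd (psnd z)) (\<pi> j)))"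
    unfolding theta_def P_def using A_L[OF im_fb[OF theta_parts] rel_U[OF ij] graph_fun(1) r z] .
  also have "\<dots> \<longleftrightarrow> L ?Q pfst (rx (graph i j) (\<lambda>z. psnd (psnd z)) (\<pi> j))"
    using im_L[OF theta_parts, of pfst "rx P psnd z"] f(1) fbD[OF a] by simp
  also have "\<dots> \<longleftrightarrow> L ?Q (\<lambda>x. psnd (psnd (pfst x))) (\<pi> j)"
    using rx_L[OF pi_fb[OF ij(2)] graph_U[OF ij] graph_fun(3), of pfst ?Q] f(1) Q by simp
  finally show "L z r (theta i j) \<longleftrightarrow> L ?Q (\<lambda>x. psnd (psnd (pfst x))) (\<pi> j)" .
qed

text \<open>Modus ponens: instantiating the bound pair with \<alpha> and \<beta> maps
  \<open>Q\<close> into the pullback over which \<open>theta\<close> is tested.\<close>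

lemma theta_elim:
  assumes k: "L Q k (theta i j)" and a: "L Q \<alpha> (\<pi> i)"
    and b: "\<And>q. q \<in> p Q \<Longrightarrow> kpair (\<alpha> q) (\<beta> q) \<in> elts (k q)"
  shows "L Q \<beta> (\<pi> j)"
proof -
  have Q: "Q \<in> Obj (Total X)" using L_obj k by blast
  have kf: "k \<in> p Q \<rightarrow> rel i j" using L_fun[OF k] fbD(1)[OF theta_fb] by simp
  let ?P = "pb (graph i j) pfst (p Q) k"
  note t = theta_L[OF Q kf]
  let ?h = "\<lambda>q. kpair (kpair (k q) (kpair (\<alpha> q) (\<beta> q))) q"
  have h: "?h \<in> p Q \<rightarrow> ?P" using b kf by (auto simp: graph_def)
  have h': "(\<lambda>q. pfst (?h q)) \<in> p Q \<rightarrow> graph i j" using b kf by (auto simp: graph_def)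
  have "L Q ?h (rx ?P psnd Q)"
    using rx_L[OF fbI[OF Q] t(6,5) h] L_refl[OF Q] by simp
  moreover have "L Q ?h (rx ?P pfst (rx (graph i j) (\<lambda>z. pfst (psnd z)) (\<pi> i)))"
    using rx_L[OF theta_parts(1) t(6,4) h] rx_L[OF pi_fb[OF ij(1)] graph_U[OF ij] graph_fun(2) h'] a by simp
  ultimately have "L Q ?h (mt (rx ?P psnd Q) (rx ?P pfst (rx (graph i j) (\<lambda>z. pfst (psnd z)) (\<pi> i))))"
    using mt_L[OF t(2,3) h Q] by blast
  from L_trans[OF this t(1)[THEN iffD1, OF k]] show ?thesis by simp
qed

text \<open>The premise ranges over all contexts \<open>Q\<close> but is applied to the generic one,
  the meet over the pullback in \<open>theta_L\<close>. The rule form spares later proofs from this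
  pullback.\<close>

lemma theta_intro:
  assumes z: "z \<in> Obj (Total X)" and r: "r \<in> p z \<rightarrow> rel i j"
    and h: "\<And>Q k \<alpha> \<beta>. L Q k z \<Longrightarrow> L Q \<alpha> (\<pi> i) \<Longrightarrow> (\<And>q. q \<in> p Q \<Longrightarrow> kpair (\<alpha> q) (\<beta> q) \<in> elts (r (k q))) \<Longrightarrow> L Q \<beta> (\<pi> j)"
  shows "L z r (theta i j)"
proof -
  note t = theta_L[OF z r]
  let ?P = "pb (graph i j) pfst (p z) r"
  let ?Q = "mt (rx ?P psnd z) (rx ?P pfst (rx (graph i j) (\<lambda>z. pfst (psnd z)) (\<pi> i)))"
  have 1: "L ?Q psnd z" using L_trans[OF mt_fst[OF t(2,3)] rx_proj[OF fbI[OF z] t(6,5)]] .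
  have 2: "L ?Q (\<lambda>x. pfst (psnd (pfst x))) (\<pi> i)"
    using L_trans[OF L_trans[OF mt_snd[OF t(2,3)] rx_proj[OF theta_parts(1) t(6,4)]]
        rx_proj[OF pi_fb[OF ij(1)] graph_U[OF ij] graph_fun(2)]] .
  have "L ?Q (\<lambda>x. psnd (psnd (pfst x))) (\<pi> j)"
  proof (rule h[OF 1 2])
    fix q assume "q \<in> p ?Q"
    then have "q \<in> ?P" using fbD(1)[OF mt_fb[OF t(2,3)]] by simp
    then have "pfst q \<in> graph i j" "pfst (pfst q) = r (psnd q)" using pbD[of q] by auto
    then show "kpair (pfst (psnd (pfst q))) (psnd (psnd (pfst q))) \<in> elts (r (psnd q))"
      using graphD[of "pfst q" i j] by auto
  qed
  then show ?thesis using t(1) by simp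
qed

text \<open>A presentation of \<open>theta\<close> has an index \<open>k\<close>, whose elements
  serve as codes of relations. For a pair (a, b) in \<open>u n\<close>, the result b is tracked by
  the code \<open>g n\<close> and the argument a, by \<open>theta_elim\<close>. By modesty b then
  depends on \<open>g n\<close> and a only, and this dependence is application.\<close>

lemma app_exists: "\<exists>k W h. is_app i j k W h"
proof -
  obtain N u k g where pr: "pres (theta i j) N u k g" using pres_exists[OF theta_fb] by blast
  then have N: "N \<in> U" "u \<in> N \<rightarrow> rel i j" "k \<in> I" "g \<in> N \<rightarrow> Ai k"
    using fbD(1)[OF theta_fb] by (auto simp: pres_def)
  \<comment> \<open>All instances of coded relations: an \<open>n\<close> with a pair in
    \<open>u n\<close>. \<open>?e\<close> forgets everything but the code and the argument, and is
    onto \<open>?W\<close> by the definition of \<open>?W\<close>.\<close>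
  let ?K = "sig N (\<lambda>n. elts (u n))"
  let ?e = "\<lambda>z. kpair (g (pfst z)) (pfst (psnd z))"
  let ?W = "?e ` ?K"
  have K: "?K \<in> U" by (rule sig_U[OF N(1) elts_U])
  have W: "?W \<in> U" using image_U K by blast
  have KE: "pfst z \<in> N \<and> psnd z = kpair (pfst (psnd z)) (psnd (psnd z)) \<and> psnd z \<in> elts (u (pfst z)) \<and>
     pfst (psnd z) \<in> Ai i \<and> psnd (psnd z) \<in> Ai j" if z: "z \<in> ?K" for z
  proof -
    have z': "pfst z \<in> N" "psnd z \<in> elts (u (pfst z))" using sig_fst[OF z] sig_snd[OF z] by auto
    then have "psnd z \<in> prd (Ai i) (Ai j)" using N(2) by (auto simp: rel_def)
    then show ?thesis using z' by (auto elim!: sigE)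
  qed
  have Wsub: "?W \<subseteq> prd (Ai k) (Ai i)" using KE N(4) by auto
  have wf: "pfst \<in> ?W \<rightarrow> Ai k" "psnd \<in> ?W \<rightarrow> Ai i" using Wsub by auto
  note c1 = rx_fb[OF pi_fb[OF N(3)] W wf(1)] and c2 = rx_fb[OF pi_fb[OF ij(1)] W wf(2)]
  let ?c = "mt (rx ?W pfst (\<pi> k)) (rx ?W psnd (\<pi> i))"
  have c: "?c \<in> fb ?W" "?c \<in> S"
    using mt_fb[OF c1 c2] mt_S[OF _ _ c1 c2] rx_S[OF pi_S pi_fb W] N(3) ij(1) wf by auto
  have e: "?e \<in> ?K \<rightarrow> ?W" by blast
  let ?Q = "rx ?K ?e ?c"
  have Q: "?Q \<in> fb ?K" using rx_fb[OF c(1) K e] .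
  have q1: "L ?Q (\<lambda>z. g (pfst z)) (\<pi> k)"
    using L_trans[OF L_trans[OF rx_proj[OF c(1) K e] mt_fst[OF c1 c2]] rx_proj[OF pi_fb[OF N(3)] W wf(1)]] by simp
  have q2: "L ?Q (\<lambda>z. pfst (psnd z)) (\<pi> i)"
    using L_trans[OF L_trans[OF rx_proj[OF c(1) K e] mt_snd[OF c1 c2]] rx_proj[OF pi_fb[OF ij(1)] W wf(2)]] by simp
  have "L ?Q pfst (rx N g (\<pi> k))"
    using rx_L[OF pi_fb[OF N(3)] N(1,4), of pfst ?Q] q1 fbD(1)[OF Q] KE by auto
  from L_trans[OF this pres_unit[OF pr]] have "L ?Q (\<lambda>z. u (pfst z)) (theta i j)" .
  then have "L ?Q (\<lambda>z. psnd (psnd z)) (\<pi> j)"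
  proof (rule theta_elim[OF _ q2])
    fix q assume "q \<in> p ?Q"
    then show "kpair (pfst (psnd q)) (psnd (psnd q)) \<in> elts (u (pfst q))"
      using KE[of q] fbD(1)[OF Q] by auto
  qed
  \<comment> \<open>Descent along \<open>?e\<close>: instances with equal code and equal argument
    have equal results, even if they come from different \<open>n\<close>.\<close>
  then obtain h where h: "h \<in> ?W \<rightarrow> Ai j" "\<And>z. z \<in> ?K \<Longrightarrow> h (?e z) = psnd (psnd z)" "L ?c h (\<pi> j)"
    by (rule modest[OF ij(2) c(2,1) K e refl]) blast
  have "kpair (g n) a \<in> ?W \<and> h (kpair (g n) a) = b" if n: "n \<in> N" "kpair a b \<in> elts (u n)" for n a b
  proof -
    have z: "kpair n (kpair a b) \<in> ?K" using n by simp
    then have "?e (kpair n (kpair a b)) \<in> ?W" by blast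
    then show ?thesis using h(2)[OF z] by simp
  qed
  then have "\<forall>n\<in>N. \<forall>a b. kpair a b \<in> elts (u n) \<longrightarrow> kpair (g n) a \<in> ?W \<and> h (kpair (g n) a) = b" by blast
  then have "is_app i j k ?W h"
    unfolding is_app_def using N(3) Wsub h(1,3) pr by (intro conjI exI[of _ N] exI[of _ u] exI[of _ g])
  then show ?thesis by blast
qed

end

definition app_data where
  "app_data i j = (SOME (k, W, h). is_app i j k W h)"

definition imp :: "'v \<Rightarrow> 'v \<Rightarrow> 'v" where "imp i j = fst (app_data i j)"
definition app_dom where "app_dom i j = fst (snd (app_data i j))"
definition app_fun where "app_fun i j = snd (snd (app_data i j))"

definition appl :: "'v \<Rightarrow> 'v \<Rightarrow> 'v \<Rightarrow> 'v \<Rightarrow> 'v option" where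
  "appl i j c a = (if kpair c a \<in> app_dom i j then Some (app_fun i j (kpair c a)) else None)"

lemma app_spec:
  assumes ij: "i \<in> I" "j \<in> I"
  shows "imp i j \<in> I" "app_dom i j \<subseteq> prd (Ai (imp i j)) (Ai i)" "app_fun i j \<in> app_dom i j \<rightarrow> Ai j"
    "L (mt (rx (app_dom i j) pfst (\<pi> (imp i j))) (rx (app_dom i j) psnd (\<pi> i))) (app_fun i j) (\<pi> j)"
    "\<exists>N u g. pres (theta i j) N u (imp i j) g \<and>
      (\<forall>n\<in>N. \<forall>a b. kpair a b \<in> elts (u n) \<longrightarrow> appl i j (g n) a = Some b)"
proof -
  have "case app_data i j of (k, W, h) \<Rightarrow> is_app i j k W h"
    unfolding app_data_def by (rule someI_ex) (use app_exists[OF ij] in \<open>simp add: split_paired_Ex\<close>)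
  then have *: "is_app i j (imp i j) (app_dom i j) (app_fun i j)"
    by (simp add: imp_def app_dom_def app_fun_def split_def)
  then show "imp i j \<in> I" "app_dom i j \<subseteq> prd (Ai (imp i j)) (Ai i)" "app_fun i j \<in> app_dom i j \<rightarrow> Ai j"
    "L (mt (rx (app_dom i j) pfst (\<pi> (imp i j))) (rx (app_dom i j) psnd (\<pi> i))) (app_fun i j) (\<pi> j)"
    by (auto simp: is_app_def)
  from * show "\<exists>N u g. pres (theta i j) N u (imp i j) g \<and>
      (\<forall>n\<in>N. \<forall>a b. kpair a b \<in> elts (u n) \<longrightarrow> appl i j (g n) a = Some b)"
    unfolding appl_def is_app_def by (elim conjE exE) (intro exI conjI ballI allI impI, assumption, simp)
qed

lemma appl_closed: "i \<in> I \<Longrightarrow> j \<in> I \<Longrightarrow> appl i j c a = Some b \<Longrightarrow> b \<in> Ai j"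
  using app_spec(3)[of i j] by (auto simp: appl_def split: if_splits)

text \<open>Modus ponens for application in a context \<open>Q\<close>: function and argument are
  paired into \<open>app_dom\<close>, on which \<open>app_fun\<close> is tracked.\<close>

lemma appl_rule:
  assumes ij: "i \<in> I" "j \<in> I" and f: "L Q f (\<pi> (imp i j))" and a: "L Q \<alpha> (\<pi> i)"
    and b: "\<And>q. q \<in> p Q \<Longrightarrow> appl i j (f q) (\<alpha> q) = Some (\<beta> q)"
  shows "L Q \<beta> (\<pi> j)"
proof -
  let ?W = "app_dom i j" and ?k = "imp i j"
  have k: "?k \<in> I" using app_spec(1)[OF ij] .
  have Q: "Q \<in> Obj (Total X)" using L_obj f by blast
  have W: "?W \<in> U" using sep_U[OF sig_U[OF Ai_U[OF k] Ai_U[OF ij(1)]] app_spec(2)[OF ij]] .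
  have wf: "pfst \<in> ?W \<rightarrow> Ai ?k" "psnd \<in> ?W \<rightarrow> Ai i"
    using subsetD[OF app_spec(2)[OF ij], THEN sig_fst] subsetD[OF app_spec(2)[OF ij], THEN sig_snd] by auto
  let ?h = "\<lambda>q. kpair (f q) (\<alpha> q)"
  have hb: "?h q \<in> ?W \<and> app_fun i j (?h q) = \<beta> q" if "q \<in> p Q" for q
    using b[OF that] by (simp add: appl_def split: if_splits)
  then have h: "?h \<in> p Q \<rightarrow> ?W" by blast
  have "L Q ?h (mt (rx ?W pfst (\<pi> ?k)) (rx ?W psnd (\<pi> i)))"
    using mt_L[OF rx_fb[OF pi_fb[OF k] W wf(1)] rx_fb[OF pi_fb[OF ij(1)] W wf(2)] h Q]
      rx_L[OF pi_fb[OF k] W wf(1) h] rx_L[OF pi_fb[OF ij(1)] W wf(2) h] f a by simp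
  from L_trans[OF this app_spec(4)[OF ij]] show ?thesis by (rule L_cong) (use hb in blast)
qed

text \<open>Functional completeness with a parameter in \<chi>. Each \<open>F z\<close> is turned
  into its graph; that \<open>F\<close> is tracked says that \<chi> is below \<open>theta\<close>
  along the coded graphs. The presentation of \<open>theta\<close> chosen for application has codes
  for them, found on a cover by \<open>prime\<close> and made a function of the parameter by
  \<open>modest\<close>.\<close>

lemma lam:
  assumes ij: "i \<in> I" "j \<in> I" and c: "\<chi> \<in> S"
    and F: "\<And>Q k \<alpha> \<beta>. L Q k \<chi> \<Longrightarrow> L Q \<alpha> (\<pi> i) \<Longrightarrow>
       (\<And>q. q \<in> p Q \<Longrightarrow> F (k q) (\<alpha> q) = Some (\<beta> q)) \<Longrightarrow> L Q \<beta> (\<pi> j)"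
    and Fc: "\<And>z a b. z \<in> p \<chi> \<Longrightarrow> a \<in> Ai i \<Longrightarrow> F z a = Some b \<Longrightarrow> b \<in> Ai j"
  obtains h where "h \<in> p \<chi> \<rightarrow> Ai (imp i j)" "L \<chi> h (\<pi> (imp i j))"
    "\<And>z a b. z \<in> p \<chi> \<Longrightarrow> a \<in> Ai i \<Longrightarrow> F z a = Some b \<Longrightarrow> appl i j (h z) a = Some b"
proof -
  let ?k = "imp i j"
  have k: "?k \<in> I" using app_spec(1)[OF ij] .
  have cf: "\<chi> \<in> fb (p \<chi>)" using S_fb[OF c] .
  \<comment> \<open>The graph of \<open>F z\<close>, cut down to a subset of the product so that it
    has a code.\<close>
  define G where "G z = {q \<in> prd (Ai i) (Ai j). F z (pfst q) = Some (psnd q)}" for z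
  define r where "r z = mk (G z)" for z
  have pU: "prd (Ai i) (Ai j) \<in> U" by (intro sig_U Ai_U ij)
  have r: "elts (r z) = G z" for z
  proof -
    have "G z \<in> U" by (rule sep_U[OF pU]) (auto simp: G_def)
    then show ?thesis unfolding r_def by (rule elts_mk)
  qed
  have rr: "r \<in> p \<chi> \<rightarrow> rel i j" by (auto simp: rel_def r G_def)
  have t: "L \<chi> r (theta i j)"
  proof (rule theta_intro[OF ij S_obj[OF c] rr])
    fix Q k \<alpha> \<beta> assume k: "L Q k \<chi>" and a: "L Q \<alpha> (\<pi> i)"
      and b: "\<And>q. q \<in> p Q \<Longrightarrow> kpair (\<alpha> q) (\<beta> q) \<in> elts (r (k q))"
    show "L Q \<beta> (\<pi> j)" by (rule F[OF k a]) (use b r in \<open>auto simp: G_def\<close>)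
  qed
  obtain N u g where pr: "pres (theta i j) N u ?k g"
    and ap: "\<And>n a b. n \<in> N \<Longrightarrow> kpair a b \<in> elts (u n) \<Longrightarrow> appl i j (g n) a = Some b"
    using app_spec(5)[OF ij] by blast
  have N: "N \<in> U" "u \<in> N \<rightarrow> rel i j" "g \<in> N \<rightarrow> Ai ?k"
    using pr fbD(1)[OF theta_fb[OF ij]] by (auto simp: pres_def)
  note ps = rx_fb[OF pi_fb[OF k] N(1,3)]
  have e: "E (rel i j) u (rx N g (\<pi> ?k)) \<in> fb (rel i j)" using E_fb[OF ps rel_U[OF ij] N(2)] .
  \<comment> \<open>\<open>theta\<close> is replaced by the existential that presents it, to which
    \<open>prime\<close> applies.\<close>
  have "L (theta i j) (\<lambda>a. a) (E (rel i j) u (rx N g (\<pi> ?k)))"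
    using pr E_unit[OF ps rel_U[OF ij] N(2)] fbD[OF e] fbD(1)[OF theta_fb[OF ij]] unfolding pres_def by simp
  from L_trans[OF t this] have "L \<chi> r (E (rel i j) u (rx N g (\<pi> ?k)))" .
  then obtain K e w where K: "K \<in> U" "e \<in> K \<rightarrow> p \<chi>" "e ` K = p \<chi>" "w \<in> K \<rightarrow> N"
    "\<And>k. k \<in> K \<Longrightarrow> u (w k) = r (e k)" "L (rx K e \<chi>) w (rx N g (\<pi> ?k))"
    by (rule prime[OF c rel_U[OF ij] N(2) ps]) blast
  have "L (rx K e \<chi>) (\<lambda>x. g (w x)) (\<pi> ?k)" using L_trans[OF K(6) rx_proj[OF pi_fb[OF k] N(1,3)]] .
  \<comment> \<open>The witness \<open>w x\<close> lives on the cover, but its code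
    \<open>g (w x)\<close> depends only on the parameter \<open>e x\<close>.\<close>
  then obtain h where h: "h \<in> p \<chi> \<rightarrow> Ai ?k" "\<And>x. x \<in> K \<Longrightarrow> h (e x) = g (w x)" "L \<chi> h (\<pi> ?k)"
    by (rule modest[OF k c cf K(1,2,3)]) blast
  show ?thesis
  proof (rule that[OF h(1,3)])
    fix z a b assume z: "z \<in> p \<chi>" and a: "a \<in> Ai i" and b: "F z a = Some b"
    obtain x where x: "x \<in> K" "z = e x" using z K(3) by blast
    have "kpair a b \<in> elts (u (w x))" using K(5)[OF x(1)] r z a b Fc x(2) by (simp add: G_def)
    then have "appl i j (g (w x)) a = Some b" using ap K(4) x(1) by blast
    then show "appl i j (h z) a = Some b" using h(2)[OF x(1)] x(2) by simp
  qed
qed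

text \<open>The case without parameter: \<open>lam\<close> over truth on a one-element set.\<close>

lemma lam1:
  assumes ij: "i \<in> I" "j \<in> I"
    and F: "\<And>Q \<alpha> \<beta>. L Q \<alpha> (\<pi> i) \<Longrightarrow>
       (\<And>q. q \<in> p Q \<Longrightarrow> F (\<alpha> q) = Some (\<beta> q)) \<Longrightarrow> L Q \<beta> (\<pi> j)"
    and Fc: "\<And>a b. a \<in> Ai i \<Longrightarrow> F a = Some b \<Longrightarrow> b \<in> Ai j"
  obtains c where "c \<in> Ai (imp i j)" "\<And>a b. a \<in> Ai i \<Longrightarrow> F a = Some b \<Longrightarrow> appl i j c a = Some b"
proof -
  have t: "p (tt one_set) = one_set" using fbD(1)[OF tt_fb[OF one_U]] .
  obtain h where h: "h \<in> one_set \<rightarrow> Ai (imp i j)" "L (tt one_set) h (\<pi> (imp i j))"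
    "\<And>z a b. z \<in> one_set \<Longrightarrow> a \<in> Ai i \<Longrightarrow> F a = Some b \<Longrightarrow> appl i j (h z) a = Some b"
  proof (rule lam[OF ij tt_S[OF one_U], of "\<lambda>_. F", unfolded t])
    fix Q k \<alpha> \<beta> assume "L Q \<alpha> (\<pi> i)" "\<And>q. q \<in> p Q \<Longrightarrow> F (\<alpha> q) = Some (\<beta> q)"
    then show "L Q \<beta> (\<pi> j)" by (rule F)
  qed (use Fc in blast)+
  show ?thesis by (rule that[of "h undefined"]) (use h(1,3) in \<open>auto simp: one_set_def\<close>)
qed

text \<open>Currying: the first argument is the parameter of \<open>lam\<close>, with
  \<open>\<pi> i\<close> as parameter predicate, and the resulting function of it is coded by
  \<open>lam1\<close>. That function is total, so applying \<open>c\<close> to \<open>a\<close> is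
  always defined.\<close>

lemma lam2:
  assumes ij: "i \<in> I" "j \<in> I" "k \<in> I"
    and F: "\<And>Q \<alpha> \<beta> \<gamma>. L Q \<alpha> (\<pi> i) \<Longrightarrow> L Q \<beta> (\<pi> j) \<Longrightarrow>
       (\<And>q. q \<in> p Q \<Longrightarrow> F (\<alpha> q) (\<beta> q) = Some (\<gamma> q)) \<Longrightarrow> L Q \<gamma> (\<pi> k)"
    and Fc: "\<And>a b c. a \<in> Ai i \<Longrightarrow> b \<in> Ai j \<Longrightarrow> F a b = Some c \<Longrightarrow> c \<in> Ai k"
  obtains c where "c \<in> Ai (imp i (imp j k))"
    "\<And>a. a \<in> Ai i \<Longrightarrow> \<exists>d. appl i (imp j k) c a = Some d \<and> (\<forall>b\<in>Ai j. \<forall>r. F a b = Some r \<longrightarrow> appl j k d b = Some r)"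
proof -
  obtain h where h: "h \<in> Ai i \<rightarrow> Ai (imp j k)" "L (\<pi> i) h (\<pi> (imp j k))"
    "\<And>z a b. z \<in> Ai i \<Longrightarrow> a \<in> Ai j \<Longrightarrow> F z a = Some b \<Longrightarrow> appl j k (h z) a = Some b"
  proof (rule lam[OF ij(2,3) pi_S[OF ij(1)], of F, unfolded pi_p[OF ij(1)]])
    fix Q \<alpha> \<beta> \<gamma> assume "L Q \<alpha> (\<pi> i)" "L Q \<beta> (\<pi> j)" "\<And>q. q \<in> p Q \<Longrightarrow> F (\<alpha> q) (\<beta> q) = Some (\<gamma> q)"
    then show "L Q \<gamma> (\<pi> k)" by (rule F)
  qed (use Fc in blast)+
  have jk: "imp j k \<in> I" using app_spec(1)[OF ij(2,3)] .
  obtain c where c: "c \<in> Ai (imp i (imp j k))"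
    "\<And>a b. a \<in> Ai i \<Longrightarrow> Some (h a) = Some b \<Longrightarrow> appl i (imp j k) c a = Some b"
  proof (rule lam1[OF ij(1) jk])
    fix Q \<alpha> \<beta> assume "L Q \<alpha> (\<pi> i)" and b: "\<And>q. q \<in> p Q \<Longrightarrow> Some (h (\<alpha> q)) = Some (\<beta> q)"
    from L_trans[OF this(1) h(2)] show "L Q \<beta> (\<pi> (imp j k))" by (rule L_cong) (use b in simp)
  qed (use h(1) in auto)
  show ?thesis by (rule that[OF c(1)]) (use c(2) h(3) in blast)
qed

lemma appl_k:
  assumes ij: "i \<in> I" "j \<in> I"
  obtains c where "c \<in> Ai (imp i (imp j i))"
    "\<And>a. a \<in> Ai i \<Longrightarrow> \<exists>d. appl i (imp j i) c a = Some d \<and> (\<forall>b\<in>Ai j. appl j i d b = Some a)"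
proof -
  obtain c where "c \<in> Ai (imp i (imp j i))"
    "\<And>a. a \<in> Ai i \<Longrightarrow> \<exists>d. appl i (imp j i) c a = Some d \<and> (\<forall>b\<in>Ai j. \<forall>r. Some a = Some r \<longrightarrow> appl j i d b = Some r)"
  proof (rule lam2[OF ij ij(1), of "\<lambda>a b. Some a"])
    fix Q \<alpha> \<beta> \<gamma> assume "L Q \<alpha> (\<pi> i)" and b: "\<And>q. q \<in> p Q \<Longrightarrow> Some (\<alpha> q) = Some (\<gamma> q)"
    then show "L Q \<gamma> (\<pi> i)" using L_cong by blast
  qed auto
  then show ?thesis using that by auto
qed

text \<open>\<open>lam\<close> allows a single parameter. Two parameters are packed into one: the
  meet of the two reindexings is again in \<open>S\<close>, by closure under finite meets.\<close>

lemma ctx: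
  assumes ij: "i \<in> I" "j \<in> I"
  defines "P \<equiv> prd (Ai i) (Ai j)"
  defines "c \<equiv> mt (rx P pfst (\<pi> i)) (rx P psnd (\<pi> j))"
  shows "P \<in> U" "c \<in> fb P" "c \<in> S" "L c pfst (\<pi> i)" "L c psnd (\<pi> j)"
    "L Q \<alpha> (\<pi> i) \<Longrightarrow> L Q \<beta> (\<pi> j) \<Longrightarrow> L Q (\<lambda>q. kpair (\<alpha> q) (\<beta> q)) c"
proof -
  show P: "P \<in> U" unfolding P_def by (intro sig_U Ai_U ij)
  have f: "pfst \<in> P \<rightarrow> Ai i" "psnd \<in> P \<rightarrow> Ai j" unfolding P_def by (auto dest: sig_fst sig_snd)
  note a = rx_fb[OF pi_fb[OF ij(1)] P f(1)] and b = rx_fb[OF pi_fb[OF ij(2)] P f(2)]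
  show "c \<in> fb P" unfolding c_def using mt_fb[OF a b] .
  show "c \<in> S" unfolding c_def
    using mt_S[OF _ _ a b] rx_S[OF pi_S pi_fb P] f ij by blast
  show "L c pfst (\<pi> i)" unfolding c_def using L_trans[OF mt_fst[OF a b] rx_proj[OF pi_fb[OF ij(1)] P f(1)]] .
  show "L c psnd (\<pi> j)" unfolding c_def using L_trans[OF mt_snd[OF a b] rx_proj[OF pi_fb[OF ij(2)] P f(2)]] .
  assume l: "L Q \<alpha> (\<pi> i)" "L Q \<beta> (\<pi> j)"
  have h: "(\<lambda>q. kpair (\<alpha> q) (\<beta> q)) \<in> p Q \<rightarrow> P" using L_fun[OF l(1)] L_fun[OF l(2)] ij by (auto simp: P_def)
  show "L Q (\<lambda>q. kpair (\<alpha> q) (\<beta> q)) c"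
    unfolding c_def mt_L[OF a b h L_obj[OF l(1), THEN conjunct1]]
    using rx_L[OF pi_fb[OF ij(1)] P f(1) h] rx_L[OF pi_fb[OF ij(2)] P f(2) h] l by simp
qed

text \<open>\<open>lam\<close> over the context of \<open>x\<close> and \<open>y\<close> gives a
  total function \<open>h\<close> of the pair, so \<open>s x y\<close> is defined even if
  \<open>x z (y z)\<close> never is; \<open>lam2\<close> then curries \<open>h\<close>.\<close>

lemma appl_s:
  assumes ij: "i \<in> I" "j \<in> I" "k \<in> I"
  obtains s where "s \<in> Ai (imp (imp i (imp j k)) (imp (imp i j) (imp i k)))"
    "\<And>x y. x \<in> Ai (imp i (imp j k)) \<Longrightarrow> y \<in> Ai (imp i j) \<Longrightarrow>
      \<exists>d f. appl (imp i (imp j k)) (imp (imp i j) (imp i k)) s x = Some d \<and> appl (imp i j) (imp i k) d y = Some f \<and>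
        (\<forall>z\<in>Ai i. refines (appl i k f z) (papp (appl j k) (appl i (imp j k) x z) (appl i j y z)))"
proof -
  let ?a = "imp i (imp j k)" and ?b = "imp i j" and ?c = "imp i k"
  have I: "imp j k \<in> I" "?a \<in> I" "?b \<in> I" "?c \<in> I" using app_spec(1) ij by blast+
  let ?P = "prd (Ai ?a) (Ai ?b)"
  let ?ctx = "mt (rx ?P pfst (\<pi> ?a)) (rx ?P psnd (\<pi> ?b))"
  note C = ctx[OF I(2,3)]
  let ?F = "\<lambda>x z. papp (appl j k) (appl i (imp j k) (pfst x) z) (appl i j (psnd x) z)"
  have pc: "p ?ctx = ?P" using fbD(1)[OF C(2)] .
  obtain h where h: "h \<in> ?P \<rightarrow> Ai ?c" "L ?ctx h (\<pi> ?c)"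
    "\<And>x z b. x \<in> ?P \<Longrightarrow> z \<in> Ai i \<Longrightarrow> ?F x z = Some b \<Longrightarrow> appl i k (h x) z = Some b"
  proof (rule lam[OF ij(1,3) C(3), of ?F, unfolded pc])
    fix Q x z b assume x: "L Q x ?ctx" and z: "L Q z (\<pi> i)" and b: "\<And>q. q \<in> p Q \<Longrightarrow> ?F (x q) (z q) = Some (b q)"
    have x1: "L Q (\<lambda>q. pfst (x q)) (\<pi> ?a)" using L_trans[OF x C(4)] .
    have x2: "L Q (\<lambda>q. psnd (x q)) (\<pi> ?b)" using L_trans[OF x C(5)] .
    \<comment> \<open>Names for the intermediate values, so that the three applications can be
      tracked one after the other.\<close>
    define f where "f q = the (appl i (imp j k) (pfst (x q)) (z q))" for q
    define g where "g q = the (appl i j (psnd (x q)) (z q))" for q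
    have d: "appl i (imp j k) (pfst (x q)) (z q) = Some (f q)" "appl i j (psnd (x q)) (z q) = Some (g q)"
      "appl j k (f q) (g q) = Some (b q)" if "q \<in> p Q" for q
      using b[OF that] by (auto simp: papp_Some_iff f_def g_def)
    have "L Q f (\<pi> (imp j k))" by (rule appl_rule[OF ij(1) I(1) x1 z d(1)])
    moreover have "L Q g (\<pi> j)" by (rule appl_rule[OF ij(1,2) x2 z d(2)])
    ultimately show "L Q b (\<pi> k)" by (rule appl_rule[OF ij(2,3)]) (rule d(3))
  next
    fix x z b assume "?F x z = Some b"
    then show "b \<in> Ai k" using appl_closed[OF ij(2,3)] by (auto simp: papp_Some_iff)
  qed blast
  obtain s where s: "s \<in> Ai (imp ?a (imp ?b ?c))"
    "\<And>a. a \<in> Ai ?a \<Longrightarrow> \<exists>d. appl ?a (imp ?b ?c) s a = Some d \<and> (\<forall>b\<in>Ai ?b. \<forall>r. Some (h (kpair a b)) = Some r \<longrightarrow> appl ?b ?c d b = Some r)"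
  proof (rule lam2[OF I(2,3,4), of "\<lambda>x y. Some (h (kpair x y))"])
    fix Q \<alpha> \<beta> \<gamma> assume a: "L Q \<alpha> (\<pi> ?a)" "L Q \<beta> (\<pi> ?b)" and g: "\<And>q. q \<in> p Q \<Longrightarrow> Some (h (kpair (\<alpha> q) (\<beta> q))) = Some (\<gamma> q)"
    from L_trans[OF C(6)[OF a] h(2)] show "L Q \<gamma> (\<pi> ?c)" by (rule L_cong) (use g in simp)
  qed (use h(1) in auto)
  show ?thesis
  proof (rule that[OF s(1)])
    fix x y assume x: "x \<in> Ai ?a" and y: "y \<in> Ai ?b"
    obtain d where d: "appl ?a (imp ?b ?c) s x = Some d" "appl ?b ?c d y = Some (h (kpair x y))" using s(2)[OF x] y by blast
    have "refines (appl i k (h (kpair x y)) z) (papp (appl j k) (appl i (imp j k) x z) (appl i j y z))" if z: "z \<in> Ai i" for z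
      using h(3)[of "kpair x y" z] x y z unfolding refines_def by auto
    then show "\<exists>d f. appl ?a (imp ?b ?c) s x = Some d \<and> appl ?b ?c d y = Some f \<and>
        (\<forall>z\<in>Ai i. refines (appl i k f z) (papp (appl j k) (appl i (imp j k) x z) (appl i j y z)))" using d by blast
  qed
qed

text \<open>By modesty \<open>f\<close> factors through the image of \<open>g\<close>, and the
  factor is a tracked partial operation on \<open>Ai i\<close>, which \<open>lam1\<close>
  codes.\<close>

lemma track:
  assumes ij: "i \<in> I" "j \<in> I" and N: "N \<in> U" "g \<in> N \<rightarrow> Ai i" and f: "L (rx N g (\<pi> i)) f (\<pi> j)"
  shows "\<exists>c\<in>Ai (imp i j). \<forall>n\<in>N. appl i j c (g n) = Some (f n)"
proof -
  let ?J = "g ` N"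
  have J: "?J \<in> U" "?J \<subseteq> Ai i" using image_U[OF N(1)] N(2) by auto
  have id: "(\<lambda>x. x) \<in> ?J \<rightarrow> Ai i" using J by auto
  let ?x = "rx ?J (\<lambda>x. x) (\<pi> i)"
  have x: "?x \<in> fb ?J" "?x \<in> S" using rx_fb[OF pi_fb[OF ij(1)] J(1) id] rx_S[OF pi_S pi_fb J(1) id] ij(1) by auto
  have g: "g \<in> N \<rightarrow> ?J" by blast
  have r: "rx N g ?x \<in> fb N" using rx_fb[OF x(1) N(1) g] .
  have "L (rx N g ?x) g (\<pi> i)" using L_trans[OF rx_proj[OF x(1) N(1) g] rx_proj[OF pi_fb[OF ij(1)] J(1) id]] .
  then have "L (rx N g ?x) (\<lambda>a. a) (rx N g (\<pi> i))"
    using rx_L[OF pi_fb[OF ij(1)] N, of "\<lambda>a. a"] fbD(1)[OF r] by simp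
  from L_trans[OF this f] obtain h where h: "h \<in> ?J \<rightarrow> Ai j" "\<And>n. n \<in> N \<Longrightarrow> h (g n) = f n" "L ?x h (\<pi> j)"
    by (rule modest[OF ij(2) x(2,1) N(1) g refl]) blast
  \<comment> \<open>Outside the image of \<open>g\<close> the operation is undefined, so tracking
    has to be checked only in contexts whose argument lies in the image.\<close>
  obtain c where c: "c \<in> Ai (imp i j)" "\<And>a b. a \<in> Ai i \<Longrightarrow> (if a \<in> ?J then Some (h a) else None) = Some b \<Longrightarrow> appl i j c a = Some b"
  proof (rule lam1[OF ij, of "\<lambda>a. if a \<in> ?J then Some (h a) else None"])
    fix Q \<alpha> \<beta> assume a: "L Q \<alpha> (\<pi> i)" and b: "\<And>q. q \<in> p Q \<Longrightarrow> (if \<alpha> q \<in> ?J then Some (h (\<alpha> q)) else None) = Some (\<beta> q)"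
    have hb: "\<alpha> q \<in> ?J \<and> h (\<alpha> q) = \<beta> q" if "q \<in> p Q" for q
      using b[OF that] by (simp split: if_splits)
    then have aJ: "\<alpha> \<in> p Q \<rightarrow> ?J" by blast
    have "L Q \<alpha> ?x" using rx_L[OF pi_fb[OF ij(1)] J(1) id aJ] a by simp
    from L_trans[OF this h(3)] show "L Q \<beta> (\<pi> j)" by (rule L_cong) (use hb in blast)
  qed (use h(1) in \<open>auto split: if_splits\<close>)
  have "appl i j c (g n) = Some (f n)" if n: "n \<in> N" for n
    using c(2)[of "g n" "f n"] h(2)[OF n] n g J(2) by auto
  then show ?thesis using c(1) by blast
qed

definition is_prod where
  "is_prod i j k \<longleftrightarrow> k \<in> I \<and> (\<exists>pr\<in>Ai (imp i (imp j k)). \<exists>fs\<in>Ai (imp k i). \<exists>sn\<in>Ai (imp k j). \<forall>x\<in>Ai i. \<forall>y\<in>Ai j. \<exists>d v.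
    appl i (imp j k) pr x = Some d \<and> appl j k d y = Some v \<and> appl k i fs v = Some x \<and> appl k j sn v = Some y)"

text \<open>The meet of the two predicates over the product of \<open>Ai i\<close> and
  \<open>Ai j\<close> lies in \<open>S\<close>, so it is isomorphic to a reindexing of some
  \<open>\<pi> k\<close> along some \<open>g\<close>. This \<open>k\<close> is the product type and
  \<open>g\<close> the pairing function; the projections are tracked, so \<open>track\<close>
  computes them from the values of \<open>g\<close>.\<close>

lemma prod_exists:
  assumes ij: "i \<in> I" "j \<in> I"
  shows "\<exists>k. is_prod i j k"
proof -
  let ?P = "prd (Ai i) (Ai j)"
  let ?c = "mt (rx ?P pfst (\<pi> i)) (rx ?P psnd (\<pi> j))"
  note C = ctx[OF ij]
  have pc: "p ?c = ?P" using fbD(1)[OF C(2)] .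
  obtain k g where k: "k \<in> I" "g \<in> ?P \<rightarrow> Ai k" "L ?c g (\<pi> k)" "L (rx ?P g (\<pi> k)) (\<lambda>a. a) ?c"
    using C(3) unfolding S_iff pc by blast
  have proj: "\<exists>c\<in>Ai (imp k l). \<forall>q\<in>?P. appl k l c (g q) = Some (f q)"
    if "l \<in> I" "L ?c f (\<pi> l)" for l f
    by (rule track[OF k(1) that(1) C(1) k(2) L_trans[OF k(4) that(2)]])
  obtain fs where fs: "fs \<in> Ai (imp k i)" "\<forall>q\<in>?P. appl k i fs (g q) = Some (pfst q)" using proj[OF ij(1) C(4)] by blast
  obtain sn where sn: "sn \<in> Ai (imp k j)" "\<forall>q\<in>?P. appl k j sn (g q) = Some (psnd q)" using proj[OF ij(2) C(5)] by blast
  obtain pr where pr: "pr \<in> Ai (imp i (imp j k))"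
    "\<And>a. a \<in> Ai i \<Longrightarrow> \<exists>d. appl i (imp j k) pr a = Some d \<and> (\<forall>b\<in>Ai j. \<forall>r. Some (g (kpair a b)) = Some r \<longrightarrow> appl j k d b = Some r)"
  proof (rule lam2[OF ij k(1), of "\<lambda>x y. Some (g (kpair x y))"])
    fix Q \<alpha> \<beta> \<gamma> assume a: "L Q \<alpha> (\<pi> i)" "L Q \<beta> (\<pi> j)" and b: "\<And>q. q \<in> p Q \<Longrightarrow> Some (g (kpair (\<alpha> q) (\<beta> q))) = Some (\<gamma> q)"
    from L_trans[OF C(6)[OF a] k(3)] show "L Q \<gamma> (\<pi> k)" by (rule L_cong) (use b in simp)
  qed (use k(2) in auto)
  have fin: "\<exists>d v. appl i (imp j k) pr x = Some d \<and> appl j k d y = Some v \<and> appl k i fs v = Some x \<and> appl k j sn v = Some y"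
    if x: "x \<in> Ai i" and y: "y \<in> Ai j" for x y
  proof -
    obtain d where "appl i (imp j k) pr x = Some d" "appl j k d y = Some (g (kpair x y))" using pr(2)[OF x] y by blast
    moreover have "kpair x y \<in> ?P" using x y by simp
    ultimately show ?thesis using fs(2) sn(2) by fastforce
  qed
  show ?thesis unfolding is_prod_def using k(1) pr(1) fs(1) sn(1) fin by blast
qed

definition prodt :: "'v \<Rightarrow> 'v \<Rightarrow> 'v" where
  "prodt i j = (SOME k. is_prod i j k)"

lemma prodt: "i \<in> I \<Longrightarrow> j \<in> I \<Longrightarrow> is_prod i j (prodt i j)"
  unfolding prodt_def by (rule someI_ex) (rule prod_exists)

definition rpca :: "'v tpca" where
  "rpca = \<lparr>types = I, tprod = prodt, timp = imp, elems = Ai, tapp = appl\<rparr>"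

text \<open>Truth on a one-element set is isomorphic to a reindexing of some
  \<open>\<pi> i\<close>.\<close>

lemma I_ne: "I \<noteq> {}"
  using tt_S[OF one_U] unfolding S_iff by blast

lemma typed_pca_rpca: "typed_pca (set_cat elts) rpca"
  unfolding typed_pca_def set_cat_sel
proof (intro conjI ballI allI impI)
  show "types rpca \<in> U" "types rpca \<noteq> {}" using I_U I_ne by (simp_all add: rpca_def)
  show "elems rpca i \<in> U" if "i \<in> types rpca" for i using Ai_U that by (simp add: rpca_def)
  fix i j assume "i \<in> types rpca" "j \<in> types rpca"
  then have ij: "i \<in> I" "j \<in> I" by (simp_all add: rpca_def)
  show "tprod rpca i j \<in> types rpca" "timp rpca i j \<in> types rpca"
    using prodt[OF ij] app_spec(1)[OF ij] by (simp_all add: rpca_def is_prod_def)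
  show "y \<in> elems rpca j" if "tapp rpca i j f x = Some y" for f x y
    using appl_closed[OF ij] that by (simp add: rpca_def)
  fix k assume "k \<in> types rpca"
  then have k: "k \<in> I" by (simp add: rpca_def)
  obtain c where c: "c \<in> Ai (imp i (imp j i))"
    "\<And>a. a \<in> Ai i \<Longrightarrow> \<exists>d. appl i (imp j i) c a = Some d \<and> (\<forall>b\<in>Ai j. appl j i d b = Some a)" by (rule appl_k[OF ij]) blast
  show "\<exists>kk\<in>elems rpca (timp rpca i (timp rpca j i)). \<forall>x\<in>elems rpca i.
      tapp rpca i (timp rpca j i) kk x \<noteq> None \<and>
      (\<forall>y\<in>elems rpca j. papp (tapp rpca j i) (tapp rpca i (timp rpca j i) kk x) (Some y) = Some x)"
    unfolding rpca_def by (simp, rule bexI[OF _ c(1)]) (use c(2) in \<open>fastforce simp: papp_def\<close>)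
  obtain s where s: "s \<in> Ai (imp (imp i (imp j k)) (imp (imp i j) (imp i k)))"
    "\<And>x y. x \<in> Ai (imp i (imp j k)) \<Longrightarrow> y \<in> Ai (imp i j) \<Longrightarrow>
      \<exists>d f. appl (imp i (imp j k)) (imp (imp i j) (imp i k)) s x = Some d \<and> appl (imp i j) (imp i k) d y = Some f \<and>
        (\<forall>z\<in>Ai i. refines (appl i k f z) (papp (appl j k) (appl i (imp j k) x z) (appl i j y z)))"
    by (rule appl_s[OF ij k]) blast
  show "let ijk = timp rpca i (timp rpca j k); ij = timp rpca i j; ik = timp rpca i k in
         \<exists>ss\<in>elems rpca (timp rpca ijk (timp rpca ij ik)).
           \<forall>x\<in>elems rpca ijk. \<forall>y\<in>elems rpca ij.
             papp (tapp rpca ij ik) (tapp rpca ijk (timp rpca ij ik) ss x) (Some y) \<noteq> None \<and>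
             (\<forall>z\<in>elems rpca i.
               refines
                 (papp (tapp rpca i k)
                    (papp (tapp rpca ij ik) (tapp rpca ijk (timp rpca ij ik) ss x) (Some y)) (Some z))
                 (papp (tapp rpca j k) (tapp rpca i (timp rpca j k) x z) (tapp rpca i j y z)))"
    unfolding rpca_def Let_def by (simp, rule bexI[OF _ s(1)]) (use s(2) in \<open>fastforce simp: papp_def\<close>)
  obtain pr fs sn where P: "pr \<in> Ai (imp i (imp j (prodt i j)))" "fs \<in> Ai (imp (prodt i j) i)" "sn \<in> Ai (imp (prodt i j) j)"
    "\<And>x y. x \<in> Ai i \<Longrightarrow> y \<in> Ai j \<Longrightarrow> \<exists>d v.
    appl i (imp j (prodt i j)) pr x = Some d \<and> appl j (prodt i j) d y = Some v \<and> appl (prodt i j) i fs v = Some x \<and> appl (prodt i j) j sn v = Some y"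
    using prodt[OF ij] unfolding is_prod_def by blast
  show "let p = tprod rpca i j in
         \<exists>pr\<in>elems rpca (timp rpca i (timp rpca j p)). \<exists>fs\<in>elems rpca (timp rpca p i). \<exists>sn\<in>elems rpca (timp rpca p j).
           \<forall>x\<in>elems rpca i. \<forall>y\<in>elems rpca j.
             papp (tapp rpca p i) (Some fs)
               (papp (tapp rpca j p) (tapp rpca i (timp rpca j p) pr x) (Some y)) = Some x \<and>
             papp (tapp rpca p j) (Some sn)
               (papp (tapp rpca j p) (tapp rpca i (timp rpca j p) pr x) (Some y)) = Some y"
    unfolding rpca_def Let_def
    by (simp, rule bexI[OF _ P(1)], rule bexI[OF _ P(2)], rule bexI[OF _ P(3)]) (use P(4) in \<open>fastforce simp: papp_def\<close>)
qed

end

section \<open>Realizers of predicates\<close>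

text \<open>\<open>points\<close> is the condition on \<gamma> in the form given by
  \<open>gamma_iso_pi_iff\<close>.\<close>

locale realiz = prim elts X I Ai \<pi> for elts :: "'v \<Rightarrow> 'v set" and X :: "('o, 'a, 'v) setfib" and I Ai \<pi> +
  assumes points: "\<And>i a. i \<in> I \<Longrightarrow> a \<in> Ai i \<Longrightarrow> L (tt one_set) (\<lambda>_. a) (\<pi> i)"
begin

lemma rpca_sel [simp]: "types rpca = I" "tprod rpca = prodt" "timp rpca = imp" "elems rpca = Ai" "tapp rpca = appl"
  by (simp_all add: rpca_def)

sublocale RP: tp elts rpca
  by unfold_locales (rule typed_pca_rpca)

lemma const_point:
  assumes Q: "Q \<in> Obj (Total X)" and i: "i \<in> I" "a \<in> Ai i" shows "L Q (\<lambda>_. a) (\<pi> i)"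
proof -
  have "L Q (\<lambda>_. undefined) (tt one_set)" using tt_L[OF one_U Q] by (simp add: one_set_def)
  from L_trans[OF this points[OF i]] show ?thesis .
qed

text \<open>From left to right, \<open>prime\<close> gives elements of \<open>N'\<close> on a cover
  of \<open>N\<close>, \<open>modest\<close> makes their codes a function of \<open>n\<close>, and
  \<open>track\<close> represents this function by an element. From right to left, any element
  \<open>e\<close> may serve as a realizer because \<open>points\<close> makes it true in every
  context, and application to it is tracked by \<open>appl_rule\<close>.\<close>

lemma order:
  assumes P: "pres \<phi> N u i g" and P': "pres \<psi> N' u' j g'" and v: "v \<in> p \<phi> \<rightarrow> p \<psi>"
  shows "L \<phi> v \<psi> \<longleftrightarrow> (\<exists>e\<in>Ai (imp i j). \<forall>n\<in>N. \<exists>n'\<in>N'. u' n' = v (u n) \<and> appl i j e (g n) = Some (g' n'))"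
proof -
  have N: "\<phi> \<in> Obj (Total X)" "N \<in> U" "u \<in> N \<rightarrow> p \<phi>" "i \<in> I" "g \<in> N \<rightarrow> Ai i" using P by (auto simp: pres_def)
  have N': "\<psi> \<in> Obj (Total X)" "N' \<in> U" "u' \<in> N' \<rightarrow> p \<psi>" "j \<in> I" "g' \<in> N' \<rightarrow> Ai j" using P' by (auto simp: pres_def)
  let ?Q = "rx N g (\<pi> i)" and ?Q' = "rx N' g' (\<pi> j)"
  have Q: "?Q \<in> fb N" "?Q \<in> S" using rx_fb[OF pi_fb N(2,5)] rx_S[OF pi_S pi_fb N(2,5)] N(4) by auto
  have Q': "?Q' \<in> fb N'" using rx_fb[OF pi_fb N'(2,5)] N'(4) by auto
  have M': "p \<psi> \<in> U" using fbD(3)[OF fbI[OF N'(1)]] .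
  show ?thesis
  proof
    assume l: "L \<phi> v \<psi>"
    have e: "E (p \<psi>) u' ?Q' \<in> fb (p \<psi>)" using E_fb[OF Q' M' N'(3)] .
    have "L \<psi> (\<lambda>a. a) (E (p \<psi>) u' ?Q')"
      using P' E_unit[OF Q' M' N'(3)] fbD[OF e] unfolding pres_def by simp
    from L_trans[OF L_trans[OF pres_unit[OF P] l] this] have "L ?Q (\<lambda>n. v (u n)) (E (p \<psi>) u' ?Q')" .
    then obtain K e w where K: "K \<in> U" "e \<in> K \<rightarrow> N" "e ` K = N" "w \<in> K \<rightarrow> N'"
      "\<And>k. k \<in> K \<Longrightarrow> u' (w k) = v (u (e k))" "L (rx K e ?Q) w ?Q'"
      by (rule prime[OF Q(2) M' N'(3) Q', unfolded fbD(1)[OF Q(1)]]) blast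
    have "L (rx K e ?Q) (\<lambda>k. g' (w k)) (\<pi> j)" using L_trans[OF K(6) rx_proj[OF pi_fb[OF N'(4)] N'(2,5)]] .
    then obtain h where h: "h \<in> N \<rightarrow> Ai j" "\<And>k. k \<in> K \<Longrightarrow> h (e k) = g' (w k)" "L ?Q h (\<pi> j)"
      by (rule modest[OF N'(4) Q(2,1) K(1-3)]) blast
    obtain d where d: "d \<in> Ai (imp i j)" "\<forall>n\<in>N. appl i j d (g n) = Some (h n)"
      using track[OF N(4) N'(4) N(2,5) h(3)] by blast
    have "\<exists>n'\<in>N'. u' n' = v (u n) \<and> appl i j d (g n) = Some (g' n')" if n: "n \<in> N" for n
    proof -
      obtain k where k: "k \<in> K" "n = e k" using n K(3) by blast
      have "appl i j d (g n) = Some (h n)" using d(2) n by blast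
      moreover have "h n = g' (w k)" using h(2) k by simp
      moreover have "w k \<in> N'" using K(4) k(1) by blast
      ultimately show ?thesis using K(5)[OF k(1)] k(2) by auto
    qed
    then show "\<exists>e\<in>Ai (imp i j). \<forall>n\<in>N. \<exists>n'\<in>N'. u' n' = v (u n) \<and> appl i j e (g n) = Some (g' n')" using d(1) by blast
  next
    assume "\<exists>e\<in>Ai (imp i j). \<forall>n\<in>N. \<exists>n'\<in>N'. u' n' = v (u n) \<and> appl i j e (g n) = Some (g' n')"
    then obtain e w where e: "e \<in> Ai (imp i j)"
      and w: "\<And>n. n \<in> N \<Longrightarrow> w n \<in> N' \<and> u' (w n) = v (u n) \<and> appl i j e (g n) = Some (g' (w n))" by metis
    have a: "L ?Q (\<lambda>_. e) (\<pi> (imp i j))" using const_point[OF fbD(2)[OF Q(1)] app_spec(1)[OF N(4) N'(4)] e] .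
    have "L ?Q (\<lambda>n. g' (w n)) (\<pi> j)"
      by (rule appl_rule[OF N(4) N'(4) a rx_proj[OF pi_fb[OF N(4)] N(2,5)]]) (use w fbD(1)[OF Q(1)] in simp)
    then have "L ?Q w ?Q'" using rx_L[OF pi_fb[OF N'(4)] N'(2,5), of w ?Q] w fbD(1)[OF Q(1)] by auto
    from L_trans[OF this pres_unit[OF P']] have "L ?Q (\<lambda>n. v (u n)) \<psi>"
      by (rule L_cong) (use w fbD(1)[OF Q(1)] in simp)
    then show "L \<phi> v \<psi>" using P v N'(1) unfolding pres_def by simp
  qed
qed

definition realize where
  "realize M N u i g = (i, \<lambda>m\<in>M. {g n | n. n \<in> N \<and> u n = m})"

lemma realize_Pr: "i \<in> I \<Longrightarrow> g \<in> N \<rightarrow> Ai i \<Longrightarrow> realize M N u i g \<in> RP.Pr M"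
  by (auto simp: realize_def RP.Pr_def)

lemma le_realize:
  assumes P: "pres \<phi> N u i g" and P': "pres \<psi> N' u' j g'" and v: "v \<in> p \<phi> \<rightarrow> p \<psi>"
  shows "L \<phi> v \<psi> \<longleftrightarrow>
    RP.le (p \<phi>) (realize (p \<phi>) N u i g) (RP.RE (arr (p \<phi>) v (p \<psi>)) (realize (p \<psi>) N' u' j g'))"
proof -
  have u: "u \<in> N \<rightarrow> p \<phi>" using P by (simp add: pres_def)
  have "RP.le (p \<phi>) (realize (p \<phi>) N u i g) (RP.RE (arr (p \<phi>) v (p \<psi>)) (realize (p \<psi>) N' u' j g')) \<longleftrightarrow>
    (\<exists>e\<in>Ai (imp i j). \<forall>m\<in>p \<phi>. \<forall>x\<in>{g n | n. n \<in> N \<and> u n = m}. \<exists>y\<in>{g' n | n. n \<in> N' \<and> u' n = v m}. appl i j e x = Some y)"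
    unfolding RP.le_RE[OF v] realize_def using v by (auto simp: Pi_iff)
  also have "\<dots> \<longleftrightarrow> (\<exists>e\<in>Ai (imp i j). \<forall>n\<in>N. \<exists>n'\<in>N'. u' n' = v (u n) \<and> appl i j e (g n) = Some (g' n'))"
    using u by (intro bex_cong refl) blast
  finally show ?thesis using order[OF assms] by simp
qed

definition repr where
  "repr \<phi> = (SOME r. \<exists>N u i g. pres \<phi> N u i g \<and> r = realize (p \<phi>) N u i g)"

lemma repr: assumes "\<phi> \<in> Obj (Total X)" obtains N u i g where "pres \<phi> N u i g" "repr \<phi> = realize (p \<phi>) N u i g"
proof -
  have "\<exists>r. \<exists>N u i g. pres \<phi> N u i g \<and> r = realize (p \<phi>) N u i g" using pres_exists[OF fbI[OF assms]] by blast
  from someI_ex[OF this, folded repr_def] show ?thesis using that by blast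
qed

lemma repr_Pr: assumes "\<phi> \<in> Obj (Total X)" shows "repr \<phi> \<in> RP.Pr (p \<phi>)"
proof -
  obtain N u i g where "pres \<phi> N u i g" "repr \<phi> = realize (p \<phi>) N u i g" by (rule repr[OF assms])
  then show ?thesis using realize_Pr by (auto simp: pres_def)
qed

lemma over_repr:
  assumes x: "x \<in> Obj (Total X)" "y \<in> Obj (Total X)"
  shows "over X x u y \<longleftrightarrow> u \<in> hom (set_cat elts) (p x) (p y) \<and> RP.le (p x) (repr x) (RP.RE u (repr y))"
proof -
  obtain N v i g where P: "pres x N v i g" "repr x = realize (p x) N v i g" by (rule repr[OF x(1)])
  obtain N' v' j g' where P': "pres y N' v' j g'" "repr y = realize (p y) N' v' j g'" by (rule repr[OF x(2)])
  show ?thesis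
  proof
    assume o: "over X x u y"
    then obtain f where f: "u = arr (p x) f (p y)" "L x f y" by (auto simp: over_L)
    show "u \<in> hom (set_cat elts) (p x) (p y) \<and> RP.le (p x) (repr x) (RP.RE u (repr y))"
      using over_hom[OF o] base le_realize[OF P(1) P'(1) L_fun[OF f(2)]] f P P' by simp
  next
    assume a: "u \<in> hom (set_cat elts) (p x) (p y) \<and> RP.le (p x) (repr x) (RP.RE u (repr y))"
    then obtain f where f: "u = arr (p x) f (p y)" "f \<in> p x \<rightarrow> p y" by (auto elim: homE)
    then have "L x f y" using le_realize[OF P(1) P'(1) f(2)] a P P' by simp
    then show "over X x u y" using f by (auto simp: over_L)
  qed
qed

text \<open>A realizability predicate presents a predicate of \<open>X\<close> over its own total
  space: pairs of a point and a realizer, mapped to the point and to the realizer.\<close>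

lemma repr_surj:
  assumes M: "M \<in> U" and a: "a \<in> RP.Pr M"
  obtains x where "x \<in> fb M" "RP.le M a (repr x)" "RP.le M (repr x) a"
proof -
  let ?i = "fst a" and ?N = "sig M (snd a)"
  have i: "?i \<in> I" and s: "snd a \<in> M \<rightarrow>\<^sub>E Pow (Ai ?i)" using a by (simp_all add: RP.Pr_def)
  have N: "?N \<in> U" using sig_U[OF M] sep_U[OF Ai_U[OF i]] s by auto
  have f: "pfst \<in> ?N \<rightarrow> M" by (auto dest: sig_fst)
  have g: "psnd \<in> ?N \<rightarrow> Ai ?i"
  proof
    fix z assume "z \<in> ?N"
    then have "psnd z \<in> snd a (pfst z)" "pfst z \<in> M" using sig_fst sig_snd by blast+
    then show "psnd z \<in> Ai ?i" using s by auto
  qed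
  let ?x = "E M pfst (rx ?N psnd (\<pi> ?i))"
  have x: "?x \<in> fb M" using E_fb[OF rx_fb[OF pi_fb[OF i] N g] M f] .
  have P: "pres ?x ?N pfst ?i psnd" using pres_E[OF M N f i g] .
  have "{psnd n | n. n \<in> ?N \<and> pfst n = m} = snd a m" if "m \<in> M" for m
  proof
    show "snd a m \<subseteq> {psnd n | n. n \<in> ?N \<and> pfst n = m}"
      using that by (auto intro!: exI[of _ "kpair m _"])
  qed (auto elim!: sigE)
  then have "(\<lambda>m\<in>M. {psnd n | n. n \<in> ?N \<and> pfst n = m}) = snd a"
    using s by (auto simp: PiE_def extensional_def fun_eq_iff)
  then have ra: "realize (p ?x) ?N pfst ?i psnd = a" using fbD(1)[OF x] by (simp add: realize_def)
  \<comment> \<open>\<open>repr\<close> may have chosen another presentation of the same predicate;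
    \<open>le_realize\<close> along the identity shows that the two are equivalent.\<close>
  obtain N' u' i' g' where P': "pres ?x N' u' i' g'" "repr ?x = realize (p ?x) N' u' i' g'" by (rule repr[OF fbD(2)[OF x]])
  have id: "(\<lambda>a. a) \<in> p ?x \<rightarrow> p ?x" by auto
  have r: "repr ?x \<in> RP.Pr M" using repr_Pr[OF fbD(2)[OF x]] fbD(1)[OF x] by simp
  have "RP.le M a (repr ?x)"
    using le_realize[OF P P'(1) id] L_refl[OF fbD(2)[OF x]] ra P'(2) fbD(1)[OF x] RP.RE_id[OF r] by simp
  moreover have "RP.le M (repr ?x) a"
    using le_realize[OF P'(1) P id] L_refl[OF fbD(2)[OF x]] ra P'(2) fbD(1)[OF x] RP.RE_id[OF a] by simp
  ultimately show ?thesis using that x by blast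
qed

theorem equivalent_hyperdoctrine: "fibered_equivalent X (realizability_hyperdoctrine (set_cat elts) rpca)"
  unfolding RP.RH_eq
proof (rule fibered_equivalentI[where F = "\<lambda>x. (p x, repr x)"])
  show "faithful_fib X" by unfold_locales
  show "faithful_fib (grothendieck (set_cat elts) RP.Pr RP.le RP.RE)" by (rule RP.faithful_fib_RH)
next
  fix x u y assume "x \<in> Obj (Total X)" "y \<in> Obj (Total X)"
  then show "over X x u y \<longleftrightarrow> over (grothendieck (set_cat elts) RP.Pr RP.le RP.RE) (p x, repr x) u (p y, repr y)"
    using over_repr repr_Pr by (simp add: over_grothendieck)
next
  fix y :: "'v set \<times> 'v \<times> ('v \<Rightarrow> 'v set)"
  assume "y \<in> Obj (Total (grothendieck (set_cat elts) RP.Pr RP.le RP.RE))"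
  then obtain M a where y: "y = (M, a)" "M \<in> U" "a \<in> RP.Pr M" by auto
  obtain x where x: "x \<in> fb M" "RP.le M a (repr x)" "RP.le M (repr x) a" by (rule repr_surj[OF y(2,3)])
  have r: "repr x \<in> RP.Pr M" using repr_Pr[OF fbD(2)[OF x(1)]] fbD(1)[OF x(1)] by simp
  show "\<exists>x\<in>Obj (Total X). p x = on_obj (Proj (grothendieck (set_cat elts) RP.Pr RP.le RP.RE)) y \<and>
       over (grothendieck (set_cat elts) RP.Pr RP.le RP.RE) y (Ident (Base (grothendieck (set_cat elts) RP.Pr RP.le RP.RE)) (on_obj (Proj (grothendieck (set_cat elts) RP.Pr RP.le RP.RE)) y)) (p x, repr x) \<and>
       over (grothendieck (set_cat elts) RP.Pr RP.le RP.RE) (p x, repr x) (Ident (Base (grothendieck (set_cat elts) RP.Pr RP.le RP.RE)) (on_obj (Proj (grothendieck (set_cat elts) RP.Pr RP.le RP.RE)) y)) y"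
    using x r y fbD[OF x(1)] by (intro bexI[of _ x]) (simp_all add: over_grothendieck RP.RE_id)
qed (use repr_Pr base proj_obj in auto)

section \<open>The case of a single generating predicate\<close>

context
  fixes i assumes single: "I = {i}"
begin

definition rone :: "'v pca" where "rone = \<lparr>carr = Ai i, app = appl i i\<rparr>"

lemma iI: "i \<in> I" using single by simp
text \<open>With one type, the arrow type can only be that type itself, so application becomes an
  untyped partial operation.\<close>

lemma imp_single: "imp i i = i" using app_spec(1)[OF iI iI] single by simp

lemma is_pca_rone: "is_pca (set_cat elts) rone"
proof -
  obtain k where k: "k \<in> Ai i"
    "\<And>a. a \<in> Ai i \<Longrightarrow> \<exists>d. appl i i k a = Some d \<and> (\<forall>b\<in>Ai i. appl i i d b = Some a)"
    by (rule appl_k[OF iI iI, unfolded imp_single]) blast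
  obtain s where s: "s \<in> Ai i"
    "\<And>x y. x \<in> Ai i \<Longrightarrow> y \<in> Ai i \<Longrightarrow>
      \<exists>d f. appl i i s x = Some d \<and> appl i i d y = Some f \<and>
        (\<forall>z\<in>Ai i. refines (appl i i f z) (papp (appl i i) (appl i i x z) (appl i i y z)))"
    by (rule appl_s[OF iI iI iI, unfolded imp_single]) blast
  have "\<forall>x\<in>Ai i. \<forall>y\<in>Ai i. papp (appl i i) (appl i i k x) (Some y) = Some x"
    using k(2) unfolding papp_Some_iff by blast
  moreover have "\<forall>x\<in>Ai i. \<forall>y\<in>Ai i. papp (appl i i) (appl i i s x) (Some y) \<noteq> None \<and>
           (\<forall>z\<in>Ai i.
              refines (papp (appl i i) (papp (appl i i) (appl i i s x) (Some y)) (Some z))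
                      (papp (appl i i) (appl i i x z) (appl i i y z)))"
    using s(2) by (fastforce simp: papp_def)
  ultimately show ?thesis
    unfolding is_pca_def rone_def pca.simps set_cat_sel
    using Ai_U[OF iI] appl_closed[OF iI iI] k(1) s(1) by (intro conjI bexI[of _ k] bexI[of _ s]) blast+
qed

lemma Pr_single: "(i, \<phi>) \<in> RP.Pr M \<longleftrightarrow> \<phi> \<in> M \<rightarrow>\<^sub>E Pow (Ai i)"
  using iI by (simp add: RP.Pr_def)

lemma fst_Pr: assumes "a \<in> RP.Pr M" shows "fst a = i"
proof -
  have "fst a \<in> I" using RP.Pr_J[OF assms] by simp
  then show ?thesis using single by blast
qed

text \<open>The tripos consists of the predicates of the hyperdoctrine, all of which have first
  component \<open>i\<close>, with this component dropped; its laws are inherited in this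
  way.\<close>

lemma tripos_eq: "realizability_tripos (set_cat elts) rone =
    grothendieck (set_cat elts) (\<lambda>M. M \<rightarrow>\<^sub>E Pow (Ai i)) (\<lambda>M \<phi> \<psi>. RP.le M (i, \<phi>) (i, \<psi>)) (\<lambda>u \<psi>. snd (RP.RE u (i, \<psi>)))"
  by (simp add: realizability_tripos_def rone_def RP.le_def RP.RE_def imp_single)

lemma RE_single: "(i, snd (RP.RE u (i, \<psi>))) = RP.RE u (i, \<psi>)" by (simp add: RP.RE_def)

theorem equivalent_tripos: "fibered_equivalent X (realizability_tripos (set_cat elts) rone)"
proof -
  let ?Y = "grothendieck (set_cat elts) (\<lambda>M. M \<rightarrow>\<^sub>E Pow (Ai i)) (\<lambda>M \<phi> \<psi>. RP.le M (i, \<phi>) (i, \<psi>)) (\<lambda>u \<psi>. snd (RP.RE u (i, \<psi>)))"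
  have rr: "(i, snd (repr x)) = repr x" if "x \<in> Obj (Total X)" for x
    using fst_Pr[OF repr_Pr[OF that]] by (cases "repr x") simp
  have rP: "snd (repr x) \<in> p x \<rightarrow>\<^sub>E Pow (Ai i)" if "x \<in> Obj (Total X)" for x
    using repr_Pr[OF that] rr[OF that] Pr_single[of "snd (repr x)" "p x"] by simp
  have ff: "faithful_fib ?Y"
  proof (rule faithful_fib_grothendieck)
    show "category (set_cat elts)" by (rule category_set_cat)
    fix N M u \<psi> assume u: "u \<in> hom (set_cat elts) N M" and ps: "\<psi> \<in> M \<rightarrow>\<^sub>E Pow (Ai i)"
    obtain f where f: "u = arr N f M" "f \<in> N \<rightarrow> M" by (rule homE[OF u])
    have "RP.RE u (i, \<psi>) \<in> RP.Pr N" using RP.RE_Pr[OF Pr_single[THEN iffD2, OF ps] f(2)] f(1) by simp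
    then show "snd (RP.RE u (i, \<psi>)) \<in> N \<rightarrow>\<^sub>E Pow (Ai i)" using Pr_single[of "snd (RP.RE u (i, \<psi>))" N] RE_single[of u \<psi>] by simp
  next
    fix M \<phi> assume "M \<in> Obj (set_cat elts)" "\<phi> \<in> M \<rightarrow>\<^sub>E Pow (Ai i)"
    then have P: "(i, \<phi>) \<in> RP.Pr M" using Pr_single by blast
    show "snd (RP.RE (Ident (set_cat elts) M) (i, \<phi>)) = \<phi>" using RP.RE_id[OF P] by simp
    show "RP.le M (i, \<phi>) (i, \<phi>)" using RP.le_refl[OF P] .
  next
    fix K N M u v \<phi> assume "v \<in> hom (set_cat elts) K N" "u \<in> hom (set_cat elts) N M"
    then show "snd (RP.RE (Comp (set_cat elts) u v) (i, \<phi>)) = snd (RP.RE v (i, snd (RP.RE u (i, \<phi>))))"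
      unfolding RE_single by (elim homE) (simp add: RP.RE_comp)
  next
    fix M \<phi> \<psi> \<theta> assume "\<phi> \<in> M \<rightarrow>\<^sub>E Pow (Ai i)" "\<psi> \<in> M \<rightarrow>\<^sub>E Pow (Ai i)" "\<theta> \<in> M \<rightarrow>\<^sub>E Pow (Ai i)"
      "RP.le M (i, \<phi>) (i, \<psi>)" "RP.le M (i, \<psi>) (i, \<theta>)"
    then show "RP.le M (i, \<phi>) (i, \<theta>)" using RP.le_trans Pr_single by blast
  next
    fix N M u \<phi> \<psi> assume "u \<in> hom (set_cat elts) N M" "RP.le M (i, \<phi>) (i, \<psi>)"
    then show "RP.le N (i, snd (RP.RE u (i, \<phi>))) (i, snd (RP.RE u (i, \<psi>)))"
      unfolding RE_single by (elim homE) (simp add: RP.RE_mono)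
  qed
  show ?thesis
    unfolding tripos_eq
  proof (rule fibered_equivalentI[where F = "\<lambda>x. (p x, snd (repr x))"])
    show "faithful_fib X" by unfold_locales
  next
    fix x u y assume xy: "x \<in> Obj (Total X)" "y \<in> Obj (Total X)"
    show "over X x u y \<longleftrightarrow> over ?Y (p x, snd (repr x)) u (p y, snd (repr y))"
      using over_repr[OF xy, of u] rP[OF xy(1)] rP[OF xy(2)] RE_single[of u "snd (repr y)"]
      unfolding over_grothendieck rr[OF xy(1)] rr[OF xy(2)] by simp
  next
    fix y :: "'v set \<times> ('v \<Rightarrow> 'v set)" assume "y \<in> Obj (Total ?Y)"
    then obtain M a where y: "y = (M, a)" "M \<in> U" "a \<in> M \<rightarrow>\<^sub>E Pow (Ai i)" by auto
    then have P: "(i, a) \<in> RP.Pr M" using Pr_single by blast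
    obtain x where x: "x \<in> fb M" "RP.le M (i, a) (repr x)" "RP.le M (repr x) (i, a)" by (rule repr_surj[OF y(2) P])
    have r: "repr x \<in> RP.Pr M" using repr_Pr[OF fbD(2)[OF x(1)]] fbD(1)[OF x(1)] by simp
    note rx' = rr[OF fbD(2)[OF x(1)]] rP[OF fbD(2)[OF x(1)]]
    show "\<exists>x\<in>Obj (Total X). p x = on_obj (Proj ?Y) y \<and>
       over ?Y y (Ident (Base ?Y) (on_obj (Proj ?Y) y)) (p x, snd (repr x)) \<and>
       over ?Y (p x, snd (repr x)) (Ident (Base ?Y) (on_obj (Proj ?Y) y)) y"
      using x r y P fbD[OF x(1)] rx'
      by (intro bexI[of _ x]) (simp_all add: over_grothendieck RE_single RP.RE_id)
  qed (use ff rP base proj_obj in auto)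
qed

end

end

section \<open>Logic of the realizability hyperdoctrine\<close>

context tp
begin

definition eqv :: "'v set \<Rightarrow> 'v \<times> ('v \<Rightarrow> 'v set) \<Rightarrow> 'v \<times> ('v \<Rightarrow> 'v set) \<Rightarrow> bool" where
  "eqv M a b \<longleftrightarrow> a \<in> Pr M \<and> b \<in> Pr M \<and> le M a b \<and> le M b a"

lemma eqv_refl: "a \<in> Pr M \<Longrightarrow> eqv M a a" by (simp add: eqv_def le_refl)
lemma eqv_sym: "eqv M a b \<Longrightarrow> eqv M b a" by (simp add: eqv_def)
lemma eqv_trans: "eqv M a b \<Longrightarrow> eqv M b c \<Longrightarrow> eqv M a c" unfolding eqv_def using le_trans by blast
lemma eqv_le: "eqv M a b \<Longrightarrow> eqv M c d \<Longrightarrow> le M a c \<longleftrightarrow> le M b d"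
  unfolding eqv_def using le_trans by blast

lemma eqvI: assumes "a \<in> Pr M" "b \<in> Pr M" "\<And>c. c \<in> Pr M \<Longrightarrow> le M c a \<longleftrightarrow> le M c b" shows "eqv M a b"
  using assms le_refl unfolding eqv_def by blast

lemma eqvI': assumes "a \<in> Pr M" "b \<in> Pr M" "\<And>c. c \<in> Pr M \<Longrightarrow> le M a c \<longleftrightarrow> le M b c" shows "eqv M a b"
  using assms le_refl unfolding eqv_def by blast

lemma eqv_RE: "eqv M a b \<Longrightarrow> u \<in> N \<rightarrow> M \<Longrightarrow> eqv N (RE (arr N u M) a) (RE (arr N u M) b)"
  unfolding eqv_def using RE_Pr RE_mono by blast

text \<open>Some type is inhabited: \<open>i \<rightharpoondown> i\<close> contains the identity,
  even if \<open>B i\<close> is empty.\<close>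

lemma t0_ex: "\<exists>t c. t \<in> J \<and> c \<in> B t"
  using T_ne id1 arrow_J by blast

definition t0 where "t0 = (SOME t. \<exists>c. t \<in> J \<and> c \<in> B t)"
definition c0 where "c0 = (SOME c. c \<in> B t0)"

lemma t0: "t0 \<in> J" "c0 \<in> B t0"
proof -
  have "\<exists>c. t0 \<in> J \<and> c \<in> B t0" unfolding t0_def by (rule someI_ex) (rule t0_ex)
  then show "t0 \<in> J" "c0 \<in> B t0" unfolding c0_def by (auto intro: someI_ex)
qed

section \<open>Connectives and quantifiers on realizability predicates\<close>

definition TT where "TT M = (t0, \<lambda>m\<in>M. {c0})"
definition MT where
  "MT M a b = (tprod T (fst a) (fst b), \<lambda>m\<in>M. {PR (fst a) (fst b) x y | x y. x \<in> snd a m \<and> y \<in> snd b m})"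
definition IM where
  "IM M a b = (fst a \<rightharpoondown> fst b, \<lambda>m\<in>M. {e \<in> B (fst a \<rightharpoondown> fst b). \<forall>x\<in>snd a m. \<exists>y\<in>snd b m. ap (fst a) (fst b) e x = Some y})"
definition SX where
  "SX N u M a = (fst a, \<lambda>m\<in>M. \<Union>n\<in>{n \<in> N. u n = m}. snd a n)"
text \<open>
  Over points outside the image of \<open>u\<close> a realizer of \<open>u\<^sup>*b \<le> a\<close> may diverge; suspending it by a dummy
  argument of type \<open>t0\<close> makes it a total map into \<open>AL\<close>.
\<close>

definition AL where
  "AL N u M a = (t0 \<rightharpoondown> fst a, \<lambda>m\<in>M. {e \<in> B (t0 \<rightharpoondown> fst a).
     \<forall>n\<in>N. u n = m \<longrightarrow> (\<forall>c\<in>B t0. \<exists>y\<in>snd a n. ap t0 (fst a) e c = Some y)})"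

lemma TT_Pr: "TT M \<in> Pr M" using t0 by (simp add: TT_def Pr_def)

lemma MT_Pr: "a \<in> Pr M \<Longrightarrow> b \<in> Pr M \<Longrightarrow> MT M a b \<in> Pr M"
  using PR_B Pr_B[of a M] Pr_B[of b M] Pr_J[of a M] Pr_J[of b M] unfolding MT_def by (fastforce simp: Pr_def)

lemma IM_Pr: "a \<in> Pr M \<Longrightarrow> b \<in> Pr M \<Longrightarrow> IM M a b \<in> Pr M"
  using Pr_J[of a M] Pr_J[of b M] unfolding IM_def by (auto simp: Pr_def)

lemma SX_Pr: "a \<in> Pr N \<Longrightarrow> SX N u M a \<in> Pr M"
  using Pr_B[of a N] Pr_J[of a N] unfolding SX_def by (fastforce simp: Pr_def)

lemma AL_Pr: "a \<in> Pr N \<Longrightarrow> AL N u M a \<in> Pr M"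
  using Pr_J[of a N] t0(1) unfolding AL_def by (auto simp: Pr_def)

lemma TT_top: assumes "a \<in> Pr M" shows "le M a (TT M)"
proof -
  obtain c where "c \<in> B (fst a \<rightharpoondown> t0)" "\<forall>y\<in>B (fst a). ap (fst a) t0 c y = Some c0"
    using const1[OF t0(1) Pr_J[OF assms] t0(2)] by blast
  then show ?thesis unfolding le_def TT_def using Pr_B[OF assms] by (intro bexI[of _ c]) auto
qed

lemma MT_le:
  assumes P: "a \<in> Pr M" "b \<in> Pr M" "c \<in> Pr M"
  shows "le M c (MT M a b) \<longleftrightarrow> le M c a \<and> le M c b"
proof -
  let ?i = "fst a" and ?j = "fst b" and ?l = "fst c"
  let ?p = "tprod T ?i ?j"
  note J = P[THEN Pr_J]
  obtain pr fs sn where f: "fs \<in> B (?p \<rightharpoondown> ?i)" "sn \<in> B (?p \<rightharpoondown> ?j)"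
    "\<And>x y. x \<in> B ?i \<Longrightarrow> y \<in> B ?j \<Longrightarrow> ap ?p ?i fs (PR ?i ?j x y) = Some x"
    "\<And>x y. x \<in> B ?i \<Longrightarrow> y \<in> B ?j \<Longrightarrow> ap ?p ?j sn (PR ?i ?j x y) = Some y"
    by (rule PR[OF J(1,2)]) blast
  have "le M (MT M a b) a"
    unfolding le_def MT_def using f Pr_B[OF P(1)] Pr_B[OF P(2)] by (intro bexI[of _ fs]) auto
  moreover have "le M (MT M a b) b"
    unfolding le_def MT_def using f Pr_B[OF P(1)] Pr_B[OF P(2)] by (intro bexI[of _ sn]) auto
  moreover have "le M c (MT M a b)" if "le M c a" "le M c b"
  proof -
    obtain e where e: "e \<in> B (?l \<rightharpoondown> ?i)" "\<forall>m\<in>M. \<forall>x\<in>snd c m. \<exists>y\<in>snd a m. ap ?l ?i e x = Some y"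
      using \<open>le M c a\<close> unfolding le_def by blast
    obtain d where d: "d \<in> B (?l \<rightharpoondown> ?j)" "\<forall>m\<in>M. \<forall>x\<in>snd c m. \<exists>y\<in>snd b m. ap ?l ?j d x = Some y"
      using \<open>le M c b\<close> unfolding le_def by blast
    obtain g where g: "g \<in> B (?l \<rightharpoondown> ?p)" "\<forall>z\<in>B ?l. \<forall>x y. ap ?l ?i e z = Some x \<longrightarrow> ap ?l ?j d z = Some y \<longrightarrow>
       ap ?l ?p g z = Some (PR ?i ?j x y)" using pair1[OF J(3,1,2) e(1) d(1)] by blast
    have "\<exists>y\<in>snd (MT M a b) m. ap ?l ?p g x = Some y" if m: "m \<in> M" and x: "x \<in> snd c m" for m x
    proof -
      obtain y where y: "y \<in> snd a m" "ap ?l ?i e x = Some y" using e(2) m x by blast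
      obtain z where z: "z \<in> snd b m" "ap ?l ?j d x = Some z" using d(2) m x by blast
      have "ap ?l ?p g x = Some (PR ?i ?j y z)" using g(2) Pr_B[OF P(3) m x] y(2) z(2) by blast
      then show ?thesis using y(1) z(1) m by (auto simp: MT_def)
    qed
    then show ?thesis unfolding le_def using g(1) by (intro bexI[of _ g]) (auto simp: MT_def)
  qed
  ultimately show ?thesis using le_trans[OF P(3) MT_Pr[OF P(1,2)]] P by blast
qed

lemma IM_le:
  assumes P: "a \<in> Pr M" "b \<in> Pr M" "c \<in> Pr M"
  shows "le M c (IM M a b) \<longleftrightarrow> le M (MT M c a) b"
proof -
  let ?i = "fst a" and ?j = "fst b" and ?l = "fst c"
  let ?p = "tprod T ?l ?i"
  note J = P[THEN Pr_J]
  have p: "?p \<in> J" using J by simp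
  show ?thesis
  proof
    assume "le M c (IM M a b)"
    then obtain e where e: "e \<in> B (?l \<rightharpoondown> ?i \<rightharpoondown> ?j)"
      "\<And>m x. m \<in> M \<Longrightarrow> x \<in> snd c m \<Longrightarrow> \<exists>y. ap ?l (?i \<rightharpoondown> ?j) e x = Some y \<and> (\<forall>z\<in>snd a m. \<exists>w\<in>snd b m. ap ?i ?j y z = Some w)"
      unfolding le_def IM_def by fastforce
    obtain pr fs sn where f: "fs \<in> B (?p \<rightharpoondown> ?l)" "sn \<in> B (?p \<rightharpoondown> ?i)"
      "\<And>x y. x \<in> B ?l \<Longrightarrow> y \<in> B ?i \<Longrightarrow> PR ?l ?i x y \<in> B ?p"
      "\<And>x y. x \<in> B ?l \<Longrightarrow> y \<in> B ?i \<Longrightarrow> ap ?p ?l fs (PR ?l ?i x y) = Some x"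
      "\<And>x y. x \<in> B ?l \<Longrightarrow> y \<in> B ?i \<Longrightarrow> ap ?p ?i sn (PR ?l ?i x y) = Some y"
      by (rule PR[OF J(3,1)]) blast
    obtain c1 where c1: "c1 \<in> B (?p \<rightharpoondown> ?i \<rightharpoondown> ?j)"
      "\<forall>z\<in>B ?p. \<forall>y r. ap ?p ?l fs z = Some y \<longrightarrow> ap ?l (?i \<rightharpoondown> ?j) e y = Some r \<longrightarrow> ap ?p (?i \<rightharpoondown> ?j) c1 z = Some r"
      using comp1[OF p J(3) arrow_J[OF J(1,2)] f(1) e(1)] by blast
    obtain d where d: "d \<in> B (?p \<rightharpoondown> ?j)" "\<forall>z\<in>B ?p. \<forall>u v r. ap ?p (?i \<rightharpoondown> ?j) c1 z = Some u \<longrightarrow> ap ?p ?i sn z = Some v \<longrightarrow>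
      ap ?i ?j u v = Some r \<longrightarrow> ap ?p ?j d z = Some r" using app1[OF p J(1,2) c1(1) f(2)] by blast
    have "\<exists>w\<in>snd b m. ap ?p ?j d (PR ?l ?i x y) = Some w" if m: "m \<in> M" and x: "x \<in> snd c m" and y: "y \<in> snd a m" for m x y
    proof -
      obtain v w where v: "ap ?l (?i \<rightharpoondown> ?j) e x = Some v" "w \<in> snd b m" "ap ?i ?j v y = Some w" using e(2)[OF m x] y by blast
      have xy: "x \<in> B ?l" "y \<in> B ?i" using Pr_B P m x y by blast+
      have "ap ?p (?i \<rightharpoondown> ?j) c1 (PR ?l ?i x y) = Some v" using c1(2) f(3,4)[OF xy] v(1) by blast
      then have "ap ?p ?j d (PR ?l ?i x y) = Some w" using d(2) f(3,5)[OF xy] v(3) by blast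
      then show ?thesis using v(2) by blast
    qed
    then show "le M (MT M c a) b" unfolding le_def MT_def using d(1) by (intro bexI[of _ d]) auto
  next
    assume "le M (MT M c a) b"
    then obtain e where e: "e \<in> B (?p \<rightharpoondown> ?j)"
      "\<And>m x y. m \<in> M \<Longrightarrow> x \<in> snd c m \<Longrightarrow> y \<in> snd a m \<Longrightarrow> \<exists>w\<in>snd b m. ap ?p ?j e (PR ?l ?i x y) = Some w"
      unfolding le_def MT_def by fastforce
    \<comment> \<open>Where \<open>a m\<close> is empty nothing has to be computed, yet a realizer
      of the implication must be returned for every \<open>x\<close>; this is the totality built
      into \<open>cur\<close>.\<close>
    have "cur ?l ?i ?j (\<lambda>x y. papp (ap ?p ?j) (Some e) (if x \<in> B ?l \<and> y \<in> B ?i then Some (PR ?l ?i x y) else None))"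
      using J p e(1) by (intro cur_app cur_const cur_pair) simp_all
    then obtain d where d: "d \<in> B (?l \<rightharpoondown> ?i \<rightharpoondown> ?j)" "\<And>x. x \<in> B ?l \<Longrightarrow> \<exists>e'\<in>B (?i \<rightharpoondown> ?j). ap ?l (?i \<rightharpoondown> ?j) d x = Some e' \<and>
     (\<forall>y\<in>B ?i. \<forall>r. papp (ap ?p ?j) (Some e) (if x \<in> B ?l \<and> y \<in> B ?i then Some (PR ?l ?i x y) else None) = Some r \<longrightarrow> ap ?i ?j e' y = Some r)"
      unfolding cur_def by blast
    have "\<exists>e'\<in>snd (IM M a b) m. ap ?l (?i \<rightharpoondown> ?j) d x = Some e'" if m: "m \<in> M" and x: "x \<in> snd c m" for m x
    proof -
      have xB: "x \<in> B ?l" using Pr_B[OF P(3) m x] .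
      obtain e' where e': "e' \<in> B (?i \<rightharpoondown> ?j)" "ap ?l (?i \<rightharpoondown> ?j) d x = Some e'"
       "\<forall>y\<in>B ?i. \<forall>r. papp (ap ?p ?j) (Some e) (if x \<in> B ?l \<and> y \<in> B ?i then Some (PR ?l ?i x y) else None) = Some r \<longrightarrow> ap ?i ?j e' y = Some r"
        using d(2)[OF xB] by blast
      have "\<exists>w\<in>snd b m. ap ?i ?j e' y = Some w" if y: "y \<in> snd a m" for y
      proof -
        have yB: "y \<in> B ?i" using Pr_B[OF P(1) m y] .
        obtain w where w: "w \<in> snd b m" "ap ?p ?j e (PR ?l ?i x y) = Some w" using e(2)[OF m x y] by blast
        then have "ap ?i ?j e' y = Some w" using e'(3) xB yB by (simp add: papp_def)
        then show ?thesis using w(1) by blast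
      qed
      then show ?thesis using e'(1,2) m by (auto simp: IM_def)
    qed
    then show "le M c (IM M a b)" unfolding le_def using d(1) by (intro bexI[of _ d]) (auto simp: IM_def)
  qed
qed

lemma SX_le: assumes u: "u \<in> N \<rightarrow> M" shows "le M (SX N u M a) b \<longleftrightarrow> le N a (RE (arr N u M) b)"
proof -
  have "(\<forall>m\<in>M. \<forall>x\<in>snd (SX N u M a) m. Q m x) \<longleftrightarrow> (\<forall>n\<in>N. \<forall>x\<in>snd a n. Q (u n) x)" for Q
    using u unfolding SX_def by (simp add: Pi_iff) blast
  then show ?thesis by (simp add: le_def RE_arr SX_def)
qed

lemma AL_le:
  assumes P: "a \<in> Pr N" "b \<in> Pr M" and u: "u \<in> N \<rightarrow> M"
  shows "le M b (AL N u M a) \<longleftrightarrow> le N (RE (arr N u M) b) a"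
proof -
  let ?i = "fst a" and ?l = "fst b"
  note J = P[THEN Pr_J]
  show ?thesis
  proof
    assume "le M b (AL N u M a)"
    then obtain e where e: "e \<in> B (?l \<rightharpoondown> t0 \<rightharpoondown> ?i)"
      "\<And>n x. n \<in> N \<Longrightarrow> x \<in> snd b (u n) \<Longrightarrow> \<exists>y. ap ?l (t0 \<rightharpoondown> ?i) e x = Some y \<and> (\<forall>c\<in>B t0. \<exists>w\<in>snd a n. ap t0 ?i y c = Some w)"
      using u unfolding le_def AL_def by (fastforce simp: Pi_iff)
    \<comment> \<open>The dummy argument is discharged by feeding it the constant
      \<open>c0\<close>.\<close>
    obtain k where k: "k \<in> B (?l \<rightharpoondown> t0)" "\<forall>y\<in>B ?l. ap ?l t0 k y = Some c0" using const1[OF t0(1) J(2) t0(2)] by blast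
    obtain d where d: "d \<in> B (?l \<rightharpoondown> ?i)" "\<forall>z\<in>B ?l. \<forall>v w r. ap ?l (t0 \<rightharpoondown> ?i) e z = Some v \<longrightarrow> ap ?l t0 k z = Some w \<longrightarrow>
      ap t0 ?i v w = Some r \<longrightarrow> ap ?l ?i d z = Some r" using app1[OF J(2) t0(1) J(1) e(1) k(1)] by blast
    have "\<exists>w\<in>snd a n. ap ?l ?i d x = Some w" if n: "n \<in> N" and x: "x \<in> snd b (u n)" for n x
    proof -
      obtain v w where v: "ap ?l (t0 \<rightharpoondown> ?i) e x = Some v" "w \<in> snd a n" "ap t0 ?i v c0 = Some w" using e(2)[OF n x] t0(2) by blast
      have "x \<in> B ?l" using Pr_B[OF P(2) _ x] n u by blast
      then show ?thesis using d(2) k(2) v by blast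
    qed
    then show "le N (RE (arr N u M) b) a" unfolding le_def RE_arr using d(1) by (intro bexI[of _ d]) auto
  next
    assume "le N (RE (arr N u M) b) a"
    then obtain e where e: "e \<in> B (?l \<rightharpoondown> ?i)" "\<And>n x. n \<in> N \<Longrightarrow> x \<in> snd b (u n) \<Longrightarrow> \<exists>w\<in>snd a n. ap ?l ?i e x = Some w"
      unfolding le_def RE_arr by auto
    \<comment> \<open>The term \<open>e x\<close>, suspended. Over points outside the image of
      \<open>u\<close> it may be undefined, but its suspension is not.\<close>
    have "cur ?l t0 ?i (\<lambda>x y. papp (ap ?l ?i) (Some e) (Some x))"
      using J t0(1) e(1) by (intro cur_app cur_const cur_fst) simp_all
    then obtain d where d: "d \<in> B (?l \<rightharpoondown> t0 \<rightharpoondown> ?i)" "\<And>x. x \<in> B ?l \<Longrightarrow> \<exists>e'\<in>B (t0 \<rightharpoondown> ?i). ap ?l (t0 \<rightharpoondown> ?i) d x = Some e' \<and>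
     (\<forall>y\<in>B t0. \<forall>r. ap ?l ?i e x = Some r \<longrightarrow> ap t0 ?i e' y = Some r)"
      unfolding cur_def by (auto simp: papp_def)
    have "\<exists>e'\<in>snd (AL N u M a) m. ap ?l (t0 \<rightharpoondown> ?i) d x = Some e'" if m: "m \<in> M" and x: "x \<in> snd b m" for m x
    proof -
      obtain e' where e': "e' \<in> B (t0 \<rightharpoondown> ?i)" "ap ?l (t0 \<rightharpoondown> ?i) d x = Some e'"
        "\<forall>y\<in>B t0. \<forall>r. ap ?l ?i e x = Some r \<longrightarrow> ap t0 ?i e' y = Some r" using d(2)[OF Pr_B[OF P(2) m x]] by blast
      then have "e' \<in> snd (AL N u M a) m" using m e(2) x by (fastforce simp: AL_def)
      then show ?thesis using e'(2) by blast
    qed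
    then show "le M b (AL N u M a)" unfolding le_def using d(1) by (intro bexI[of _ d]) (auto simp: AL_def)
  qed
qed

lemma RE_TT: "u \<in> N \<rightarrow> M \<Longrightarrow> RE (arr N u M) (TT M) = TT N"
  unfolding RE_arr TT_def by (auto simp: Pi_iff intro!: restrict_ext)

lemma RE_MT: "u \<in> N \<rightarrow> M \<Longrightarrow> RE (arr N u M) (MT M a b) = MT N (RE (arr N u M) a) (RE (arr N u M) b)"
  unfolding RE_arr MT_def by (simp add: Pi_iff cong: restrict_cong)

lemma RE_IM: "u \<in> N \<rightarrow> M \<Longrightarrow> RE (arr N u M) (IM M a b) = IM N (RE (arr N u M) a) (RE (arr N u M) b)"
  unfolding RE_arr IM_def by (auto simp: Pi_iff intro!: restrict_ext)

text \<open>Beck-Chevalley holds as an equation, since unions and reindexings are computed point by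
  point; \<open>RE_AL\<close> is the analogue for \<forall>.\<close>

lemma RE_SX:
  assumes f: "u \<in> N \<rightarrow> M" "v \<in> K \<rightarrow> M" "q \<in> Z \<rightarrow> N" "r \<in> Z \<rightarrow> K"
    and c: "\<And>z. z \<in> Z \<Longrightarrow> u (q z) = v (r z)"
    and e: "\<And>n k. n \<in> N \<Longrightarrow> k \<in> K \<Longrightarrow> u n = v k \<Longrightarrow> \<exists>z\<in>Z. q z = n \<and> r z = k"
  shows "RE (arr K v M) (SX N u M a) = SX Z r K (RE (arr Z q N) a)"
proof -
  have "(\<Union>n\<in>{n \<in> N. u n = v k}. snd a n) = (\<Union>z\<in>{z \<in> Z. r z = k}. snd a (q z))" if k: "k \<in> K" for k
  proof
    show "(\<Union>n\<in>{n \<in> N. u n = v k}. snd a n) \<subseteq> (\<Union>z\<in>{z \<in> Z. r z = k}. snd a (q z))"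
      using e[OF _ k] by fastforce
    show "(\<Union>z\<in>{z \<in> Z. r z = k}. snd a (q z)) \<subseteq> (\<Union>n\<in>{n \<in> N. u n = v k}. snd a n)"
      using c f(3) by (fastforce simp: Pi_iff)
  qed
  then show ?thesis unfolding RE_arr SX_def using f by (auto simp: Pi_iff intro!: restrict_ext)
qed

lemma RE_AL:
  assumes f: "u \<in> N \<rightarrow> M" "v \<in> K \<rightarrow> M" "q \<in> Z \<rightarrow> N" "r \<in> Z \<rightarrow> K"
    and c: "\<And>z. z \<in> Z \<Longrightarrow> u (q z) = v (r z)"
    and e: "\<And>n k. n \<in> N \<Longrightarrow> k \<in> K \<Longrightarrow> u n = v k \<Longrightarrow> \<exists>z\<in>Z. q z = n \<and> r z = k"
  shows "RE (arr K v M) (AL N u M a) = AL Z r K (RE (arr Z q N) a)"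
proof -
  have "(\<forall>n\<in>N. u n = v k \<longrightarrow> (\<forall>x\<in>B t0. \<exists>y\<in>snd a n. ap t0 (fst a) d x = Some y)) \<longleftrightarrow>
    (\<forall>z\<in>Z. r z = k \<longrightarrow> (\<forall>x\<in>B t0. \<exists>y\<in>snd a (q z). ap t0 (fst a) d x = Some y))"
    (is "(\<forall>n\<in>N. _ \<longrightarrow> ?Q n) \<longleftrightarrow> _") if k: "k \<in> K" for k d
  proof
    assume h: "\<forall>n\<in>N. u n = v k \<longrightarrow> ?Q n"
    show "\<forall>z\<in>Z. r z = k \<longrightarrow> ?Q (q z)"
    proof (rule ballI, rule impI)
      fix z assume z: "z \<in> Z" "r z = k"
      then have "q z \<in> N" "u (q z) = v k" using f(3) c by auto
      then show "?Q (q z)" using h by blast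
    qed
  next
    assume h: "\<forall>z\<in>Z. r z = k \<longrightarrow> ?Q (q z)"
    show "\<forall>n\<in>N. u n = v k \<longrightarrow> ?Q n"
    proof (rule ballI, rule impI)
      fix n assume "n \<in> N" "u n = v k"
      then obtain z where "z \<in> Z" "q z = n" "r z = k" using e[OF _ k] by blast
      then show "?Q n" using h by blast
    qed
  qed
  then show ?thesis unfolding RE_arr AL_def using f by (auto simp: Pi_iff intro!: restrict_ext)
qed

lemma MT_cong: "eqv M a a' \<Longrightarrow> eqv M b b' \<Longrightarrow> eqv M (MT M a b) (MT M a' b')"
  by (rule eqvI) (auto simp: eqv_def MT_le intro: MT_Pr le_trans)

lemma IM_cong:
  assumes "eqv M a a'" "eqv M b b'" shows "eqv M (IM M a b) (IM M a' b')"
proof (rule eqvI)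
  have P: "a \<in> Pr M" "a' \<in> Pr M" "b \<in> Pr M" "b' \<in> Pr M" using assms by (auto simp: eqv_def)
  then show "IM M a b \<in> Pr M" "IM M a' b' \<in> Pr M" using IM_Pr by blast+
  fix c assume c: "c \<in> Pr M"
  show "le M c (IM M a b) \<longleftrightarrow> le M c (IM M a' b')"
    unfolding IM_le[OF P(1,3) c] IM_le[OF P(2,4) c]
    by (rule eqv_le[OF MT_cong[OF eqv_refl[OF c] assms(1)] assms(2)])
qed

lemma SX_cong: assumes "eqv N a a'" "u \<in> N \<rightarrow> M" shows "eqv M (SX N u M a) (SX N u M a')"
  by (rule eqvI') (use assms SX_Pr in \<open>auto simp: eqv_def SX_le intro: le_trans RE_Pr\<close>)

lemma AL_cong: assumes "eqv N a a'" "u \<in> N \<rightarrow> M" shows "eqv M (AL N u M a) (AL N u M a')"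
proof (rule eqvI)
  have P: "a \<in> Pr N" "a' \<in> Pr N" using assms by (auto simp: eqv_def)
  then show "AL N u M a \<in> Pr M" "AL N u M a' \<in> Pr M" using AL_Pr by blast+
  fix c assume c: "c \<in> Pr M"
  show "le M c (AL N u M a) \<longleftrightarrow> le M c (AL N u M a')"
    unfolding AL_le[OF P(1) c assms(2)] AL_le[OF P(2) c assms(2)]
    by (rule eqv_le[OF eqv_refl[OF RE_Pr[OF c assms(2)]] assms(1)])
qed

end

text \<open>An equivalence with the realizability hyperdoctrine, reduced to its effect on
  predicates: \<open>R\<close> respects and reflects the order along functions and is surjective up
  to \<open>eqv\<close>. The structure of \<open>Pr\<close> is carried to \<open>X\<close> along
  \<open>R\<close>.\<close>

locale represented = set_fib elts X + tp elts T
  for elts :: "'v \<Rightarrow> 'v set" and X :: "('o, 'a, 'v) setfib" and T :: "'v tpca" +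
  fixes R :: "'o \<Rightarrow> 'v \<times> ('v \<Rightarrow> 'v set)"
  assumes R_Pr: "x \<in> fb M \<Longrightarrow> R x \<in> Pr M"
    and R_L: "x \<in> fb N \<Longrightarrow> y \<in> fb M \<Longrightarrow> f \<in> N \<rightarrow> M \<Longrightarrow> L x f y \<longleftrightarrow> le N (R x) (RE (arr N f M) (R y))"
    and R_surj: "M \<in> U \<Longrightarrow> a \<in> Pr M \<Longrightarrow> \<exists>x\<in>fb M. eqv M (R x) a"
begin

lemma R_fle: "x \<in> fb M \<Longrightarrow> y \<in> fb M \<Longrightarrow> fle X x y \<longleftrightarrow> le M (R x) (R y)"
  using R_L[of x M y M "\<lambda>a. a"] RE_id[OF R_Pr] by (simp add: fle_L)

lemma R_fiso: "x \<in> fb M \<Longrightarrow> y \<in> fb M \<Longrightarrow> fiso X x y \<longleftrightarrow> eqv M (R x) (R y)"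
  using R_fle R_Pr by (auto simp: fiso_def eqv_def)

text \<open>The transport principle: a predicate with a universal property for maps into it is
  recognized by its value under \<open>R\<close>. Surjectivity supplies a test predicate equivalent
  to \<open>a\<close>. \<open>R_lower\<close> is the dual.\<close>

lemma R_upper:
  assumes x: "x \<in> fb M" and a: "a \<in> Pr M"
  shows "(\<forall>y\<in>fb M. fle X y x \<longleftrightarrow> le M (R y) a) \<longleftrightarrow> eqv M (R x) a"
proof
  assume h: "\<forall>y\<in>fb M. fle X y x \<longleftrightarrow> le M (R y) a"
  obtain y where y: "y \<in> fb M" "eqv M (R y) a" using R_surj[OF fbD(3)[OF x] a] by blast
  have "le M (R x) a" using h x R_fle[OF x x] le_refl[OF R_Pr[OF x]] by blast
  moreover have "le M (R y) (R x)" using h y R_fle[OF y(1) x] by (auto simp: eqv_def)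
  ultimately show "eqv M (R x) a"
    using y(2) R_Pr[OF x] a le_trans[OF a R_Pr[OF y(1)] R_Pr[OF x]] by (auto simp: eqv_def)
next
  assume e: "eqv M (R x) a"
  show "\<forall>y\<in>fb M. fle X y x \<longleftrightarrow> le M (R y) a"
    using R_fle[OF _ x] eqv_le[OF eqv_refl[OF R_Pr] e] by blast
qed

lemma R_lower:
  assumes x: "x \<in> fb M" and a: "a \<in> Pr M"
  shows "(\<forall>y\<in>fb M. fle X x y \<longleftrightarrow> le M a (R y)) \<longleftrightarrow> eqv M (R x) a"
proof
  assume h: "\<forall>y\<in>fb M. fle X x y \<longleftrightarrow> le M a (R y)"
  obtain y where y: "y \<in> fb M" "eqv M (R y) a" using R_surj[OF fbD(3)[OF x] a] by blast
  have "le M a (R x)" using h x R_fle[OF x x] le_refl[OF R_Pr[OF x]] by blast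
  moreover have "le M (R x) (R y)" using h y R_fle[OF x y(1)] by (auto simp: eqv_def)
  ultimately show "eqv M (R x) a"
    using y(2) R_Pr[OF x] a le_trans[OF R_Pr[OF x] R_Pr[OF y(1)] a] by (auto simp: eqv_def)
next
  assume e: "eqv M (R x) a"
  show "\<forall>y\<in>fb M. fle X x y \<longleftrightarrow> le M a (R y)"
    using R_fle[OF x] eqv_le[OF e eqv_refl[OF R_Pr]] by blast
qed

lemma R_rx:
  assumes y: "y \<in> fb M" and N: "N \<in> U" and u: "u \<in> N \<rightarrow> M"
  shows "eqv N (R (rx N u y)) (RE (arr N u M) (R y))"
proof -
  have "\<forall>z\<in>fb N. fle X z (rx N u y) \<longleftrightarrow> le N (R z) (RE (arr N u M) (R y))"
    using fle_rx[OF _ y u] R_L[OF _ y u] by blast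
  then show ?thesis using R_upper[OF rx_fb[OF y N u] RE_Pr[OF R_Pr[OF y] u]] by blast
qed

lemma is_truth_R: "M \<in> U \<Longrightarrow> is_truth X M \<tau> \<longleftrightarrow> \<tau> \<in> fb M \<and> eqv M (R \<tau>) (TT M)"
proof (cases "\<tau> \<in> fb M")
  case True
  then show ?thesis using R_upper[OF True TT_Pr] TT_top[OF R_Pr] by (simp add: is_truth_def)
qed (simp add: is_truth_def)

lemma is_meet_R:
  assumes "\<phi> \<in> fb M" "\<psi> \<in> fb M"
  shows "is_meet X M \<phi> \<psi> \<mu> \<longleftrightarrow> \<mu> \<in> fb M \<and> eqv M (R \<mu>) (MT M (R \<phi>) (R \<psi>))"
proof (cases "\<mu> \<in> fb M")
  case True
  then show ?thesis
    using R_upper[OF True MT_Pr[OF R_Pr[OF assms(1)] R_Pr[OF assms(2)]]] MT_le[OF R_Pr[OF assms(1)] R_Pr[OF assms(2)] R_Pr]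
      R_fle[OF _ assms(1)] R_fle[OF _ assms(2)] by (simp add: is_meet_def)
qed (simp add: is_meet_def)

lemma is_imp_R:
  assumes "\<phi> \<in> fb M" "\<psi> \<in> fb M"
  shows "is_imp X M \<phi> \<psi> \<mu> \<longleftrightarrow> \<mu> \<in> fb M \<and> eqv M (R \<mu>) (IM M (R \<phi>) (R \<psi>))"
proof (cases "\<mu> \<in> fb M")
  case True
  note P = R_Pr[OF assms(1)] R_Pr[OF assms(2)]
  have M: "M \<in> U" using fbD(3)[OF True] .
  \<comment> \<open>\<open>is_imp\<close> quantifies over all representatives of the meet; they are
    equivalent, and at least one exists.\<close>
  have "(\<forall>\<nu>. is_meet X M \<theta> \<phi> \<nu> \<longrightarrow> (fle X \<theta> \<mu> \<longleftrightarrow> fle X \<nu> \<psi>)) \<longleftrightarrow> (fle X \<theta> \<mu> \<longleftrightarrow> le M (R \<theta>) (IM M (R \<phi>) (R \<psi>)))"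
    if t: "\<theta> \<in> fb M" for \<theta>
  proof -
    have f: "fle X \<nu> \<psi> \<longleftrightarrow> le M (R \<theta>) (IM M (R \<phi>) (R \<psi>))" if "is_meet X M \<theta> \<phi> \<nu>" for \<nu>
      using that R_fle[OF _ assms(2), of \<nu>] eqv_le[OF _ eqv_refl[OF P(2)], of "R \<nu>"]
      unfolding IM_le[OF P R_Pr[OF t]] is_meet_R[OF t assms(1)] by blast
    obtain \<nu> where "is_meet X M \<theta> \<phi> \<nu>"
      using R_surj[OF M MT_Pr[OF R_Pr[OF t] P(1)]] is_meet_R[OF t assms(1)] by blast
    then show ?thesis using f by blast
  qed
  then show ?thesis using R_upper[OF True IM_Pr[OF P]] True unfolding is_imp_def by blast
qed (simp add: is_imp_def)

lemma is_ex_R: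
  assumes ph: "\<phi> \<in> fb N" and u: "u \<in> N \<rightarrow> M"
  shows "is_ex X (arr N u M) \<phi> \<epsilon> \<longleftrightarrow> \<epsilon> \<in> fb M \<and> eqv M (R \<epsilon>) (SX N u M (R \<phi>))"
proof (cases "\<epsilon> \<in> fb M")
  case True
  have "fle X \<phi> (reindex X (arr N u M) \<psi>) \<longleftrightarrow> le M (SX N u M (R \<phi>)) (R \<psi>)" if "\<psi> \<in> fb M" for \<psi>
    using R_L[OF ph that u] fle_rx[OF ph that u] SX_le[OF u] reindex_rx[OF that] by simp
  then show ?thesis using R_lower[OF True SX_Pr[OF R_Pr[OF ph]]] True base unfolding is_ex_def by simp
qed (simp add: is_ex_def base)

lemma is_all_R:
  assumes ph: "\<phi> \<in> fb N" and u: "u \<in> N \<rightarrow> M"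
  shows "is_all X (arr N u M) \<phi> \<epsilon> \<longleftrightarrow> \<epsilon> \<in> fb M \<and> eqv M (R \<epsilon>) (AL N u M (R \<phi>))"
proof (cases "\<epsilon> \<in> fb M")
  case True
  have N: "N \<in> U" using fbD(3)[OF ph] .
  have "fle X (reindex X (arr N u M) \<psi>) \<phi> \<longleftrightarrow> le M (R \<psi>) (AL N u M (R \<phi>))" if p: "\<psi> \<in> fb M" for \<psi>
    using R_fle[OF rx_fb[OF p N u] ph] eqv_le[OF R_rx[OF p N u] eqv_refl[OF R_Pr[OF ph]]]
      AL_le[OF R_Pr[OF ph] R_Pr[OF p] u] reindex_rx[OF p] by simp
  then show ?thesis using R_upper[OF True AL_Pr[OF R_Pr[OF ph]]] True base unfolding is_all_def by simp
qed (simp add: is_all_def base)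

lemma ex_R:
  assumes ph: "\<phi> \<in> fb N" and u: "u \<in> N \<rightarrow> M" and M: "M \<in> U"
  shows "ex X (arr N u M) \<phi> \<in> fb M" "eqv M (R (ex X (arr N u M) \<phi>)) (SX N u M (R \<phi>))"
proof -
  have "\<exists>\<epsilon>. is_ex X (arr N u M) \<phi> \<epsilon>"
    using R_surj[OF M SX_Pr[OF R_Pr[OF ph]]] is_ex_R[OF ph u] by blast
  from someI_ex[OF this, folded ex_def] show "ex X (arr N u M) \<phi> \<in> fb M" "eqv M (R (ex X (arr N u M) \<phi>)) (SX N u M (R \<phi>))"
    unfolding is_ex_R[OF ph u] by auto
qed

lemma all_R:
  assumes ph: "\<phi> \<in> fb N" and u: "u \<in> N \<rightarrow> M" and M: "M \<in> U"
  shows "univ X (arr N u M) \<phi> \<in> fb M" "eqv M (R (univ X (arr N u M) \<phi>)) (AL N u M (R \<phi>))"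
proof -
  have "\<exists>\<epsilon>. is_all X (arr N u M) \<phi> \<epsilon>"
    using R_surj[OF M AL_Pr[OF R_Pr[OF ph]]] is_all_R[OF ph u] by blast
  from someI_ex[OF this, folded univ_def] show "univ X (arr N u M) \<phi> \<in> fb M" "eqv M (R (univ X (arr N u M) \<phi>)) (AL N u M (R \<phi>))"
    unfolding is_all_R[OF ph u] by auto
qed

text \<open>An abstract pullback square becomes a pair of elementwise conditions. The element over a
  compatible pair comes from the universal property at the one-element set.\<close>

lemma pullbackE:
  assumes "is_pullback (set_cat elts) p' q' u' v'"
  obtains Z N K M q r u v where "p' = arr Z q N" "q' = arr Z r K" "u' = arr N u M" "v' = arr K v M"
    "Z \<in> U" "N \<in> U" "K \<in> U" "M \<in> U"
    "q \<in> Z \<rightarrow> N" "r \<in> Z \<rightarrow> K" "u \<in> N \<rightarrow> M" "v \<in> K \<rightarrow> M"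
    "\<And>z. z \<in> Z \<Longrightarrow> u (q z) = v (r z)"
    "\<And>n k. n \<in> N \<Longrightarrow> k \<in> K \<Longrightarrow> u n = v k \<Longrightarrow> \<exists>z\<in>Z. q z = n \<and> r z = k"
proof -
  note P = assms[unfolded is_pullback_def]
  have h: "f \<in> hom (set_cat elts) (Dom (set_cat elts) f) (Cod (set_cat elts) f)" if "f \<in> Arr (set_cat elts)" for f
    using that by (simp add: hom_def)
  obtain q where q: "p' = arr (Dom (set_cat elts) p') q (Dom (set_cat elts) u')" "Dom (set_cat elts) p' \<in> U"
    "q \<in> Dom (set_cat elts) p' \<rightarrow> Dom (set_cat elts) u'" using h[of p'] P by (metis homE)
  obtain r where r: "q' = arr (Dom (set_cat elts) p') r (Dom (set_cat elts) v')"
    "r \<in> Dom (set_cat elts) p' \<rightarrow> Dom (set_cat elts) v'" using h[of q'] P by (metis homE)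
  obtain u where u: "u' = arr (Dom (set_cat elts) u') u (Cod (set_cat elts) u')" "Dom (set_cat elts) u' \<in> U" "Cod (set_cat elts) u' \<in> U"
    "u \<in> Dom (set_cat elts) u' \<rightarrow> Cod (set_cat elts) u'" using h[of u'] P by (metis homE)
  obtain v where v: "v' = arr (Dom (set_cat elts) v') v (Cod (set_cat elts) u')" "Dom (set_cat elts) v' \<in> U"
    "v \<in> Dom (set_cat elts) v' \<rightarrow> Cod (set_cat elts) u'" using h[of v'] P by (metis homE)
  let ?Z = "Dom (set_cat elts) p'" and ?N = "Dom (set_cat elts) u'" and ?K = "Dom (set_cat elts) v'" and ?M = "Cod (set_cat elts) u'"
  have "Comp (set_cat elts) (arr ?N u ?M) (arr ?Z q ?N) = Comp (set_cat elts) (arr ?K v ?M) (arr ?Z r ?K)"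
    using P q(1) r(1) u(1) v(1) by metis
  then have c: "u (q z) = v (r z)" if "z \<in> ?Z" for z
    using that unfolding comp_arr[OF q(3)] comp_arr[OF r(2)] arr_eq_iff by blast
  have e: "\<exists>z\<in>?Z. q z = n \<and> r z = k" if n: "n \<in> ?N" and k: "k \<in> ?K" and nk: "u n = v k" for n k
  proof -
    let ?a = "arr one_set (\<lambda>_. n) ?N" and ?b = "arr one_set (\<lambda>_. k) ?K"
    have ab: "?a \<in> hom (set_cat elts) one_set ?N" "?b \<in> hom (set_cat elts) one_set ?K"
      using n k one_U u(2) v(2) unfolding hom_arr by simp_all
    have fa: "(\<lambda>_. n) \<in> one_set \<rightarrow> ?N" "(\<lambda>_. k) \<in> one_set \<rightarrow> ?K" using n k by auto
    have "Comp (set_cat elts) (arr ?N u ?M) ?a = Comp (set_cat elts) (arr ?K v ?M) ?b"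
      unfolding comp_arr[OF fa(1)] comp_arr[OF fa(2)] using nk by simp
    then have "Comp (set_cat elts) u' ?a = Comp (set_cat elts) v' ?b" using u(1) v(1) by metis
    then obtain h where h: "h \<in> hom (set_cat elts) one_set ?Z" "Comp (set_cat elts) p' h = ?a" "Comp (set_cat elts) q' h = ?b"
      using P ab by blast
    obtain g where g: "h = arr one_set g ?Z" "g \<in> one_set \<rightarrow> ?Z" using h(1) by (rule homE)
    have "Comp (set_cat elts) (arr ?Z q ?N) (arr one_set g ?Z) = ?a" "Comp (set_cat elts) (arr ?Z r ?K) (arr one_set g ?Z) = ?b"
      using h(2,3) q(1) r(1) g(1) by metis+
    then have "q (g undefined) = n" "r (g undefined) = k"
      unfolding comp_arr[OF g(2)] arr_eq_iff by (auto simp: one_set_def)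
    moreover have "g undefined \<in> ?Z" using g(2) by (auto simp: one_set_def)
    ultimately show ?thesis by blast
  qed
  show ?thesis by (rule that[OF q(1) r(1) u(1) v(1) q(2) u(2) v(2) u(3) q(3) r(2) u(4) v(3) c e])
qed

text \<open>Each clause is moved to \<open>Pr\<close> along \<open>R\<close>, where stability and
  Beck-Chevalley hold as equations between predicates.\<close>

theorem R1_represented: "R1 X"
  unfolding R1_def base
proof (intro conjI ballI allI impI)
  fix M assume M: "M \<in> Obj (set_cat elts)"
  then have MU: "M \<in> U" by simp
  show "\<exists>\<tau>. is_truth X M \<tau>" using R_surj[OF MU TT_Pr] is_truth_R[OF MU] by blast
  fix \<phi> \<psi> assume ph: "\<phi> \<in> fb M" "\<psi> \<in> fb M"
  show "\<exists>\<mu>. is_meet X M \<phi> \<psi> \<mu>"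
    using R_surj[OF MU MT_Pr[OF R_Pr[OF ph(1)] R_Pr[OF ph(2)]]] is_meet_R[OF ph] by blast
  show "\<exists>\<mu>. is_imp X M \<phi> \<psi> \<mu>"
    using R_surj[OF MU IM_Pr[OF R_Pr[OF ph(1)] R_Pr[OF ph(2)]]] is_imp_R[OF ph] by blast
next
  fix N M u' \<tau> assume u': "u' \<in> hom (set_cat elts) N M" and t: "is_truth X M \<tau>"
  obtain u where u: "u' = arr N u M" "N \<in> U" "M \<in> U" "u \<in> N \<rightarrow> M" using u' by (rule homE)
  have tf: "\<tau> \<in> fb M" "eqv M (R \<tau>) (TT M)" using t is_truth_R[OF u(3)] by auto
  have "eqv N (R (rx N u \<tau>)) (TT N)"
    using eqv_trans[OF R_rx[OF tf(1) u(2,4)] eqv_RE[OF tf(2) u(4)]] RE_TT[OF u(4)] by simp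
  then show "is_truth X N (reindex X u' \<tau>)"
    using is_truth_R[OF u(2)] rx_fb[OF tf(1) u(2,4)] u(1) reindex_rx[OF tf(1)] by simp
next
  fix N M u' \<phi> \<psi> \<mu> assume u': "u' \<in> hom (set_cat elts) N M" and ph: "\<phi> \<in> fb M" "\<psi> \<in> fb M" and m: "is_meet X M \<phi> \<psi> \<mu>"
  obtain u where u: "u' = arr N u M" "N \<in> U" "M \<in> U" "u \<in> N \<rightarrow> M" using u' by (rule homE)
  have mf: "\<mu> \<in> fb M" "eqv M (R \<mu>) (MT M (R \<phi>) (R \<psi>))" using m is_meet_R[OF ph] by auto
  have "eqv N (R (rx N u \<mu>)) (MT N (RE (arr N u M) (R \<phi>)) (RE (arr N u M) (R \<psi>)))"
    using eqv_trans[OF R_rx[OF mf(1) u(2,4)] eqv_RE[OF mf(2) u(4)]] RE_MT[OF u(4)] by simp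
  from eqv_trans[OF this MT_cong[OF R_rx[OF ph(1) u(2,4), THEN eqv_sym] R_rx[OF ph(2) u(2,4), THEN eqv_sym]]]
  show "is_meet X N (reindex X u' \<phi>) (reindex X u' \<psi>) (reindex X u' \<mu>)"
    using is_meet_R[OF rx_fb[OF ph(1) u(2,4)] rx_fb[OF ph(2) u(2,4)]] rx_fb[OF mf(1) u(2,4)] u(1)
      reindex_rx[OF ph(1)] reindex_rx[OF ph(2)] reindex_rx[OF mf(1)] by simp
next
  fix N M u' \<phi> \<psi> \<mu> assume u': "u' \<in> hom (set_cat elts) N M" and ph: "\<phi> \<in> fb M" "\<psi> \<in> fb M" and m: "is_imp X M \<phi> \<psi> \<mu>"
  obtain u where u: "u' = arr N u M" "N \<in> U" "M \<in> U" "u \<in> N \<rightarrow> M" using u' by (rule homE)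
  have mf: "\<mu> \<in> fb M" "eqv M (R \<mu>) (IM M (R \<phi>) (R \<psi>))" using m is_imp_R[OF ph] by auto
  have "eqv N (R (rx N u \<mu>)) (IM N (RE (arr N u M) (R \<phi>)) (RE (arr N u M) (R \<psi>)))"
    using eqv_trans[OF R_rx[OF mf(1) u(2,4)] eqv_RE[OF mf(2) u(4)]] RE_IM[OF u(4)] by simp
  from eqv_trans[OF this IM_cong[OF R_rx[OF ph(1) u(2,4), THEN eqv_sym] R_rx[OF ph(2) u(2,4), THEN eqv_sym]]]
  show "is_imp X N (reindex X u' \<phi>) (reindex X u' \<psi>) (reindex X u' \<mu>)"
    using is_imp_R[OF rx_fb[OF ph(1) u(2,4)] rx_fb[OF ph(2) u(2,4)]] rx_fb[OF mf(1) u(2,4)] u(1)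
      reindex_rx[OF ph(1)] reindex_rx[OF ph(2)] reindex_rx[OF mf(1)] by simp
next
  fix N M u' \<phi> assume u': "u' \<in> hom (set_cat elts) N M" and ph: "\<phi> \<in> fb N"
  obtain u where u: "u' = arr N u M" "N \<in> U" "M \<in> U" "u \<in> N \<rightarrow> M" using u' by (rule homE)
  show "\<exists>\<epsilon>. is_ex X u' \<phi> \<epsilon>" using ex_R[OF ph u(4,3)] is_ex_R[OF ph u(4)] u(1) by blast
  show "\<exists>\<epsilon>. is_all X u' \<phi> \<epsilon>" using all_R[OF ph u(4,3)] is_all_R[OF ph u(4)] u(1) by blast
next
  fix p' q' u' v' \<phi> assume pb: "is_pullback (set_cat elts) p' q' u' v'" and ph': "\<phi> \<in> fb (Dom (set_cat elts) u')"
  obtain Z N K M q r u v where P: "p' = arr Z q N" "q' = arr Z r K" "u' = arr N u M" "v' = arr K v M"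
    "Z \<in> U" "N \<in> U" "K \<in> U" "M \<in> U"
    "q \<in> Z \<rightarrow> N" "r \<in> Z \<rightarrow> K" "u \<in> N \<rightarrow> M" "v \<in> K \<rightarrow> M"
    "\<And>z. z \<in> Z \<Longrightarrow> u (q z) = v (r z)"
    "\<And>n k. n \<in> N \<Longrightarrow> k \<in> K \<Longrightarrow> u n = v k \<Longrightarrow> \<exists>z\<in>Z. q z = n \<and> r z = k"
    using pb by (rule pullbackE) blast
  have ph: "\<phi> \<in> fb N" using ph' P(3) by simp
  note rp = rx_fb[OF ph P(5,9)]
  have "eqv Z (RE (arr Z q N) (R \<phi>)) (R (rx Z q \<phi>))" using R_rx[OF ph P(5,9)] eqv_sym by blast
  note 1 = SX_cong[OF this P(10)] and 2 = AL_cong[OF this P(10)]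
  have se: "RE (arr K v M) (SX N u M (R \<phi>)) = SX Z r K (RE (arr Z q N) (R \<phi>))"
    by (rule RE_SX[OF P(11,12,9,10)]) (rule P(13), assumption, rule P(14))
  have ae: "RE (arr K v M) (AL N u M (R \<phi>)) = AL Z r K (RE (arr Z q N) (R \<phi>))"
    by (rule RE_AL[OF P(11,12,9,10)]) (rule P(13), assumption, rule P(14))
  note e = ex_R[OF ph P(11,8)] and e' = ex_R[OF rp P(10,7)]
  have "eqv K (R (rx K v (ex X (arr N u M) \<phi>))) (SX Z r K (RE (arr Z q N) (R \<phi>)))"
    using eqv_trans[OF R_rx[OF e(1) P(7,12)] eqv_RE[OF e(2) P(12)]] unfolding se .
  from eqv_trans[OF eqv_trans[OF this 1] eqv_sym[OF e'(2)]]
  show "fiso X (reindex X v' (ex X u' \<phi>)) (ex X q' (reindex X p' \<phi>))"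
    using R_fiso[OF rx_fb[OF e(1) P(7,12)] e'(1)] reindex_rx[OF e(1)] reindex_rx[OF ph] P(1-4) by simp
  note a = all_R[OF ph P(11,8)] and a' = all_R[OF rp P(10,7)]
  have "eqv K (R (rx K v (univ X (arr N u M) \<phi>))) (AL Z r K (RE (arr Z q N) (R \<phi>)))"
    using eqv_trans[OF R_rx[OF a(1) P(7,12)] eqv_RE[OF a(2) P(12)]] unfolding ae .
  from eqv_trans[OF eqv_trans[OF this 2] eqv_sym[OF a'(2)]]
  show "fiso X (reindex X v' (univ X u' \<phi>)) (univ X q' (reindex X p' \<phi>))"
    using R_fiso[OF rx_fb[OF a(1) P(7,12)] a'(1)] reindex_rx[OF a(1)] reindex_rx[OF ph] P(1-4) by simp
qed

end

section \<open>The characterization\<close>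

context represented
begin

section \<open>Singleton predicates as a generating family\<close>

definition sing :: "('v \<Rightarrow> 'v) \<Rightarrow> 'v \<Rightarrow> 'v set \<Rightarrow> 'v \<times> ('v \<Rightarrow> 'v set)" where
  "sing g i M = (i, \<lambda>m\<in>M. {g m})"

definition elem :: "'v \<Rightarrow> 'o" where
  "elem i = (SOME x. x \<in> fb (B i) \<and> eqv (B i) (R x) (sing (\<lambda>b. b) i (B i)))"

abbreviation G :: "'o set" where "G \<equiv> generated X J B elem"

lemma sing_Pr: "i \<in> J \<Longrightarrow> g \<in> M \<rightarrow> B i \<Longrightarrow> sing g i M \<in> Pr M"
  by (auto simp: sing_def Pr_def)

lemma elem: assumes i: "i \<in> J" shows "elem i \<in> fb (B i)" "eqv (B i) (R (elem i)) (sing (\<lambda>b. b) i (B i))"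
proof -
  have "\<exists>x. x \<in> fb (B i) \<and> eqv (B i) (R x) (sing (\<lambda>b. b) i (B i))"
    using R_surj[OF B_U[OF i] sing_Pr[OF i, of "\<lambda>b. b"]] by auto
  from someI_ex[OF this, folded elem_def]
  show "elem i \<in> fb (B i)" "eqv (B i) (R (elem i)) (sing (\<lambda>b. b) i (B i))" by auto
qed

lemma RE_sing: "u \<in> N \<rightarrow> M \<Longrightarrow> RE (arr N u M) (sing g i M) = sing (\<lambda>n. g (u n)) i N"
  unfolding RE_arr sing_def by (auto simp: Pi_iff intro!: restrict_ext)

lemma le_sing: "le M (sing g i M) (sing h j M) \<longleftrightarrow> (\<exists>e\<in>B (i \<rightharpoondown> j). \<forall>m\<in>M. ap i j e (g m) = Some (h m))"
  by (simp add: le_def sing_def)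

lemma R_rx_elem:
  assumes "i \<in> J" "N \<in> U" "f \<in> N \<rightarrow> B i" shows "eqv N (R (rx N f (elem i))) (sing f i N)"
  using eqv_trans[OF R_rx[OF elem(1)[OF assms(1)] assms(2,3)] eqv_RE[OF elem(2)[OF assms(1)] assms(3)]]
    RE_sing[OF assms(3)] by simp

lemma G_iff:
  assumes ph: "\<phi> \<in> fb M"
  shows "\<phi> \<in> G \<longleftrightarrow> (\<exists>i\<in>J. \<exists>g\<in>M \<rightarrow> B i. eqv M (R \<phi>) (sing g i M))"
proof -
  have M: "M \<in> U" using fbD(3)[OF ph] .
  have k: "fiso X \<phi> (reindex X (arr M g (B i)) (elem i)) \<longleftrightarrow> eqv M (R \<phi>) (sing g i M)"
    if i: "i \<in> J" and g: "g \<in> M \<rightarrow> B i" for i g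
    unfolding reindex_rx[OF elem(1)[OF i]] R_fiso[OF ph rx_fb[OF elem(1)[OF i] M g]]
    using R_rx_elem[OF i M g] eqv_trans eqv_sym by blast
  have "(\<exists>f\<in>hom (set_cat elts) M (B i). fiso X \<phi> (reindex X f (elem i))) \<longleftrightarrow>
     (\<exists>g\<in>M \<rightarrow> B i. eqv M (R \<phi>) (sing g i M))" if i: "i \<in> J" for i
  proof
    assume "\<exists>f\<in>hom (set_cat elts) M (B i). fiso X \<phi> (reindex X f (elem i))"
    then obtain f where f: "f \<in> hom (set_cat elts) M (B i)" "fiso X \<phi> (reindex X f (elem i))" by blast
    obtain g where "f = arr M g (B i)" "g \<in> M \<rightarrow> B i" using f(1) by (rule homE)
    then show "\<exists>g\<in>M \<rightarrow> B i. eqv M (R \<phi>) (sing g i M)" using k[OF i] f(2) by blast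
  next
    assume "\<exists>g\<in>M \<rightarrow> B i. eqv M (R \<phi>) (sing g i M)"
    then obtain g where g: "g \<in> M \<rightarrow> B i" "eqv M (R \<phi>) (sing g i M)" by blast
    have "arr M g (B i) \<in> hom (set_cat elts) M (B i)" using M B_U[OF i] g(1) by simp
    then show "\<exists>f\<in>hom (set_cat elts) M (B i). fiso X \<phi> (reindex X f (elem i))" using k[OF i g(1)] g(2) by blast
  qed
  then show ?thesis unfolding generated_def base using fbD(1,2)[OF ph] by auto
qed

text \<open>As there is exactly one realizer at each point, the realizer of the inequality finds a
  witness over each \<open>n\<close>. Choosing one gives a section \<open>w\<close> of
  \<open>v\<close>, so the identity serves as the cover.\<close>

lemma elem_prime: assumes i: "i \<in> J" shows "ex_prime X (B i) (elem i)"
  unfolding ex_prime_def base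
proof (intro conjI allI ballI impI)
  show "elem i \<in> fb (B i)" using elem(1)[OF i] .
  fix N K u' v' \<theta>
  assume u': "u' \<in> hom (set_cat elts) N (B i)" and v': "v' \<in> hom (set_cat elts) K N" and th: "\<theta> \<in> fb K"
    and le: "fle X (reindex X u' (elem i)) (ex X v' \<theta>)"
  obtain u where u: "u' = arr N u (B i)" "N \<in> U" "u \<in> N \<rightarrow> B i" using u' by (rule homE)
  obtain v where v: "v' = arr K v N" "K \<in> U" "v \<in> K \<rightarrow> N" using v' by (rule homE)
  note r = rx_fb[OF elem(1)[OF i] u(2,3)] and x = ex_R[OF th v(3) u(2)]
  have "le N (R (rx N u (elem i))) (R (ex X (arr K v N) \<theta>))"
    using le R_fle[OF r x(1)] u(1) v(1) reindex_rx[OF elem(1)[OF i]] by simp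
  then have "le N (sing u i N) (SX K v N (R \<theta>))" using eqv_le[OF R_rx_elem[OF i u(2,3)] x(2)] by blast
  then obtain e where e: "e \<in> B (i \<rightharpoondown> fst (R \<theta>))"
    "\<And>n. n \<in> N \<Longrightarrow> \<exists>k\<in>K. v k = n \<and> (\<exists>y\<in>snd (R \<theta>) k. ap i (fst (R \<theta>)) e (u n) = Some y)"
    unfolding le_def sing_def SX_def by fastforce
  then obtain w where w: "\<And>n. n \<in> N \<Longrightarrow> w n \<in> K \<and> v (w n) = n \<and> (\<exists>y\<in>snd (R \<theta>) (w n). ap i (fst (R \<theta>)) e (u n) = Some y)"
    by metis
  have wf: "w \<in> N \<rightarrow> K" using w by blast
  have rw: "rx N w \<theta> \<in> fb N" using rx_fb[OF th u(2) wf] .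
  have "le N (sing u i N) (RE (arr N w K) (R \<theta>))"
    unfolding le_RE[OF wf] using e(1) w by (auto simp: sing_def)
  then have "le N (R (rx N u (elem i))) (R (rx N w \<theta>))"
    using eqv_le[OF R_rx_elem[OF i u(2,3)] R_rx[OF th u(2) wf]] by blast
  then have fin: "fle X (rx N u (elem i)) (rx N w \<theta>)" using R_fle[OF r rw] by blast
  have c: "Comp (set_cat elts) v' (arr N w K) = arr N (\<lambda>n. n) N"
    unfolding v(1) comp_arr[OF wf] by (rule arr_cong) (use w in blast)
  have c': "Comp (set_cat elts) u' (arr N (\<lambda>n. n) N) = arr N u (B i)" unfolding u(1) by simp
  show "\<exists>L. \<exists>e\<in>hom (set_cat elts) L N. \<exists>w\<in>hom (set_cat elts) L K.
           surjection e \<and> Comp (set_cat elts) v' w = e \<and>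
           fle X (reindex X (Comp (set_cat elts) u' e) (elem i)) (reindex X w \<theta>)"
    by (rule exI[of _ N], rule bexI[of _ "arr N (\<lambda>n. n) N"], rule bexI[of _ "arr N w K"])
      (use c c' fin wf u(2) v(2) reindex_rx[OF elem(1)[OF i]] reindex_rx[OF th] in simp_all)
qed

text \<open>Truth and conjunction preserve having exactly one realizer at each point.\<close>

lemma G_meets: "closed_under_finite_meets X G"
  unfolding closed_under_finite_meets_def base set_cat_sel
proof (intro ballI conjI allI impI)
  fix M \<tau> assume M: "M \<in> U" and t: "is_truth X M \<tau>"
  then have tf: "\<tau> \<in> fb M" "eqv M (R \<tau>) (TT M)" using is_truth_R by auto
  have "TT M = sing (\<lambda>_. c0) t0 M" by (simp add: TT_def sing_def)
  moreover have "(\<lambda>_. c0) \<in> M \<rightarrow> B t0" using t0 by auto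
  ultimately show "\<tau> \<in> G" unfolding G_iff[OF tf(1)] using tf(2) t0(1) by auto
next
  fix M \<phi> \<psi> \<mu> assume M: "M \<in> U" and ph: "\<phi> \<in> G \<inter> fb M" "\<psi> \<in> G \<inter> fb M" and m: "is_meet X M \<phi> \<psi> \<mu>"
  then have f: "\<phi> \<in> fb M" "\<psi> \<in> fb M" by auto
  have mf: "\<mu> \<in> fb M" "eqv M (R \<mu>) (MT M (R \<phi>) (R \<psi>))" using m is_meet_R[OF f] by auto
  obtain i g where g: "i \<in> J" "g \<in> M \<rightarrow> B i" "eqv M (R \<phi>) (sing g i M)" using ph(1) G_iff[OF f(1)] by blast
  obtain j h where h: "j \<in> J" "h \<in> M \<rightarrow> B j" "eqv M (R \<psi>) (sing h j M)" using ph(2) G_iff[OF f(2)] by blast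
  have "MT M (sing g i M) (sing h j M) = sing (\<lambda>m. PR i j (g m) (h m)) (tprod T i j) M"
    by (auto simp: MT_def sing_def intro!: restrict_ext)
  then have "eqv M (R \<mu>) (sing (\<lambda>m. PR i j (g m) (h m)) (tprod T i j) M)"
    using eqv_trans[OF mf(2) MT_cong[OF g(3) h(3)]] by simp
  moreover have "(\<lambda>m. PR i j (g m) (h m)) \<in> M \<rightarrow> B (tprod T i j)"
    using PR_B[OF g(1) h(1)] g(2) h(2) by blast
  ultimately show "\<mu> \<in> G" unfolding G_iff[OF mf(1)] using tprod_J[OF g(1) h(1)] by blast
qed

text \<open>The realizer \<open>d\<close> computes \<open>f k\<close> from the single realizer
  \<open>g (e k)\<close> of \<phi> at \<open>e k\<close>, so \<open>f k\<close> depends on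
  \<open>e k\<close> only; \<open>h\<close> reads off the value of \<open>d\<close>.\<close>

lemma elem_modest: assumes i: "i \<in> J" shows "modest_in X G (B i) (elem i)"
  unfolding modest_in_def base
proof (intro conjI allI ballI impI)
  have "elem i \<in> G" unfolding G_iff[OF elem(1)[OF i]] using elem(2)[OF i] i by blast
  then show "elem i \<in> G \<inter> fb (B i)" using elem(1)[OF i] by blast
next
  fix N K e' f' \<phi>
  assume e': "e' \<in> hom (set_cat elts) K N" and f': "f' \<in> hom (set_cat elts) K (B i)" and ph: "\<phi> \<in> G \<inter> fb N"
    and s: "surjection e' \<and> fle X (reindex X e' \<phi>) (reindex X f' (elem i))"
  obtain e where e: "e' = arr K e N" "K \<in> U" "N \<in> U" "e \<in> K \<rightarrow> N" using e' by (rule homE)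
  obtain f where f: "f' = arr K f (B i)" "f \<in> K \<rightarrow> B i" using f' by (rule homE)
  have sur: "e ` K = N" using s e(1) by simp
  have pf: "\<phi> \<in> fb N" using ph by blast
  obtain l g where g: "l \<in> J" "g \<in> N \<rightarrow> B l" "eqv N (R \<phi>) (sing g l N)" using ph G_iff[OF pf] by blast
  have "fle X (rx K e \<phi>) (rx K f (elem i))" using s e(1) f(1) reindex_rx[OF pf] reindex_rx[OF elem(1)[OF i]] by simp
  then have 1: "le K (R (rx K e \<phi>)) (R (rx K f (elem i)))"
    using R_fle[OF rx_fb[OF pf e(2,4)] rx_fb[OF elem(1)[OF i] e(2) f(2)]] by blast
  have "eqv K (R (rx K e \<phi>)) (sing (\<lambda>k. g (e k)) l K)"
    using eqv_trans[OF R_rx[OF pf e(2,4)] eqv_RE[OF g(3) e(4)]] RE_sing[OF e(4)] by simp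
  then have "le K (sing (\<lambda>k. g (e k)) l K) (sing f i K)" using 1 eqv_le[OF _ R_rx_elem[OF i e(2) f(2)]] by blast
  then obtain d where d: "d \<in> B (l \<rightharpoondown> i)" "\<And>k. k \<in> K \<Longrightarrow> ap l i d (g (e k)) = Some (f k)" unfolding le_sing by blast
  define h where "h n = the (ap l i d (g n))" for n
  have he: "h (e k) = f k" if "k \<in> K" for k using d(2)[OF that] by (simp add: h_def)
  have hd: "ap l i d (g n) = Some (h n) \<and> h n \<in> B i" if n: "n \<in> N" for n
  proof -
    obtain k where k: "k \<in> K" "n = e k" using sur n by blast
    then show ?thesis using d(2) he f(2) by auto
  qed
  have hf: "h \<in> N \<rightarrow> B i" using hd by blast
  have "le N (sing g l N) (sing h i N)" unfolding le_sing using d(1) hd by blast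
  then have "le N (R \<phi>) (R (rx N h (elem i)))" using eqv_le[OF g(3) R_rx_elem[OF i e(3) hf]] by blast
  then have "fle X \<phi> (rx N h (elem i))" using R_fle[OF pf rx_fb[OF elem(1)[OF i] e(3) hf]] by blast
  moreover have "Comp (set_cat elts) (arr N h (B i)) e' = f'"
    unfolding e(1) f(1) comp_arr[OF e(4)] by (rule arr_cong) (rule he)
  ultimately show "\<exists>h\<in>hom (set_cat elts) N (B i). Comp (set_cat elts) h e' = f' \<and> fle X \<phi> (reindex X h (elem i))"
    using hf e(3) B_U[OF i] reindex_rx[OF elem(1)[OF i]] by (intro bexI[of _ "arr N h (B i)"]) simp_all
qed

lemma R2_family_elem: "R2_family X J B elem"
  unfolding R2_family_def base set_cat_sel
proof (intro conjI ballI)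
  fix M \<phi> assume M: "M \<in> U" and ph: "\<phi> \<in> fb M"
  \<comment> \<open>The total space of the predicate: pairs of a point and a realizer. The singleton
    predicate of the second component, summed along the first, gives back the predicate.\<close>
  let ?a = "R \<phi>" and ?N = "sig M (snd (R \<phi>))"
  have a: "?a \<in> Pr M" using R_Pr[OF ph] .
  have i: "fst ?a \<in> J" using Pr_J[OF a] .
  have N: "?N \<in> U" by (rule sig_U[OF M]) (rule sep_U[OF B_U[OF i]], use Pr_B[OF a] in blast)
  have f: "pfst \<in> ?N \<rightarrow> M" by (auto dest: sig_fst)
  have g: "psnd \<in> ?N \<rightarrow> B (fst ?a)" using sig_fst sig_snd Pr_B[OF a] by blast
  obtain \<psi> where ps: "\<psi> \<in> fb ?N" "eqv ?N (R \<psi>) (sing psnd (fst ?a) ?N)" using R_surj[OF N sing_Pr[OF i g]] by blast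
  have G: "\<psi> \<in> G" unfolding G_iff[OF ps(1)] using i g ps(2) by blast
  have "(\<Union>n\<in>{n \<in> ?N. pfst n = m}. {psnd n}) = snd ?a m" if "m \<in> M" for m
  proof
    show "snd ?a m \<subseteq> (\<Union>n\<in>{n \<in> ?N. pfst n = m}. {psnd n})"
      using that by (auto intro!: exI[of _ "kpair m _"])
  qed (auto elim!: sigE)
  then have "(\<lambda>m\<in>M. \<Union>n\<in>{n \<in> ?N. pfst n = m}. {psnd n}) = snd ?a"
    using a by (auto simp: Pr_def PiE_def extensional_def fun_eq_iff)
  moreover have "SX ?N pfst M (sing psnd (fst ?a) ?N) = (fst ?a, \<lambda>m\<in>M. \<Union>n\<in>{n \<in> ?N. pfst n = m}. {psnd n})"
    by (simp add: SX_def sing_def)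
  ultimately have eq: "SX ?N pfst M (sing psnd (fst ?a) ?N) = ?a" by simp
  have "eqv M (R (ex X (arr ?N pfst M) \<psi>)) ?a"
    using eqv_trans[OF ex_R(2)[OF ps(1) f M] SX_cong[OF ps(2) f]] eq by simp
  then have "fiso X \<phi> (ex X (arr ?N pfst M) \<psi>)" using R_fiso[OF ph ex_R(1)[OF ps(1) f M]] eqv_sym by blast
  moreover have "arr ?N pfst M \<in> hom (set_cat elts) ?N M" using N M f by simp
  ultimately show "\<exists>N. \<exists>u\<in>hom (set_cat elts) N M. \<exists>\<psi>\<in>G \<inter> fb N. fiso X \<phi> (ex X u \<psi>)" using G ps(1) by blast
qed (use T_types B_U elem_prime G_meets elem_modest in auto)

sublocale prim elts X J B elem
  by unfold_locales (rule R1_represented, rule R2_family_elem)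

text \<open>A point \<open>a\<close> of \<open>B i\<close> is true because the constant function
  with value \<open>a\<close> has a realizer.\<close>

lemma gamma_iso_pi_represented: "gamma_iso_pi X"
  unfolding gamma_iso_pi_iff
proof (intro ballI)
  fix i a assume i: "i \<in> J" and a: "a \<in> B i"
  let ?t = "tt one_set"
  have t: "?t \<in> fb one_set" using tt_fb[OF one_U] .
  have f: "(\<lambda>_. a) \<in> one_set \<rightarrow> B i" using a by auto
  obtain e where e: "e \<in> B (fst (R ?t) \<rightharpoondown> i)" "\<forall>y\<in>B (fst (R ?t)). ap (fst (R ?t)) i e y = Some a"
    using const1[OF i Pr_J[OF R_Pr[OF t]] a] by blast
  then have "le one_set (R ?t) (sing (\<lambda>_. a) i one_set)"
    unfolding le_def sing_def using Pr_B[OF R_Pr[OF t]] by (intro bexI[of _ e]) auto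
  then have "le one_set (R ?t) (R (rx one_set (\<lambda>_. a) (elem i)))"
    using eqv_le[OF eqv_refl[OF R_Pr[OF t]] R_rx_elem[OF i one_U f]] by blast
  then have "fle X ?t (rx one_set (\<lambda>_. a) (elem i))" using R_fle[OF t rx_fb[OF elem(1)[OF i] one_U f]] by blast
  then show "L ?t (\<lambda>_. a) (elem i)" using fle_rx[OF t elem(1)[OF i] f] by blast
qed

end

context set_fib
begin

lemma hyperdoctrine_properties:
  assumes T: "typed_pca (set_cat elts) T"
    and eq: "fibered_equivalent X (realizability_hyperdoctrine (set_cat elts) T)"
  shows "R1 X \<and> R2 X \<and> gamma_iso_pi X"
proof -
  interpret tp elts T by unfold_locales (rule T)
  let ?Y = "grothendieck (set_cat elts) Pr le RE"
  interpret Y: faithful_fib ?Y by (rule faithful_fib_RH)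
  have ff: "faithful_fib X" by unfold_locales
  obtain F where F: "\<And>x. x \<in> Obj (Total X) \<Longrightarrow> F x \<in> Obj (Total ?Y) \<and> on_obj (Proj ?Y) (F x) = p x"
    "\<And>x u y. x \<in> Obj (Total X) \<Longrightarrow> y \<in> Obj (Total X) \<Longrightarrow> over X x u y \<longleftrightarrow> over ?Y (F x) u (F y)"
    "\<And>y. y \<in> Obj (Total ?Y) \<Longrightarrow> \<exists>x\<in>Obj (Total X). p x = on_obj (Proj ?Y) y \<and>
       over ?Y y (Ident (Base ?Y) (on_obj (Proj ?Y) y)) (F x) \<and>
       over ?Y (F x) (Ident (Base ?Y) (on_obj (Proj ?Y) y)) y"
    by (rule fibered_equivalentE[OF ff faithful_fib_RH eq[unfolded RH_eq]]) blast
  have FR: "\<exists>a\<in>Pr M. F x = (M, a)" if "x \<in> fb M" for x M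
    using F(1)[OF fbD(2)[OF that]] fbD(1)[OF that] by (cases "F x") auto
  \<comment> \<open>\<open>F\<close> preserves the underlying set, so \<open>snd (F x)\<close> is a
    realizability predicate on the set of \<open>x\<close>.\<close>
  interpret represented elts X T "\<lambda>x. snd (F x)"
  proof unfold_locales
    fix x M assume "x \<in> fb M"
    then show "snd (F x) \<in> Pr M" using FR by force
  next
    fix x N y M f assume x: "x \<in> fb N" and y: "y \<in> fb M" and f: "f \<in> N \<rightarrow> M"
    obtain a b where ab: "F x = (N, a)" "a \<in> Pr N" "F y = (M, b)" "b \<in> Pr M" using FR[OF x] FR[OF y] by blast
    have "L x f y \<longleftrightarrow> over ?Y (F x) (arr N f M) (F y)"
      using F(2)[OF fbD(2)[OF x] fbD(2)[OF y], of "arr N f M"] fbD(1)[OF x] fbD(1)[OF y] by (simp add: L_def)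
    then show "L x f y \<longleftrightarrow> le N (snd (F x)) (RE (arr N f M) (snd (F y)))"
      using ab f fbD(3)[OF x] fbD(3)[OF y] by (simp add: over_grothendieck)
  next
    fix M a assume M: "M \<in> U" and a: "a \<in> Pr M"
    then have "(M, a) \<in> Obj (Total ?Y)" by simp
    from F(3)[OF this] obtain x where x: "x \<in> Obj (Total X)" "p x = M"
      "over ?Y (M, a) (arr M (\<lambda>x. x) M) (F x)" "over ?Y (F x) (arr M (\<lambda>x. x) M) (M, a)" by auto
    have xf: "x \<in> fb M" using x fbI by blast
    obtain b where b: "F x = (M, b)" "b \<in> Pr M" using FR[OF xf] by blast
    have "eqv M (snd (F x)) a"
      using x(3,4) b RE_id[OF a] RE_id[OF b(2)] a by (simp add: eqv_def over_grothendieck)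
    then show "\<exists>x\<in>fb M. eqv M (snd (F x)) a" using xf by blast
  qed
  show ?thesis using R1_represented R2_family_elem gamma_iso_pi_represented unfolding R2_def by blast
qed

end

theorem corollary4p11p3:
  fixes elts :: "'v \<Rightarrow> 'v set" and X :: "('o, 'a, 'v) setfib"
  assumes "set_universe elts"
    and "Base X = set_cat elts"
    and "posetal_fibration X"
    and "pre_stack X"
  shows "((\<exists>T. typed_pca (set_cat elts) T \<and>
              fibered_equivalent X (realizability_hyperdoctrine (set_cat elts) T))
            \<longleftrightarrow> R1 X \<and> R2 X \<and> gamma_iso_pi X)
       \<and> (R1 X \<and> R2 X \<and> gamma_iso_pi X \<and> (\<exists>i A \<pi>. R2_family X {i} A \<pi>) \<longrightarrow>
            (\<exists>Q. is_pca (set_cat elts) Q \<and>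
              fibered_equivalent X (realizability_tripos (set_cat elts) Q)))"
proof -
  interpret set_fib elts X by unfold_locales (rule assms)+
  \<comment> \<open>Stated for an arbitrary family, since the two items start from different ones:
    the second from a family with a single index.\<close>
  have realiz: "realiz elts X I A \<pi>" if "R1 X" "R2_family X I A \<pi>" "gamma_iso_pi X" for I A \<pi>
  proof -
    interpret prim elts X I A \<pi> by unfold_locales (rule that)+
    show ?thesis by unfold_locales (use that(3) gamma_iso_pi_iff in blast)
  qed
  show ?thesis
  proof (intro conjI iffI impI)
    assume "\<exists>T. typed_pca (set_cat elts) T \<and> fibered_equivalent X (realizability_hyperdoctrine (set_cat elts) T)"
    then show "R1 X" "R2 X" "gamma_iso_pi X" using hyperdoctrine_properties by blast+
  next
    assume a: "R1 X \<and> R2 X \<and> gamma_iso_pi X"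
    then obtain I A \<pi> where "R2_family X I A \<pi>" by (auto simp: R2_def)
    then interpret realiz elts X I A \<pi> using realiz a by blast
    show "\<exists>T. typed_pca (set_cat elts) T \<and> fibered_equivalent X (realizability_hyperdoctrine (set_cat elts) T)"
      using typed_pca_rpca equivalent_hyperdoctrine by blast
  next
    assume a: "R1 X \<and> R2 X \<and> gamma_iso_pi X \<and> (\<exists>i A \<pi>. R2_family X {i} A \<pi>)"
    then obtain i A \<pi> where "R2_family X {i} A \<pi>" by blast
    then interpret realiz elts X "{i}" A \<pi> using realiz a by blast
    show "\<exists>Q. is_pca (set_cat elts) Q \<and> fibered_equivalent X (realizability_tripos (set_cat elts) Q)"
      using is_pca_rone[OF refl] equivalent_tripos[OF refl] by blast
  qed
qed

end
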